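(* Let the ambient manifold be the hyperbolic space $\mathcal{M}=\mathbb{H}^n$ with its hyperbolic metric $g$, and let $\mathcal{N}$ be a single point of $\mathbb{H}^n$. Then for every geodesic $\gamma$ in the condition metric $g_\kappa=d(\cdot,\mathcal{N})^{-2}g$ on $\mathbb{H}^n\setminus\mathcal{N}$, the function $$t\mapsto\log\left(\frac{1}{d(\gamma(t),\mathcal{N})}\right)$$ is concave. Moreover, if $\gamma'(t)$ does not point towards the point $\mathcal{N}$, then the function is strictly concave at $t$. Thus in this case the self-convexity property is not satisfied.
   Context: $\mathbb{H}^n$ is the $n$-dimensional hyperbolic space, i.e. the complete simply connected Riemannian manifold of constant sectional curvature $-1$. For a Riemannian manifold $(\mathcal{M},g)$ and a $\mathcal{C}^2$ submanifold $\mathcal{N}\subset\mathcal{M}$ without boundary, the condition metric on $\mathcal{M}\setminus\mathcal{N}$ is $g_{x,\kappa}=d(x,\mathcal{N})^{-2}g_x$, where $d(x,\mathcal{N})$ is the Riemannian distance with respect to $g$ from $x$ to $\mathcal{N}$. The length of a Lipschitz curve $\gamma:I\to\mathcal{M}\setminus\mathcal{N}$ in the condition metric is $L_\kappa(\gamma)=\int_I\|\dot\gamma(t)\|\,d(\gamma(t),\mathcal{N})^{-1}\,dt$, where $\|\cdot\|$ is the norm of $g$. A curve $\gamma:[a,b]\to\mathcal{M}\setminus\mathcal{N}$ parametrized by arc length (with this notion of arc length) is a minimizing geodesic in the condition metric if $L_\kappa(\gamma)\le L_\kappa(c)$ for every Lipschitz curve $c:[a,b]\to\mathcal{M}\setminus\mathcal{N}$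 with $c(a)=\gamma(a)$ and $c(b)=\gamma(b)$. A geodesic in the condition metric is a curve that is locally a minimizing geodesic. The self-convexity property is satisfied for $(\mathcal{M},\mathcal{N})$ if the function $t\mapsto\log\frac{1}{d(\gamma(t),\mathcal{N})}$ is convex for every geodesic $\gamma$ in the condition metric.
   Formalization: Strict concavity at t is stated when γ'(t) points neither towards nor directly away from the point N (along outward radial geodesics the function is affine), and the failure of self-convexity is stated for n ≥ 2 (for n = 1 the function is affine along all geodesics). *)

theory Defs
  imports "HOL-Analysis.Analysis"
begin

text \<open>
  Riemannian manifolds covered by one chart: an open set \<open>U\<close> of a Euclidean space together with a
  field \<open>g\<close> of inner products, \<open>g x u v\<close> being the product at \<open>x\<close> of the tangent vectors \<open>u\<close>, \<open>v\<close>.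
\<close>

type_synonym 'a metric_field = "'a \<Rightarrow> 'a \<Rightarrow> 'a \<Rightarrow> real"

text \<open>
  On a compact parameter interval, a curve in \<open>U\<close> is Lipschitz for the Riemannian distance if and
  only if it is Lipschitz for the Euclidean distance of the chart.
\<close>

definition lipschitz_curve :: "'a::euclidean_space set \<Rightarrow> real \<Rightarrow> real \<Rightarrow> (real \<Rightarrow> 'a) \<Rightarrow> bool" where
  "lipschitz_curve U a b c \<longleftrightarrow> c ` {a..b} \<subseteq> U \<and> (\<exists>C. C-lipschitz_on {a..b} c)"

text \<open>
  A Lipschitz curve is differentiable almost everywhere, and \<open>integral\<close> ignores the null set on
  which \<open>vector_derivative\<close> is unspecified.
\<close>

definition curve_length ::
  "'a::euclidean_space metric_field \<Rightarrow> real \<Rightarrow> real \<Rightarrow> (real \<Rightarrow> 'a) \<Rightarrow> real" where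
  "curve_length g a b c =
     integral {a..b}
       (\<lambda>t. sqrt (g (c t) (vector_derivative c (at t)) (vector_derivative c (at t))))"

text \<open>
  The infimum is over Lipschitz rather than piecewise \<open>C\<^sup>1\<close> curves: \<open>valid_path\<close> admits curves of
  infinite length, on which \<open>integral\<close> would return 0.
\<close>

definition riem_dist ::
  "'a::euclidean_space set \<Rightarrow> 'a metric_field \<Rightarrow> 'a \<Rightarrow> 'a \<Rightarrow> real" where
  "riem_dist U g x y = Inf {curve_length g 0 1 c |c. lipschitz_curve U 0 1 c \<and> c 0 = x \<and> c 1 = y}"

definition riem_setdist ::
  "'a::euclidean_space set \<Rightarrow> 'a metric_field \<Rightarrow> 'a \<Rightarrow> 'a set \<Rightarrow> real" where
  "riem_setdist U g x N = (INF y\<in>N. riem_dist U g x y)"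

definition condition_metric ::
  "'a::euclidean_space set \<Rightarrow> 'a metric_field \<Rightarrow> 'a set \<Rightarrow> 'a metric_field" where
  "condition_metric U g N x u v = g x u v / (riem_setdist U g x N)\<^sup>2"

definition minimizing_geodesic ::
  "'a::euclidean_space set \<Rightarrow> 'a metric_field \<Rightarrow> real \<Rightarrow> real \<Rightarrow> (real \<Rightarrow> 'a) \<Rightarrow> bool" where
  "minimizing_geodesic U g a b \<gamma> \<longleftrightarrow>
     lipschitz_curve U a b \<gamma> \<and>
     (\<forall>s t. a \<le> s \<and> s \<le> t \<and> t \<le> b \<longrightarrow> curve_length g s t \<gamma> = t - s) \<and>
     (\<forall>c. lipschitz_curve U a b c \<and> c a = \<gamma> a \<and> c b = \<gamma> b \<longrightarrow>
          curve_length g a b \<gamma> \<le> curve_length g a b c)"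

definition geodesic ::
  "'a::euclidean_space set \<Rightarrow> 'a metric_field \<Rightarrow> real set \<Rightarrow> (real \<Rightarrow> 'a) \<Rightarrow> bool" where
  "geodesic U g I \<gamma> \<longleftrightarrow>
     is_interval I \<and> \<gamma> ` I \<subseteq> U \<and>
     (\<forall>t\<in>I. \<exists>\<epsilon>>0. \<forall>a\<in>I \<inter> ball t \<epsilon>. \<forall>b\<in>I \<inter> ball t \<epsilon>.
        a < b \<longrightarrow> minimizing_geodesic U g a b \<gamma>)"

definition condition_geodesic ::
  "'a::euclidean_space set \<Rightarrow> 'a metric_field \<Rightarrow> 'a set \<Rightarrow> real set \<Rightarrow> (real \<Rightarrow> 'a) \<Rightarrow> bool" where
  "condition_geodesic U g N I \<gamma> \<longleftrightarrow> geodesic (U - N) (condition_metric U g N) I \<gamma>"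

definition log_condition ::
  "'a::euclidean_space set \<Rightarrow> 'a metric_field \<Rightarrow> 'a set \<Rightarrow> 'a \<Rightarrow> real" where
  "log_condition U g N x = ln (1 / riem_setdist U g x N)"

definition self_convexity ::
  "'a::euclidean_space set \<Rightarrow> 'a metric_field \<Rightarrow> 'a set \<Rightarrow> bool" where
  "self_convexity U g N \<longleftrightarrow>
     (\<forall>I \<gamma>. condition_geodesic U g N I \<gamma> \<longrightarrow> convex_on I (\<lambda>t. log_condition U g N (\<gamma> t)))"

definition strictly_concave_on :: "real set \<Rightarrow> (real \<Rightarrow> real) \<Rightarrow> bool" where
  "strictly_concave_on S f \<longleftrightarrow>
     convex S \<and>
     (\<forall>x\<in>S. \<forall>y\<in>S. \<forall>u>0. \<forall>v>0. x \<noteq> y \<and> u + v = 1 \<longrightarrow>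
        u * f x + v * f y < f (u * x + v * y))"

definition strictly_concave_at :: "real set \<Rightarrow> (real \<Rightarrow> real) \<Rightarrow> real \<Rightarrow> bool" where
  "strictly_concave_at I f t \<longleftrightarrow> (\<exists>\<epsilon>>0. strictly_concave_on (I \<inter> ball t \<epsilon>) f)"

text \<open>
  The tangent vector \<open>v\<close> at \<open>x\<close> lies on the tangent line of a shortest unit-speed curve \<open>c\<close> from
  \<open>x\<close> to \<open>p\<close>. The sign of \<open>k\<close> is not restricted: if \<open>v\<close> points straight away from \<open>p\<close>, the
  geodesic of the condition metric through \<open>x\<close> with velocity \<open>v\<close> runs along a ray issuing from
  \<open>p\<close>, just as when \<open>v\<close> points straight at \<open>p\<close>, and in both cases the logarithm of the distance
  to \<open>p\<close> is affine along it.
\<close>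

definition directed_along_segment ::
  "'a::euclidean_space set \<Rightarrow> 'a metric_field \<Rightarrow> 'a \<Rightarrow> 'a \<Rightarrow> 'a \<Rightarrow> bool" where
  "directed_along_segment U g p x v \<longleftrightarrow>
     (\<exists>L c w k. L > 0 \<and> c ` {0..L} \<subseteq> U \<and> c 0 = x \<and> c L = p \<and>
        (\<forall>s\<in>{0..L}. \<forall>t\<in>{0..L}. riem_dist U g (c s) (c t) = \<bar>s - t\<bar>) \<and>
        (c has_vector_derivative w) (at 0 within {0..L}) \<and> v = k *\<^sub>R w)"

text \<open>Hyperbolic space of dimension \<open>DIM('a)\<close> as the Poincare ball of curvature \<open>-1\<close>.\<close>

definition hyperbolic_space :: "'a::euclidean_space set" where
  "hyperbolic_space = ball 0 1"

definition hyperbolic_metric :: "'a::euclidean_space metric_field" where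
  "hyperbolic_metric x u v = 4 * (u \<bullet> v) / (1 - (norm x)\<^sup>2)\<^sup>2"

end

theory Submission
  imports Defs
begin

text \<open>
  An isometric inversion moves \<open>p\<close> to the origin. In polar coordinates \<open>r = exp \<sigma>\<close>, \<open>\<theta>\<close> about the
  origin, the condition metric \<open>(dr\<^sup>2 + sinh r\<^sup>2 d\<theta>\<^sup>2) / r\<^sup>2\<close> is the warped product
  \<open>d\<sigma>\<^sup>2 + warp \<sigma> d\<theta>\<^sup>2\<close> with \<open>warp \<sigma> = (sinh r / r)\<^sup>2\<close>, which is increasing and greater than \<open>1\<close>, and
  the logarithm in the theorem is \<open>- \<sigma>\<close>. No differential equation is needed: a minimizing curve
  minimizes the energy, and comparing it with explicit curves shows that \<open>\<sigma>\<close> lies below its chords,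
  that \<open>\<theta>\<close> is constant wherever \<open>\<sigma>\<close> is affine, and that a curve which is radial for a while is
  radial throughout. Finally, since \<open>warp > 1\<close>, the curve with \<open>\<sigma>' = sqrt (1 - 1 / warp \<sigma>)\<close> and
  angular velocity \<open>1 / warp \<sigma>\<close> is defined; a calibration shows that it is minimizing, and \<open>\<sigma>\<close> is
  strictly convex along it.
\<close>

section \<open>Differentiation of Lipschitz functions\<close>

text \<open>Geodesics are given only as Lipschitz minimizers, so derivatives exist only almost
  everywhere; and \<open>integral\<close> is 0 on functions that are not integrable, so two lengths
  can be compared only once both speeds are known to be integrable. Hence the differentiation theory
  at the start. Energy is preferred to length because its integrand is quadratic: \<sigma> and
  \<theta> can be varied separately, and the cross term with a constant slope integrates to zero
  when the variation vanishes at the ends. Propagating radial behaviour by a change of time alters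
  the warping factor; the gain beats this error only on short intervals, which is the origin of the
  condition \<open>K * (b - a) < 1\<close>, with \<open>K\<close> a bound for the rate of change of
  \<open>warp\<close> along the curve. For the explicit geodesic, recall that \<open>warp\<close>
  times the angular velocity is constant along a geodesic. The value 1 is chosen because 1 is the
  infimum of \<open>warp\<close>: unit speed then leaves a radial velocity that never
  vanishes.\<close>

lemma emeasure_UN_intervals_le:
  fixes M N :: "real measure"
  assumes sets: "sets M = sets borel" "sets N = sets borel"
    and C: "countable C" "disjoint_family_on (\<lambda>(u, v). {u..v}) C"
    and le: "\<And>u v. (u, v) \<in> C \<Longrightarrow> emeasure M {u..v} \<le> c * emeasure N {u..v}"
  shows "emeasure M (\<Union>(u, v)\<in>C. {u..v}) \<le> c * emeasure N (\<Union>(u, v)\<in>C. {u..v})"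
proof -
  have "emeasure M (\<Union>(u, v)\<in>C. {u..v})
      = (\<integral>\<^sup>+i. emeasure M (case i of (u, v) \<Rightarrow> {u..v}) \<partial>count_space C)"
    by (rule emeasure_UN_countable) (use C in \<open>auto simp: sets\<close>)
  also have "\<dots> \<le> (\<integral>\<^sup>+i. c * emeasure N (case i of (u, v) \<Rightarrow> {u..v}) \<partial>count_space C)"
    by (rule nn_integral_mono) (auto intro: le)
  also have "\<dots> = c * (\<integral>\<^sup>+i. emeasure N (case i of (u, v) \<Rightarrow> {u..v}) \<partial>count_space C)"
    by (rule nn_integral_cmult) auto
  also have "(\<integral>\<^sup>+i. emeasure N (case i of (u, v) \<Rightarrow> {u..v}) \<partial>count_space C)
      = emeasure N (\<Union>(u, v)\<in>C. {u..v})"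
    by (rule emeasure_UN_countable[symmetric]) (use C in \<open>auto simp: sets\<close>)
  finally show ?thesis .
qed

text \<open>An interval is the closed ball about its midpoint with half its length as radius, and
  the covering theorem for balls only asks that the point lie in the ball. So \<open>x\<close> may
  sit off centre or at an endpoint.\<close>

lemma Vitali_covering_intervals:
  fixes E :: "real set"
  assumes K: "\<And>u v. (u, v) \<in> K \<Longrightarrow> u < v"
    and S: "\<And>x d. \<lbrakk>x \<in> E; 0 < d\<rbrakk> \<Longrightarrow> \<exists>u v. (u, v) \<in> K \<and> u \<le> x \<and> x \<le> v \<and> v - u < d"
  obtains C where "countable C" "C \<subseteq> K" "disjoint_family_on (\<lambda>(u, v). {u..v}) C"
    "negligible (E - (\<Union>(u, v)\<in>C. {u..v}))"
proof -
  let ?a = "\<lambda>i::real \<times> real. (fst i + snd i) / 2" and ?r = "\<lambda>i::real \<times> real. (snd i - fst i) / 2"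
  have cb: "cball (?a i) (?r i) = (case i of (u, v) \<Rightarrow> {u..v})" for i
    by (cases i) (simp add: cball_eq_atLeastAtMost add_divide_distrib diff_divide_distrib)
  obtain C where C: "countable C" "C \<subseteq> K"
     "pairwise (\<lambda>i j. disjnt (cball (?a i) (?r i)) (cball (?a j) (?r j))) C"
     "negligible (E - (\<Union>i \<in> C. cball (?a i) (?r i)))"
  proof (rule Vitali_covering_theorem_cballs[of K ?r E ?a])
    show "0 < ?r i" if "i \<in> K" for i using K[of "fst i" "snd i"] that by simp
    show "\<exists>i. i \<in> K \<and> x \<in> cball (?a i) (?r i) \<and> ?r i < d" if "x \<in> E" "0 < d" for x d
    proof -
      from S[OF that] obtain u v where uv: "(u, v) \<in> K \<and> u \<le> x \<and> x \<le> v \<and> v - u < d" by blast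
      with K[of u v] show ?thesis unfolding cb by (intro exI[of _ "(u, v)"]) simp
    qed
  qed
  show thesis
  proof (rule that[OF C(1,2)])
    show "disjoint_family_on (\<lambda>(u, v). {u..v}) C"
      using C(3) unfolding cb pairwise_def disjnt_def disjoint_family_on_def by blast
    show "negligible (E - (\<Union>(u, v)\<in>C. {u..v}))" using C(4) unfolding cb .
  qed
qed

text \<open>Compare Lebesgue measure with the Stieltjes measure of \<open>F\<close>. Intervals of
  slope at most \<open>p\<close> cover almost all of \<open>E\<close> inside an open set of measure
  at most \<open>m + \<epsilon>\<close>; intervals of slope at least \<open>q\<close> cover almost
  all of \<open>E\<close> again, inside the first ones. The measure \<open>m\<close> of
  \<open>E\<close> would then be at most \<open>p / q * (m + \<epsilon>)\<close>, which is smaller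
  than \<open>m\<close>.\<close>

lemma negligible_oscillating_difference_quotients:
  fixes F :: "real \<Rightarrow> real"
  assumes F: "mono F" "continuous_on UNIV F" and pq: "0 \<le> p" "p < q"
    and E: "E \<in> lmeasurable"
    and lo: "\<And>x d. \<lbrakk>x \<in> E; 0 < d\<rbrakk> \<Longrightarrow>
      \<exists>u v. u < v \<and> u \<le> x \<and> x \<le> v \<and> v - u < d \<and> F v - F u \<le> p * (v - u)"
    and hi: "\<And>x d. \<lbrakk>x \<in> E; 0 < d\<rbrakk> \<Longrightarrow>
      \<exists>u v. u < v \<and> u \<le> x \<and> x \<le> v \<and> v - u < d \<and> q * (v - u) \<le> F v - F u"
  shows "negligible E"
proof (rule ccontr)
  assume neg: "\<not> negligible E"
  define m where "m = measure lebesgue E"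
  have m: "0 < m"
    using neg E unfolding m_def by (simp add: negligible_iff_measure zero_less_measure_iff)
  \<comment> \<open>This makes \<open>q * \<epsilon>\<close> half of the gap
    \<open>q * m - p * m\<close>.\<close>
  define \<epsilon> where "\<epsilon> = m * (q - p) / (2 * q)"
  have \<epsilon>: "0 < \<epsilon>" using m pq by (simp add: \<epsilon>_def)
  have small: "p / q * (m + \<epsilon>) < m"
  proof -
    have "p * \<epsilon> \<le> q * \<epsilon>" using pq \<epsilon> by (intro mult_right_mono) auto
    also have "q * \<epsilon> = m * (q - p) / 2" using pq by (simp add: \<epsilon>_def field_simps)
    also have "\<dots> < m * (q - p)" using m pq by simp
    finally have "p * (m + \<epsilon>) < q * m" by (simp add: algebra_simps)
    then show ?thesis using pq by (simp add: field_simps)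
  qed
  obtain T where T: "open T" "E \<subseteq> T" "T - E \<in> lmeasurable" "emeasure lebesgue (T - E) < ennreal \<epsilon>"
    using sets_lebesgue_outer_open[OF fmeasurableD[OF E] \<epsilon>] by blast
  have Tm: "emeasure lborel T \<le> ennreal (m + \<epsilon>)"
  proof -
    have "emeasure lborel T = emeasure lebesgue (E \<union> (T - E))"
      using T by (simp add: Un_absorb1)
    also have "\<dots> \<le> emeasure lebesgue E + emeasure lebesgue (T - E)"
      by (rule emeasure_subadditive) (use E T in auto)
    also have "emeasure lebesgue E = ennreal m"
      using E by (simp add: m_def emeasure_eq_measure2)
    also have "ennreal m + emeasure lebesgue (T - E) \<le> ennreal m + ennreal \<epsilon>"
      using T(4) by (intro add_left_mono) auto
    finally show ?thesis using m \<epsilon> by (simp add: ennreal_plus)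
  qed
  have shrink: "\<exists>u v. (u, v) \<in> {(u, v). u < v \<and> {u..v} \<subseteq> W \<and> Q u v} \<and> u \<le> x \<and> x \<le> v \<and> v - u < d"
    if W: "open W" "x \<in> W" "0 < d"
      and Q: "\<And>d. 0 < d \<Longrightarrow> \<exists>u v. u < v \<and> u \<le> x \<and> x \<le> v \<and> v - u < d \<and> Q u v" for W and x d :: real and Q
  proof -
    obtain e where e: "e > 0" "ball x e \<subseteq> W" using W openE by blast
    obtain u v where "u < v \<and> u \<le> x \<and> x \<le> v \<and> v - u < min d e \<and> Q u v"
      using Q[of "min d e"] e W by auto
    moreover from this have "{u..v} \<subseteq> ball x e" by (auto simp: dist_real_def)
    ultimately show ?thesis using e by (intro exI[of _ u] exI[of _ v]) auto
  qed
  obtain C1 where C1: "countable C1" "C1 \<subseteq> {(u, v). u < v \<and> {u..v} \<subseteq> T \<and> F v - F u \<le> p * (v - u)}"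
      "disjoint_family_on (\<lambda>(u, v). {u..v}) C1" "negligible (E - (\<Union>(u, v)\<in>C1. {u..v}))"
  proof (rule Vitali_covering_intervals[of "{(u, v). u < v \<and> {u..v} \<subseteq> T \<and> F v - F u \<le> p * (v - u)}" E])
    fix x d :: real assume "x \<in> E" "0 < d"
    then show "\<exists>u v. (u, v) \<in> {(u, v). u < v \<and> {u..v} \<subseteq> T \<and> F v - F u \<le> p * (v - u)} \<and> u \<le> x \<and> x \<le> v \<and> v - u < d"
      using T by (intro shrink lo) auto
  qed auto
  \<comment> \<open>The second covering must fit inside the intervals of the first, so only their
    interiors are kept; the lost endpoints are countably many, hence null.\<close>
  define T2 where "T2 = (\<Union>(u, v)\<in>C1. {u<..<v})"
  have T2: "open T2" unfolding T2_def by auto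
  obtain C2 where C2: "countable C2" "C2 \<subseteq> {(u, v). u < v \<and> {u..v} \<subseteq> T2 \<and> q * (v - u) \<le> F v - F u}"
      "disjoint_family_on (\<lambda>(u, v). {u..v}) C2" "negligible ((E \<inter> T2) - (\<Union>(u, v)\<in>C2. {u..v}))"
  proof (rule Vitali_covering_intervals[of "{(u, v). u < v \<and> {u..v} \<subseteq> T2 \<and> q * (v - u) \<le> F v - F u}" "E \<inter> T2"])
    fix x d :: real assume "x \<in> E \<inter> T2" "0 < d"
    then show "\<exists>u v. (u, v) \<in> {(u, v). u < v \<and> {u..v} \<subseteq> T2 \<and> q * (v - u) \<le> F v - F u} \<and> u \<le> x \<and> x \<le> v \<and> v - u < d"
      using T2 by (intro shrink hi) auto
  qed auto
  let ?U1 = "\<Union>(u, v)\<in>C1. {u..v}" and ?U2 = "\<Union>(u, v)\<in>C2. {u..v}" and ?\<mu> = "interval_measure F"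
  have sU: "?U1 \<in> sets borel" "?U2 \<in> sets borel" using C1(1) C2(1) by auto
  have "negligible (E - ?U2)"
  proof -
    have "negligible (fst ` C1 \<union> snd ` C1)"
      unfolding negligible_iff_null_sets
      by (rule null_sets_completionI, rule countable_imp_null_set_lborel) (use C1(1) in auto)
    moreover have "E - ?U2 \<subseteq> (E - ?U1) \<union> ((E \<inter> T2) - ?U2) \<union> (fst ` C1 \<union> snd ` C1)"
    proof
      fix x assume x: "x \<in> E - ?U2"
      show "x \<in> (E - ?U1) \<union> ((E \<inter> T2) - ?U2) \<union> (fst ` C1 \<union> snd ` C1)"
      proof (cases "x \<in> ?U1")
        case True
        then obtain u v where uv: "(u, v) \<in> C1" "u \<le> x" "x \<le> v" by auto
        show ?thesis
        proof (cases "x = u \<or> x = v")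
          case True
          then show ?thesis using uv(1) by force
        next
          case False
          then have "x \<in> T2" unfolding T2_def using uv by (intro UN_I[OF uv(1)]) auto
          then show ?thesis using x by simp
        qed
      qed (use x in simp)
    qed
    ultimately show ?thesis using C1(4) C2(4) by (meson negligible_Un negligible_subset)
  qed
  then have n0: "emeasure lebesgue (E - ?U2) = 0" 
    unfolding negligible_iff_null_sets by (rule null_setsD1)
  have "ennreal m = emeasure lebesgue E" using E by (simp add: m_def emeasure_eq_measure2)
  also have "\<dots> \<le> emeasure lebesgue (?U2 \<union> (E - ?U2))"
    by (rule emeasure_mono) (use sU E in auto)
  also have "\<dots> \<le> emeasure lebesgue ?U2 + emeasure lebesgue (E - ?U2)"
    by (rule emeasure_subadditive) (use sU E in auto)
  also have "\<dots> = emeasure lborel ?U2" using n0 sU by simp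
  also have "\<dots> \<le> ennreal (1 / q) * emeasure ?\<mu> ?U2"
  proof (rule emeasure_UN_intervals_le)
    fix u v assume "(u, v) \<in> C2"
    then have uv: "u < v" "q * (v - u) \<le> F v - F u" using C2(2) by auto
    have "v - u \<le> 1 / q * (F v - F u)" using uv pq by (simp add: field_simps)
    moreover have "emeasure ?\<mu> {u..v} = ennreal (F v - F u)"
      using uv F by (intro emeasure_interval_measure_Icc) (auto dest: monoD)
    ultimately show "emeasure lborel {u..v} \<le> ennreal (1 / q) * emeasure ?\<mu> {u..v}"
      using uv pq monoD[OF F(1), of u v] by (simp add: ennreal_mult[symmetric] ennreal_leI)
  qed (use C2 in auto)
  also have "emeasure ?\<mu> ?U2 \<le> emeasure ?\<mu> ?U1"
  proof (rule emeasure_mono)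
    have "?U2 \<subseteq> T2" using C2(2) by blast
    also have "T2 \<subseteq> ?U1" unfolding T2_def by (intro UN_mono) auto
    finally show "?U2 \<subseteq> ?U1" .
  qed (use sU in simp)
  also have "emeasure ?\<mu> ?U1 \<le> ennreal p * emeasure lborel ?U1"
  proof (rule emeasure_UN_intervals_le)
    fix u v assume "(u, v) \<in> C1"
    then have uv: "u < v" "F v - F u \<le> p * (v - u)" using C1(2) by auto
    moreover have "emeasure ?\<mu> {u..v} = ennreal (F v - F u)"
      using uv F by (intro emeasure_interval_measure_Icc) (auto dest: monoD)
    ultimately show "emeasure ?\<mu> {u..v} \<le> ennreal p * emeasure lborel {u..v}"
      using pq by (simp add: ennreal_mult[symmetric] ennreal_leI)
  qed (use C1 in auto)
  also have "emeasure lborel ?U1 \<le> emeasure lborel T"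
    using C1(2) T(1) by (intro emeasure_mono) auto
  also have "\<dots> \<le> ennreal (m + \<epsilon>)" by (rule Tm)
  finally have "ennreal m \<le> ennreal (1 / q) * (ennreal p * ennreal (m + \<epsilon>))"
    by (simp add: mult_left_mono)
  also have "\<dots> = ennreal (p / q * (m + \<epsilon>))"
    using pq m \<epsilon> by (simp add: ennreal_mult[symmetric] del: ennreal_plus)
  finally show False using small m pq \<epsilon> by (simp add: ennreal_le_iff)
qed


text \<open>Let \<open>x\<close> lie outside all \<open>E p q\<close> with rational
  \<open>0 \<le> p < q\<close>. Then the intervals around \<open>x\<close> cannot have slopes below
  \<open>p\<close> and slopes above \<open>q\<close> at arbitrarily small scales, so the slopes are
  squeezed to a single number.\<close>

lemma mono_Lipschitz_ae_differentiable:
  fixes F :: "real \<Rightarrow> real"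
  assumes F: "mono F" and L: "L-lipschitz_on UNIV F"
  shows "negligible {x. \<not> (\<exists>D. (F has_real_derivative D) (at x))}"
proof -
  have cont: "continuous_on UNIV F" using L by (rule lipschitz_on_continuous_on)
  then have contAt: "isCont F x" for x by (simp add: continuous_on_eq_continuous_at)
  have LF: "F v - F u \<le> L * (v - u)" if "u < v" for u v
    using lipschitz_onD[OF L, of v u] that by (auto simp: dist_real_def)
  \<comment> \<open>Open intervals make \<open>E p q\<close> Borel, at the price that
    \<open>x\<close> is never an endpoint of them.\<close>
  define A where "A p n = (\<Union>(u, v)\<in>{(u, v). v - u < 1 / real (Suc n) \<and> F v - F u < p * (v - u)}. {u<..<v})" for p n
  define B where "B q n = (\<Union>(u, v)\<in>{(u, v). v - u < 1 / real (Suc n) \<and> F v - F u > q * (v - u)}. {u<..<v})" for q n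
  define E where "E p q = (\<Inter>n. A p n) \<inter> (\<Inter>n. B q n)" for p q
  have "open (A p n)" "open (B p n)" for p n unfolding A_def B_def by auto
  then have Eb: "E p q \<in> sets borel" for p q unfolding E_def by auto
  have negE: "negligible (E p q)" if pq: "0 \<le> p" "p < q" for p q
  proof -
    have "negligible (E p q \<inter> {-real k..real k})" for k :: nat
    proof (rule negligible_oscillating_difference_quotients[OF F cont pq])
      show "E p q \<inter> {-real k..real k} \<in> lmeasurable"
      proof (rule bounded_set_imp_lmeasurable)
        show "bounded (E p q \<inter> {-real k..real k})" 
          by (meson bounded_closed_interval bounded_subset inf_le2)
      qed (use Eb[of p q] in auto)
      fix x d :: real assume x: "x \<in> E p q \<inter> {-real k..real k}" and "0 < d"
      then obtain n where n: "1 / real (Suc n) < d" using nat_approx_posE by blast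
      have "x \<in> A p n" "x \<in> B q n" using x unfolding E_def by auto
      then obtain u v u' v' where "x \<in> {u<..<v}" "v - u < 1 / real (Suc n)" "F v - F u < p * (v - u)"
         "x \<in> {u'<..<v'}" "v' - u' < 1 / real (Suc n)" "F v' - F u' > q * (v' - u')"
        unfolding A_def B_def by blast
      with n show "\<exists>u v. u < v \<and> u \<le> x \<and> x \<le> v \<and> v - u < d \<and> F v - F u \<le> p * (v - u)"
        "\<exists>u v. u < v \<and> u \<le> x \<and> x \<le> v \<and> v - u < d \<and> q * (v - u) \<le> F v - F u"
        by (intro exI[of _ u] exI[of _ v]; simp) (use n \<open>x \<in> {u'<..<v'}\<close> \<open>v' - u' < 1 / real (Suc n)\<close>
          \<open>F v' - F u' > q * (v' - u')\<close> in \<open>intro exI[of _ u'] exI[of _ v']; simp\<close>)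
    qed
    then have "negligible (\<Union>k. E p q \<inter> {-real k..real k})" by (rule negligible_Union_nat)
    moreover have "(\<Union>k. E p q \<inter> {-real k..real k}) = E p q"
    proof -
      have "\<exists>k. x \<in> {-real k..real k}" for x :: real
        using real_arch_simple[of "\<bar>x\<bar>"] by (metis abs_le_iff atLeastAtMost_iff minus_le_iff)
      then show ?thesis by blast
    qed
    ultimately show ?thesis by simp
  qed
  define N where "N = (\<Union>p\<in>{p\<in>\<rat>. 0 \<le> p}. \<Union>q\<in>{q\<in>\<rat>. p < q}. E p q)"
  have cR: "countable {p \<in> \<rat>. P p}" for P :: "real \<Rightarrow> bool"
    by (rule countable_subset[OF _ countable_rat]) auto
  have "negligible N"
    unfolding N_def by (intro negligible_countable_Union countable_image cR; use negE in \<open>auto intro!: negligible_countable_Union countable_image cR\<close>)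
  moreover have "\<exists>D. (F has_real_derivative D) (at x)" if x: "x \<notin> N" for x
  proof -
    define up where "up q \<longleftrightarrow> (\<exists>d>0. \<forall>u v. u \<le> x \<and> x \<le> v \<and> u < v \<and> v - u < d \<longrightarrow> F v - F u \<le> q * (v - u))" for q
    define dn where "dn p \<longleftrightarrow> (\<exists>d>0. \<forall>u v. u \<le> x \<and> x \<le> v \<and> u < v \<and> v - u < d \<longrightarrow> p * (v - u) \<le> F v - F u)" for p
    \<comment> \<open>A difference quotient at \<open>x\<close> belongs to an interval with endpoint
      \<open>x\<close>. Widening it by \<open>\<eta>\<close> on both sides and letting
      \<open>\<eta>\<close> tend to 0 carries the bounds over from open intervals around
      \<open>x\<close>.\<close>
    have lim: "((\<lambda>\<eta>. F (v + \<eta>) - F (u - \<eta>) - p * ((v + \<eta>) - (u - \<eta>))) \<longlongrightarrow> F v - F u - p * (v - u)) (at_right 0)" for u v p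
    proof -
      have "((\<lambda>\<eta>. F (v + \<eta>)) \<longlongrightarrow> F v) (at_right 0)" "((\<lambda>\<eta>. F (u - \<eta>)) \<longlongrightarrow> F u) (at_right 0)"
        by (rule isCont_tendsto_compose[OF contAt], auto intro!: tendsto_eq_intros)+
      then show ?thesis by (auto intro!: tendsto_eq_intros)
    qed
    have cases: "dn p \<or> up q" if pq: "p \<in> \<rat>" "q \<in> \<rat>" "0 \<le> p" "p < q" for p q
    proof -
      have "x \<notin> E p q" using x pq unfolding N_def by auto
      then consider n where "x \<notin> A p n" | n where "x \<notin> B q n" unfolding E_def by auto
      then show ?thesis
      proof cases
        case 1
        have "p * (v - u) \<le> F v - F u" if uv: "u \<le> x" "x \<le> v" "u < v" "v - u < 1 / real (Suc n)" for u v
        proof -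
          have "eventually (\<lambda>\<eta>. \<eta> \<in> {0<..<(1 / real (Suc n) - (v - u)) / 2}) (at_right (0::real))"
            by (rule eventually_at_right_real) (use uv in auto)
          then have "eventually (\<lambda>\<eta>. 0 \<le> F (v + \<eta>) - F (u - \<eta>) - p * ((v + \<eta>) - (u - \<eta>))) (at_right (0::real))"
          proof eventually_elim
            case (elim \<eta>)
            then have "x \<in> {u - \<eta><..<v + \<eta>}" "(v + \<eta>) - (u - \<eta>) < 1 / real (Suc n)" using uv by auto
            with 1 show ?case unfolding A_def by force
          qed
          from tendsto_lowerbound[OF lim this] show ?thesis by simp
        qed
        then have "dn p" unfolding dn_def by (intro exI[of _ "1 / real (Suc n)"]) auto
        then show ?thesis ..
      next
        case 2
        have "F v - F u \<le> q * (v - u)" if uv: "u \<le> x" "x \<le> v" "u < v" "v - u < 1 / real (Suc n)" for u v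
        proof -
          have "eventually (\<lambda>\<eta>. \<eta> \<in> {0<..<(1 / real (Suc n) - (v - u)) / 2}) (at_right (0::real))"
            by (rule eventually_at_right_real) (use uv in auto)
          then have "eventually (\<lambda>\<eta>. F (v + \<eta>) - F (u - \<eta>) - q * ((v + \<eta>) - (u - \<eta>)) \<le> 0) (at_right (0::real))"
          proof eventually_elim
            case (elim \<eta>)
            then have "x \<in> {u - \<eta><..<v + \<eta>}" "(v + \<eta>) - (u - \<eta>) < 1 / real (Suc n)" using uv by auto
            with 2 show ?case unfolding B_def by force
          qed
          from tendsto_upperbound[OF lim this] show ?thesis by simp
        qed
        then have "up q" unfolding up_def by (intro exI[of _ "1 / real (Suc n)"]) auto
        then show ?thesis ..
      qed
    qed
    have up_nonneg: "0 \<le> q" if up: "up q" for q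
    proof -
      obtain d where d: "d > 0" "\<And>u v. u \<le> x \<and> x \<le> v \<and> u < v \<and> v - u < d \<Longrightarrow> F v - F u \<le> q * (v - u)"
        using up unfolding up_def by blast
      have "F (x + d/2) - F x \<le> q * (x + d/2 - x)" by (rule d(2)) (use d(1) in auto)
      moreover have "0 \<le> F (x + d/2) - F x" using monoD[OF F, of x "x + d/2"] d by simp
      ultimately have "0 \<le> q * (x + d/2 - x)" by linarith
      then show ?thesis using d(1) by (simp add: zero_le_mult_iff)
    qed
    have upL: "up L" unfolding up_def using LF by (intro exI[of _ 1]) auto
    have up_mono: "up q'" if "up q" "q \<le> q'" for q q'
    proof -
      obtain d where d: "d > 0" "\<And>u v. u \<le> x \<and> x \<le> v \<and> u < v \<and> v - u < d \<Longrightarrow> F v - F u \<le> q * (v - u)"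
        using \<open>up q\<close> unfolding up_def by blast
      have "F v - F u \<le> q' * (v - u)" if "u \<le> x \<and> x \<le> v \<and> u < v \<and> v - u < d" for u v
        using d(2)[OF that] mult_right_mono[OF \<open>q \<le> q'\<close>, of "v - u"] that by linarith
      then show ?thesis unfolding up_def using d(1) by blast
    qed
    \<comment> \<open>The candidate derivative: the infimum of the slopes that bound all quotients
      at small scales. The set contains \<open>L\<close> and, by monotonicity of \<open>F\<close>,
      is bounded below by 0.\<close>
    define D where "D = Inf {q. up q}"
    have bdd: "bdd_below {q. up q}" using up_nonneg by (auto intro!: bdd_belowI[of _ 0])
    have D0: "0 \<le> D" unfolding D_def using upL up_nonneg by (intro cInf_greatest) auto
    have upD: "up q" if "D < q" for q
    proof -
      have "\<exists>q'\<in>{q. up q}. q' < q"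
        using that upL bdd cInf_less_iff[of "{q. up q}" q] unfolding D_def by auto
      then show ?thesis using up_mono by force
    qed
    have dnD: "dn p" if "p < D" for p
    proof (cases "0 \<le> p")
      case True
      \<comment> \<open>Two rationals are put between \<open>p\<close> and \<open>D\<close>: the
        larger is not an eventual upper bound, so by \<open>cases\<close> the smaller is an eventual
        lower bound.\<close>
      obtain p' where p': "p' \<in> \<rat>" "p < p'" "p' < D" using Rats_dense_in_real[OF \<open>p < D\<close>] by blast
      obtain q' where q': "q' \<in> \<rat>" "p' < q'" "q' < D" using Rats_dense_in_real[OF p'(3)] by blast
      have "\<not> up q'" using q'(3) bdd cInf_lower[of q' "{q. up q}"] unfolding D_def by auto
      then have "dn p'" using cases[of p' q'] p' q' True by auto
      then obtain d where d: "d > 0" "\<And>u v. u \<le> x \<and> x \<le> v \<and> u < v \<and> v - u < d \<Longrightarrow> p' * (v - u) \<le> F v - F u"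
        unfolding dn_def by blast
      have "p * (v - u) \<le> F v - F u" if "u \<le> x \<and> x \<le> v \<and> u < v \<and> v - u < d" for u v
        using d(2)[OF that] mult_right_mono[of p p' "v - u"] p'(2) that by linarith
      then show ?thesis unfolding dn_def using d(1) by blast
    next
      case False
      have "p * (v - u) \<le> F v - F u" if "u < v" for u v
      proof -
        have "p * (v - u) \<le> 0" using False that by (simp add: mult_le_0_iff)
        also have "0 \<le> F v - F u" using monoD[OF F, of u v] that by simp
        finally show ?thesis .
      qed
      then show ?thesis unfolding dn_def by (intro exI[of _ 1]) auto
    qed
    have "((\<lambda>y. (F y - F x) / (y - x)) \<longlongrightarrow> D) (at x)"
    proof (rule LIM_I)
      fix r :: real assume r: "0 < r"
      obtain d1 where d1: "d1 > 0" "\<And>u v. u \<le> x \<and> x \<le> v \<and> u < v \<and> v - u < d1 \<Longrightarrow> F v - F u \<le> (D + r/2) * (v - u)"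
        using upD[of "D + r/2"] r unfolding up_def by auto
      obtain d2 where d2: "d2 > 0" "\<And>u v. u \<le> x \<and> x \<le> v \<and> u < v \<and> v - u < d2 \<Longrightarrow> (D - r/2) * (v - u) \<le> F v - F u"
        using dnD[of "D - r/2"] r unfolding dn_def by auto
      have "norm ((F y - F x) / (y - x) - D) < r" if y: "y \<noteq> x" "norm (y - x) < min d1 d2" for y
      proof -
        have "(F y - F x) / (y - x) \<le> D + r/2 \<and> D - r/2 \<le> (F y - F x) / (y - x)"
        proof (cases "x < y")
          case True
          then show ?thesis using d1(2)[of x y] d2(2)[of x y] y by (auto simp: field_simps)
        next
          case False
          then have "y < x" using y by simp
          moreover have "(F y - F x) / (y - x) = (F x - F y) / (x - y)" 
            using minus_divide_divide[of "F x - F y" "x - y"] by simp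
          ultimately show ?thesis using d1(2)[of y x] d2(2)[of y x] y by (auto simp: pos_divide_le_eq pos_le_divide_eq)
        qed
        then show ?thesis using r by auto
      qed
      then show "\<exists>s>0. \<forall>y. y \<noteq> x \<and> norm (y - x) < s \<longrightarrow> norm ((F y - F x) / (y - x) - D) < r"
        using d1(1) d2(1) by (intro exI[of _ "min d1 d2"]) auto
    qed
    then show ?thesis by (auto simp: has_field_derivative_iff)
  qed
  ultimately show ?thesis by (blast intro: negligible_subset)
qed

lemma continuous_antiderivative_UNIV:
  fixes g :: "real \<Rightarrow> real"
  assumes "continuous_on UNIV g"
  shows "\<exists>G. \<forall>x. (G has_real_derivative g x) (at x)"
proof -
  have "isCont g x" for x using assms by (simp add: continuous_on_eq_continuous_at)
  then obtain G where "\<And>x. -\<infinity> < ereal x \<Longrightarrow> ereal x < \<infinity> \<Longrightarrow> (G has_vector_derivative g x) (at x)"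
    using einterval_antiderivative[of "-\<infinity>" \<infinity> g] by auto
  then show ?thesis by (auto simp: has_real_derivative_iff_has_vector_derivative)
qed

text \<open>Continuing by the end values keeps the Lipschitz constant and gives a meaning to forward
  difference quotients that reach beyond \<open>b\<close>.\<close>

definition clamp_extend :: "real \<Rightarrow> real \<Rightarrow> (real \<Rightarrow> 'a) \<Rightarrow> real \<Rightarrow> 'a" where
  "clamp_extend a b f t = f (max a (min b t))"

lemma lipschitz_on_clamp_extend:
  fixes f :: "real \<Rightarrow> 'a::metric_space"
  assumes "C-lipschitz_on {a..b} f" "a \<le> b"
  shows "C-lipschitz_on UNIV (clamp_extend a b f)"
proof (rule lipschitz_onI)
  fix x y :: real
  have "dist (clamp_extend a b f x) (clamp_extend a b f y) \<le> C * dist (max a (min b x)) (max a (min b y))"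
    unfolding clamp_extend_def by (rule lipschitz_onD[OF assms(1)]) (use assms(2) in auto)
  also have "\<dots> \<le> C * dist x y"
    using lipschitz_on_nonneg[OF assms(1)] by (intro mult_left_mono) (auto simp: dist_real_def)
  finally show "dist (clamp_extend a b f x) (clamp_extend a b f y) \<le> C * dist x y" .
qed (use assms lipschitz_on_nonneg in auto)

text \<open>Adding \<open>C * t\<close> turns a \<open>C\<close>-Lipschitz function into an
  increasing one. The endpoints join the exceptional set, because there the extension says nothing
  about two-sided derivatives of \<open>f\<close>.\<close>

lemma lipschitz_real_ae_differentiable:
  fixes f :: "real \<Rightarrow> real"
  assumes f: "C-lipschitz_on {a..b} f"
  obtains N where "negligible N" "\<And>t. t \<in> {a..b} - N \<Longrightarrow> a < t \<and> t < b \<and> f differentiable (at t)"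
proof (cases "a < b")
  case False
  then have "negligible {a..b}" by (cases "a = b") auto
  then show ?thesis by (intro that[of "{a..b}"]) auto
next
  case True
  let ?g = "clamp_extend a b f"
  define F where "F t = ?g t + C * t" for t
  have g: "C-lipschitz_on UNIV ?g" using f True by (intro lipschitz_on_clamp_extend) auto
  have C: "0 \<le> C" using g by (rule lipschitz_on_nonneg)
  have "C-lipschitz_on UNIV (\<lambda>t. C * t)"
    using C by (intro lipschitz_onI) (auto simp: dist_real_def right_diff_distrib[symmetric] abs_mult)
  then have "(C + C)-lipschitz_on UNIV F"
    unfolding F_def by (rule lipschitz_on_add[OF g])
  moreover have "mono F"
  proof (rule monoI)
    fix x y :: real assume "x \<le> y"
    then show "F x \<le> F y"
      using lipschitz_onD[OF g, of x y] by (auto simp: F_def dist_real_def abs_le_iff algebra_simps)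
  qed
  ultimately have neg: "negligible {t. \<not> (\<exists>D. (F has_real_derivative D) (at t))}"
    by (intro mono_Lipschitz_ae_differentiable)
  let ?N = "{t. \<not> (\<exists>D. (F has_real_derivative D) (at t))} \<union> {a, b}"
  show ?thesis
  proof (rule that[of ?N])
    show "negligible ?N" using neg by (intro negligible_Un) auto
    fix t assume t: "t \<in> {a..b} - ?N"
    then obtain D where D: "(F has_real_derivative D) (at t)" by blast
    have ab: "a < t" "t < b" using t by auto
    have "((\<lambda>t. F t - C * t) has_real_derivative D - C) (at t)"
      by (auto intro!: derivative_eq_intros D)
    then have "(f has_real_derivative D - C) (at t)"
      by (rule has_field_derivative_transform_within_open[of _ _ _ "{a<..<b}"])
        (use ab in \<open>auto simp: F_def clamp_extend_def max_def min_def\<close>)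
    then show "a < t \<and> t < b \<and> f differentiable (at t)"
      using ab real_differentiable_def by blast
  qed
qed

lemma lipschitz_on_inner_right:
  fixes f :: "'b::metric_space \<Rightarrow> 'a::real_inner"
  assumes "C-lipschitz_on S f" and "norm i \<le> 1"
  shows "C-lipschitz_on S (\<lambda>t. f t \<bullet> i)"
proof (rule lipschitz_onI)
  fix x y assume "x \<in> S" "y \<in> S"
  have "dist (f x \<bullet> i) (f y \<bullet> i) = \<bar>(f x - f y) \<bullet> i\<bar>" by (simp add: dist_real_def inner_diff_left)
  also have "\<dots> \<le> norm (f x - f y) * norm i" by (rule Cauchy_Schwarz_ineq2)
  also have "\<dots> \<le> norm (f x - f y)" using assms(2) by (simp add: mult_left_le)
  also have "\<dots> \<le> C * dist x y"
    using lipschitz_onD[OF assms(1) \<open>x \<in> S\<close> \<open>y \<in> S\<close>] by (simp add: dist_norm)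
  finally show "dist (f x \<bullet> i) (f y \<bullet> i) \<le> C * dist x y" .
qed (use assms lipschitz_on_nonneg in blast)

lemma lipschitz_ae_differentiable:
  fixes f :: "real \<Rightarrow> 'a::euclidean_space"
  assumes f: "C-lipschitz_on {a..b} f"
  obtains N where "negligible N"
    "\<And>t. t \<in> {a..b} - N \<Longrightarrow> a < t \<and> t < b \<and> (f has_vector_derivative vector_derivative f (at t)) (at t)"
proof -
  have "\<exists>N. negligible N \<and> (\<forall>t\<in>{a..b} - N. a < t \<and> t < b \<and> (\<lambda>s. f s \<bullet> i) differentiable (at t))"
    if "i \<in> Basis" for i
    by (rule lipschitz_real_ae_differentiable[OF lipschitz_on_inner_right[OF f, of i]]) (use that in auto)
  then obtain N where N: "\<And>i. i \<in> Basis \<Longrightarrow> negligible (N i)"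
    "\<And>i t. i \<in> Basis \<Longrightarrow> t \<in> {a..b} - N i \<Longrightarrow> a < t \<and> t < b \<and> (\<lambda>s. f s \<bullet> i) differentiable (at t)"
    by metis
  show thesis
  proof (rule that[of "\<Union>i\<in>Basis. N i"])
    show "negligible (\<Union>i\<in>Basis. N i)" using N(1) by (intro negligible_Union) auto
    fix t assume t: "t \<in> {a..b} - (\<Union>i\<in>Basis. N i)"
    then have "f differentiable (at t)"
      unfolding differentiable_componentwise_within[of f] using N(2) by auto
    moreover have "a < t \<and> t < b" using t N(2) nonempty_Basis by blast
    ultimately show "a < t \<and> t < b \<and> (f has_vector_derivative vector_derivative f (at t)) (at t)"
      by (simp add: vector_derivative_works)
  qed
qed

lemma norm_vector_derivative_le_lipschitz:
  fixes f :: "real \<Rightarrow> 'a::real_normed_vector"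
  assumes f: "C-lipschitz_on {a..b} f" and t: "a < t" "t < b"
    and d: "(f has_vector_derivative v) (at t)"
  shows "norm v \<le> C"
proof -
  have "((\<lambda>h. norm (f (t + h) - f t - h *\<^sub>R v) / norm h) \<longlongrightarrow> 0) (at 0)"
    using d by (simp add: has_vector_derivative_def has_derivative_at)
  moreover have "eventually (\<lambda>h. norm v - C \<le> norm (f (t + h) - f t - h *\<^sub>R v) / norm h) (at 0)"
  proof -
    have "eventually (\<lambda>h. h \<in> {a - t<..<b - t}) (at 0)"
      using t by (intro eventually_at_in_open') auto
    moreover have "eventually (\<lambda>h::real. h \<noteq> 0) (at 0)" by (simp add: eventually_at_filter)
    ultimately show ?thesis
    proof eventually_elim
      case (elim h)
      have "norm (f (t + h) - f t) \<le> C * \<bar>h\<bar>"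
        using lipschitz_onD[OF f, of "t + h" t] t elim by (auto simp: dist_norm)
      moreover have "norm (h *\<^sub>R v) \<le> norm (f (t + h) - f t) + norm (f (t + h) - f t - h *\<^sub>R v)"
        using norm_triangle_ineq4[of "f (t + h) - f t" "f (t + h) - f t - h *\<^sub>R v"] by simp
      ultimately have "(norm v - C) * \<bar>h\<bar> \<le> norm (f (t + h) - f t - h *\<^sub>R v)"
        by (simp add: algebra_simps)
      then show ?case using elim by (simp add: field_simps)
    qed
  qed
  ultimately have "norm v - C \<le> 0" by (rule tendsto_lowerbound) simp
  then show ?thesis by simp
qed

text \<open>Forward difference quotients of the extension converge to the derivative almost
  everywhere and are bounded by \<open>C\<close>. Their integrals are difference quotients of an
  antiderivative \<open>G\<close> at \<open>b\<close> and at \<open>a\<close>, which tend to the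
  values of the extension there; dominated convergence identifies the limits.\<close>

lemma lipschitz_fundamental_theorem_real:
  fixes f :: "real \<Rightarrow> real"
  assumes f: "C-lipschitz_on {a..b} f" and ab: "a \<le> b"
  shows "((\<lambda>t. vector_derivative f (at t)) has_integral f b - f a) {a..b}"
proof -
  obtain N where N: "negligible N"
    "\<And>t. t \<in> {a..b} - N \<Longrightarrow> a < t \<and> t < b \<and> (f has_vector_derivative vector_derivative f (at t)) (at t)"
    using lipschitz_ae_differentiable[OF f] by blast
  let ?f' = "\<lambda>t. vector_derivative f (at t)"
  let ?g = "clamp_extend a b f"
  have g: "C-lipschitz_on UNIV ?g" using f ab by (rule lipschitz_on_clamp_extend)
  then have gc: "continuous_on UNIV ?g" by (rule lipschitz_on_continuous_on)
  obtain G where G: "\<And>x. (G has_real_derivative ?g x) (at x)"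
    using continuous_antiderivative_UNIV[OF gc] by blast
  define h where "h n = 1 / real (Suc n)" for n
  have h: "0 < h n" for n by (simp add: h_def)
  have h0: "h \<longlonglongrightarrow> 0" unfolding h_def by (rule LIMSEQ_Suc[OF lim_1_over_n])
  have hat: "filterlim h (at 0) sequentially"
    by (rule filterlim_atI[OF h0]) (use h in \<open>auto simp: less_imp_neq[THEN not_sym]\<close>)
  have quot: "(\<lambda>n. (H (x + h n) - H x) / h n) \<longlonglongrightarrow> D" if "(H has_real_derivative D) (at x)" for H :: "real \<Rightarrow> real" and x D
    using that unfolding DERIV_def by (rule filterlim_compose[OF _ hat])
  \<comment> \<open>Both quotients and limit are set to 0 on \<open>N\<close>, so that convergence
    holds at every point, as \<open>dominated_convergence\<close> asks.\<close>
  define q where "q n t = (if t \<in> N then 0 else (?g (t + h n) - ?g t) / h n)" for n t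
  define w where "w t = (if t \<in> N then 0 else ?f' t)" for t
  have qi: "(q n has_integral ((G (b + h n) - G b) / h n - (G (a + h n) - G a) / h n)) {a..b}" for n
  proof -
    have "((\<lambda>t. (?g (t + h n) - ?g t) / h n) has_integral
        (G (b + h n) - G b) / h n - (G (a + h n) - G a) / h n) {a..b}"
      unfolding diff_divide_distrib[symmetric]
    proof (rule has_integral_divide)
      have "((\<lambda>t. ?g (t + h n) - ?g t) has_integral (G (b + h n) - G b) - (G (a + h n) - G a)) {a..b}"
        using ab
      proof (rule fundamental_theorem_of_calculus)
        fix x
        have "((\<lambda>t. G (t + h n) - G t) has_real_derivative ?g (x + h n) - ?g x) (at x)"
          by (rule derivative_eq_intros DERIV_chain2[OF G] G refl | simp)+
        then show "((\<lambda>t. G (t + h n) - G t) has_vector_derivative ?g (x + h n) - ?g x) (at x within {a..b})"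
          by (simp add: has_real_derivative_iff_has_vector_derivative[symmetric] has_field_derivative_at_within)
      qed
      then show "((\<lambda>t. ?g (t + h n) - ?g t) has_integral (G (b + h n) - G b - (G (a + h n) - G a))) {a..b}"
        by simp
    qed
    then show ?thesis
      by (rule has_integral_spike[OF N(1), rotated]) (auto simp: q_def)
  qed
  have conv: "(\<lambda>n. q n t) \<longlonglongrightarrow> w t" if t: "t \<in> {a..b}" for t
  proof (cases "t \<in> N")
    case False
    then have tt: "a < t" "t < b" "(f has_vector_derivative ?f' t) (at t)" using N(2)[of t] t by auto
    have "(?g has_real_derivative ?f' t) (at t)"
      using tt(3)[folded has_real_derivative_iff_has_vector_derivative]
      by (rule has_field_derivative_transform_within_open[of _ _ _ "{a<..<b}"])
        (use tt in \<open>auto simp: clamp_extend_def max_def min_def\<close>)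
    from quot[OF this] show ?thesis using False by (simp add: q_def w_def)
  qed (simp add: q_def w_def)
  have bound: "norm (q n t) \<le> C" for n t
  proof (cases "t \<in> N")
    case False
    have "\<bar>?g (t + h n) - ?g t\<bar> \<le> C * h n"
      using lipschitz_onD[OF g, of "t + h n" t] h[of n] by (simp add: dist_real_def)
    then show ?thesis using h[of n] False by (simp add: q_def field_simps)
  qed (use lipschitz_on_nonneg[OF f] in \<open>simp add: q_def\<close>)
  have dc: "w integrable_on {a..b}" "(\<lambda>n. integral {a..b} (q n)) \<longlonglongrightarrow> integral {a..b} w"
    using dominated_convergence[where f = q and g = w and h = "\<lambda>_. C" and S = "{a..b}"]
      has_integral_integrable[OF qi] bound conv integrable_const_ivl[of C a b] by blast+
  have "(\<lambda>n. integral {a..b} (q n)) \<longlonglongrightarrow> ?g b - ?g a"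
    unfolding integral_unique[OF qi] by (intro tendsto_diff quot G)
  then have "integral {a..b} w = f b - f a"
    using dc(2) LIMSEQ_unique ab by (fastforce simp: clamp_extend_def)
  then have "(w has_integral f b - f a) {a..b}" using dc(1) by (metis integrable_integral)
  then show ?thesis by (rule has_integral_spike[OF N(1), rotated]) (auto simp: w_def)
qed

lemma lipschitz_fundamental_theorem:
  fixes f :: "real \<Rightarrow> 'a::euclidean_space"
  assumes f: "C-lipschitz_on {a..b} f" and ab: "a \<le> b"
  shows "((\<lambda>t. vector_derivative f (at t)) has_integral f b - f a) {a..b}"
proof -
  obtain N where N: "negligible N"
    "\<And>t. t \<in> {a..b} - N \<Longrightarrow> a < t \<and> t < b \<and> (f has_vector_derivative vector_derivative f (at t)) (at t)"
    using lipschitz_ae_differentiable[OF f] by blast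
  have "((\<lambda>t. vector_derivative f (at t) \<bullet> i) has_integral (f b - f a) \<bullet> i) {a..b}" if "i \<in> Basis" for i
  proof -
    have "((\<lambda>t. vector_derivative (\<lambda>s. f s \<bullet> i) (at t)) has_integral f b \<bullet> i - f a \<bullet> i) {a..b}"
      by (rule lipschitz_fundamental_theorem_real[OF lipschitz_on_inner_right[OF f] ab]) (use that in auto)
    then have "((\<lambda>t. vector_derivative f (at t) \<bullet> i) has_integral f b \<bullet> i - f a \<bullet> i) {a..b}"
    proof (rule has_integral_spike[OF N(1), rotated])
      fix t assume "t \<in> {a..b} - N"
      then have "(f has_vector_derivative vector_derivative f (at t)) (at t)" using N(2) by blast
      then have "((\<lambda>s. f s \<bullet> i) has_vector_derivative vector_derivative f (at t) \<bullet> i) (at t)"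
        by (rule bounded_linear.has_vector_derivative[OF bounded_linear_inner_left])
      then show "vector_derivative f (at t) \<bullet> i = vector_derivative (\<lambda>s. f s \<bullet> i) (at t)"
        by (simp add: vector_derivative_at)
    qed
    then show ?thesis by (simp add: inner_diff_left)
  qed
  then show ?thesis by (subst has_integral_componentwise_iff) auto
qed

section \<open>Calculus of Lipschitz curves on compact intervals\<close>

definition lipschitz_ivl :: "real \<Rightarrow> real \<Rightarrow> (real \<Rightarrow> 'a::metric_space) \<Rightarrow> bool" where
  "lipschitz_ivl a b f \<longleftrightarrow> (\<exists>C. C-lipschitz_on {a..b} f)"

lemma lipschitz_curve_iff: "lipschitz_curve U a b c \<longleftrightarrow> c ` {a..b} \<subseteq> U \<and> lipschitz_ivl a b c"
  by (simp add: lipschitz_curve_def lipschitz_ivl_def)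

lemma lipschitz_ivl_subset:
  "lipschitz_ivl a b f \<Longrightarrow> a \<le> s \<Longrightarrow> t \<le> b \<Longrightarrow> lipschitz_ivl s t f"
  unfolding lipschitz_ivl_def by (meson atLeastatMost_subset_iff lipschitz_on_subset)

lemma lipschitz_ivl_continuous: "lipschitz_ivl a b f \<Longrightarrow> continuous_on {a..b} f"
  unfolding lipschitz_ivl_def using lipschitz_on_continuous_on by blast

lemma lipschitz_ivl_cong:
  "(\<And>t. t \<in> {a..b} \<Longrightarrow> f t = g t) \<Longrightarrow> lipschitz_ivl a b f \<longleftrightarrow> lipschitz_ivl a b g"
  unfolding lipschitz_ivl_def by (metis lipschitz_on_transform)

lemma lipschitz_ivl_const: "lipschitz_ivl a b (\<lambda>_. x)"
  unfolding lipschitz_ivl_def using lipschitz_on_constant by blast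

lemma lipschitz_ivl_add:
  fixes f :: "real \<Rightarrow> 'a::real_normed_vector"
  shows "lipschitz_ivl a b f \<Longrightarrow> lipschitz_ivl a b g \<Longrightarrow> lipschitz_ivl a b (\<lambda>t. f t + g t)"
  unfolding lipschitz_ivl_def using lipschitz_on_add by blast

lemma lipschitz_ivl_diff:
  fixes f :: "real \<Rightarrow> 'a::real_normed_vector"
  shows "lipschitz_ivl a b f \<Longrightarrow> lipschitz_ivl a b g \<Longrightarrow> lipschitz_ivl a b (\<lambda>t. f t - g t)"
  unfolding lipschitz_ivl_def using lipschitz_on_diff by blast

lemma lipschitz_ivl_compose:
  assumes "lipschitz_ivl a b f" "K-lipschitz_on (f ` {a..b}) g"
  shows "lipschitz_ivl a b (\<lambda>t. g (f t))"
  using assms lipschitz_on_compose2 unfolding lipschitz_ivl_def by blast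

lemma lipschitz_ivl_norm:
  fixes f :: "real \<Rightarrow> 'a::real_normed_vector"
  assumes "lipschitz_ivl a b f"
  shows "lipschitz_ivl a b (\<lambda>t. norm (f t))"
proof (rule lipschitz_ivl_compose[OF assms])
  show "1-lipschitz_on (f ` {a..b}) norm"
    by (rule lipschitz_onI) (auto simp: dist_norm norm_triangle_ineq3)
qed

lemma lipschitz_ivl_bounded:
  fixes f :: "real \<Rightarrow> 'a::real_normed_vector"
  assumes "lipschitz_ivl a b f"
  obtains B where "0 < B" "\<And>t. t \<in> {a..b} \<Longrightarrow> norm (f t) \<le> B"
proof -
  have "bounded (f ` {a..b})"
    by (intro compact_imp_bounded compact_continuous_image lipschitz_ivl_continuous[OF assms]) simp
  then show thesis unfolding bounded_pos using that by auto
qed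

lemma lipschitz_ivl_scaleR:
  fixes f :: "real \<Rightarrow> real" and g :: "real \<Rightarrow> 'a::real_normed_vector"
  assumes f: "lipschitz_ivl a b f" and g: "lipschitz_ivl a b g"
  shows "lipschitz_ivl a b (\<lambda>t. f t *\<^sub>R g t)"
proof -
  obtain C where C: "C-lipschitz_on {a..b} f" using f lipschitz_ivl_def by blast
  obtain D where D: "D-lipschitz_on {a..b} g" using g lipschitz_ivl_def by blast
  obtain A where A: "0 < A" "\<And>t. t \<in> {a..b} \<Longrightarrow> norm (f t) \<le> A"
    using lipschitz_ivl_bounded[OF f] by blast
  obtain B where B: "0 < B" "\<And>t. t \<in> {a..b} \<Longrightarrow> norm (g t) \<le> B"
    using lipschitz_ivl_bounded[OF g] by blast
  have C0: "0 \<le> C" and D0: "0 \<le> D" using C D lipschitz_on_nonneg by blast+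
  have "(A * D + C * B)-lipschitz_on {a..b} (\<lambda>t. f t *\<^sub>R g t)"
  proof (rule lipschitz_onI)
    fix x y assume x: "x \<in> {a..b}" and y: "y \<in> {a..b}"
    have "f x *\<^sub>R g x - f y *\<^sub>R g y = f x *\<^sub>R (g x - g y) + (f x - f y) *\<^sub>R g y"
      by (simp add: algebra_simps)
    then have "dist (f x *\<^sub>R g x) (f y *\<^sub>R g y) \<le> norm (f x) * norm (g x - g y) + norm (f x - f y) * norm (g y)"
      using norm_triangle_ineq[of "f x *\<^sub>R (g x - g y)" "(f x - f y) *\<^sub>R g y"] by (simp add: dist_norm)
    also have "\<dots> \<le> A * (D * dist x y) + (C * dist x y) * B"
      using lipschitz_onD[OF C x y] lipschitz_onD[OF D x y] A(2)[OF x] B(2)[OF y] A(1) C0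
      by (intro add_mono mult_mono) (auto simp: dist_norm)
    finally show "dist (f x *\<^sub>R g x) (f y *\<^sub>R g y) \<le> (A * D + C * B) * dist x y"
      by (simp add: algebra_simps)
  qed (use A B C0 D0 in simp)
  then show ?thesis unfolding lipschitz_ivl_def by blast
qed

text \<open>The image of \<open>{a..b}\<close> is compact and convex, so a bound for
  \<open>g'\<close> there is a Lipschitz constant for \<open>g\<close>. Smoothness is asked on the
  image only, which admits \<open>ln\<close>, \<open>inverse\<close> and
  \<open>artanh\<close>.\<close>

lemma lipschitz_ivl_compose_C1:
  fixes f :: "real \<Rightarrow> real" and g :: "real \<Rightarrow> real"
  assumes f: "lipschitz_ivl a b f"
    and g: "\<And>x. x \<in> f ` {a..b} \<Longrightarrow> (g has_real_derivative g' x) (at x)"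
    and g': "continuous_on (f ` {a..b}) g'"
  shows "lipschitz_ivl a b (\<lambda>t. g (f t))"
proof -
  have fc: "continuous_on {a..b} f" using f by (rule lipschitz_ivl_continuous)
  have "bounded (g' ` f ` {a..b})"
    by (intro compact_imp_bounded compact_continuous_image fc g') simp
  then obtain B where B: "0 < B" "\<And>x. x \<in> f ` {a..b} \<Longrightarrow> norm (g' x) \<le> B"
    unfolding bounded_pos by auto
  have cvx: "convex (f ` {a..b})"
    unfolding connected_convex_1[symmetric] by (intro connected_continuous_image[OF fc] connected_Icc)
  have "B-lipschitz_on (f ` {a..b}) g"
  proof (rule lipschitz_onI)
    fix x y assume "x \<in> f ` {a..b}" "y \<in> f ` {a..b}"
    then have "norm (g x - g y) \<le> B * norm (x - y)"
      by (intro field_differentiable_bound[OF cvx has_field_derivative_at_within[OF g] B(2)])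
    then show "dist (g x) (g y) \<le> B * dist x y" by (simp add: dist_norm)
  qed (use B in simp)
  then show ?thesis by (rule lipschitz_ivl_compose[OF f])
qed

lemma lipschitz_ivl_ae_differentiable:
  fixes f :: "real \<Rightarrow> 'a::euclidean_space"
  assumes f: "lipschitz_ivl a b f"
  obtains N C where "negligible N" "0 \<le> C"
    "\<And>t. t \<in> {a..b} - N \<Longrightarrow> a < t \<and> t < b"
    "\<And>t. t \<in> {a..b} - N \<Longrightarrow> (f has_vector_derivative vector_derivative f (at t)) (at t)"
    "\<And>t. t \<in> {a..b} - N \<Longrightarrow> norm (vector_derivative f (at t)) \<le> C"
proof -
  obtain C where C: "C-lipschitz_on {a..b} f" using f lipschitz_ivl_def by blast
  obtain N where N: "negligible N"
    "\<And>t. t \<in> {a..b} - N \<Longrightarrow> a < t \<and> t < b \<and> (f has_vector_derivative vector_derivative f (at t)) (at t)"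
    using lipschitz_ae_differentiable[OF C] by blast
  show thesis
  proof (rule that[OF N(1) lipschitz_on_nonneg[OF C]])
    fix t assume t: "t \<in> {a..b} - N"
    show "a < t \<and> t < b" using N(2)[OF t] by simp
    show "(f has_vector_derivative vector_derivative f (at t)) (at t)" using N(2)[OF t] by simp
    show "norm (vector_derivative f (at t)) \<le> C"
      using N(2)[OF t] by (intro norm_vector_derivative_le_lipschitz[OF C]) auto
  qed
qed

lemma lipschitz_ivl_fundamental_theorem:
  fixes f :: "real \<Rightarrow> 'a::euclidean_space"
  assumes "lipschitz_ivl a b f" "a \<le> b"
  shows "((\<lambda>t. vector_derivative f (at t)) has_integral f b - f a) {a..b}"
  using assms lipschitz_fundamental_theorem unfolding lipschitz_ivl_def by blast

lemma lipschitz_ivl_measurable: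
  fixes f :: "real \<Rightarrow> 'a::euclidean_space"
  assumes "lipschitz_ivl a b f"
  shows "f \<in> borel_measurable (lebesgue_on {a..b})"
    "(\<lambda>t. vector_derivative f (at t)) \<in> borel_measurable (lebesgue_on {a..b})"
proof -
  show "f \<in> borel_measurable (lebesgue_on {a..b})"
    using lipschitz_ivl_continuous[OF assms] by (rule continuous_imp_measurable_on_sets_lebesgue) simp
  show "(\<lambda>t. vector_derivative f (at t)) \<in> borel_measurable (lebesgue_on {a..b})"
  proof (cases "a \<le> b")
    case True
    then show ?thesis
      using lipschitz_ivl_fundamental_theorem[OF assms True] integrable_imp_measurable has_integral_integrable by blast
  next
    case False
    then have "{a..b} = {}" by simp
    then show ?thesis by (auto simp: measurable_def space_restrict_space)
  qed
qed

lemma bounded_ae_measurable_integrable: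
  fixes F :: "real \<Rightarrow> real"
  assumes F: "F \<in> borel_measurable (lebesgue_on {a..b})" and N: "negligible N"
    and bd: "\<And>t. t \<in> {a..b} - N \<Longrightarrow> \<bar>F t\<bar> \<le> C"
  shows "F integrable_on {a..b}"
proof -
  \<comment> \<open>The bound holds only off \<open>N\<close>; the truncation is bounded everywhere
    and differs from \<open>F\<close> at most on \<open>N\<close>.\<close>
  have "(\<lambda>t. max (- C) (min C (F t))) integrable_on {a..b}"
  proof (rule measurable_bounded_by_integrable_imp_integrable)
    show "(\<lambda>t. max (- C) (min C (F t))) \<in> borel_measurable (lebesgue_on {a..b})"
      using F by measurable
    show "(\<lambda>_. \<bar>C\<bar>) integrable_on {a..b}" by (rule integrable_const_ivl)
  qed (auto simp: max_def min_def)
  then show ?thesis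
    by (rule integrable_spike[OF _ N]) (use bd in \<open>fastforce simp: max_def min_def abs_le_iff\<close>)
qed

lemma integral_le_ae:
  fixes f g :: "real \<Rightarrow> real"
  assumes "f integrable_on S" "g integrable_on S" "negligible N" "\<And>x. x \<in> S - N \<Longrightarrow> f x \<le> g x"
  shows "integral S f \<le> integral S g"
proof -
  let ?g = "\<lambda>x. if x \<in> N then f x else g x"
  have "?g integrable_on S" by (rule integrable_spike[OF assms(2,3)]) auto
  then have "integral S f \<le> integral S ?g" by (intro integral_le assms) (use assms(4) in auto)
  also have "integral S ?g = integral S g" by (rule integral_spike[OF assms(3)]) auto
  finally show ?thesis .
qed

text \<open>This rests on the fundamental theorem for Lipschitz functions; the Cantor function shows
  that continuity would be too little.\<close>

lemma lipschitz_ivl_const_if_ae_derivative_0: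
  fixes f :: "real \<Rightarrow> 'a::euclidean_space"
  assumes f: "lipschitz_ivl a b f" and N: "negligible N"
    and 0: "\<And>t. t \<in> {a..b} - N \<Longrightarrow> vector_derivative f (at t) = 0" and t: "t \<in> {a..b}"
  shows "f t = f a"
proof -
  have "((\<lambda>t. vector_derivative f (at t)) has_integral f t - f a) {a..t}"
    by (rule lipschitz_ivl_fundamental_theorem[OF lipschitz_ivl_subset[OF f]]) (use t in auto)
  moreover have "((\<lambda>t. vector_derivative f (at t)) has_integral 0) {a..t}"
    by (rule has_integral_spike[OF N _ has_integral_0]) (use 0 t in simp)
  ultimately have "f t - f a = 0" by (rule has_integral_unique)
  then show ?thesis by simp
qed

text \<open>Needed before lengths can be estimated, since \<open>integral\<close> assigns 0 to a
  speed that is not integrable.\<close>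

lemma conformal_speed_integrable:
  fixes c :: "real \<Rightarrow> 'a::euclidean_space"
  assumes c: "lipschitz_curve U a b c" and w: "continuous_on U w"
  shows "(\<lambda>t. w (c t) * norm (vector_derivative c (at t))) integrable_on {a..b}"
proof -
  have lc: "lipschitz_ivl a b c" and cU: "c ` {a..b} \<subseteq> U" using c by (auto simp: lipschitz_curve_iff)
  obtain N C where N: "negligible N" "0 \<le> C"
    "\<And>t. t \<in> {a..b} - N \<Longrightarrow> norm (vector_derivative c (at t)) \<le> C"
    using lipschitz_ivl_ae_differentiable[OF lc] by metis
  have wc: "continuous_on {a..b} (\<lambda>t. w (c t))"
    by (rule continuous_on_compose2[OF w lipschitz_ivl_continuous[OF lc] cU])
  then have "bounded ((\<lambda>t. w (c t)) ` {a..b})" by (intro compact_imp_bounded compact_continuous_image) auto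
  then obtain B where B: "0 < B" "\<And>t. t \<in> {a..b} \<Longrightarrow> norm (w (c t)) \<le> B"
    unfolding bounded_pos by auto
  note [measurable] = lipschitz_ivl_measurable[OF lc]
  show ?thesis
  proof (rule bounded_ae_measurable_integrable[OF _ N(1)])
    have [measurable]: "(\<lambda>t. w (c t)) \<in> borel_measurable (lebesgue_on {a..b})"
      using wc by (rule continuous_imp_measurable_on_sets_lebesgue) simp
    show "(\<lambda>t. w (c t) * norm (vector_derivative c (at t))) \<in> borel_measurable (lebesgue_on {a..b})"
      by measurable
    show "\<bar>w (c t) * norm (vector_derivative c (at t))\<bar> \<le> B * C" if "t \<in> {a..b} - N" for t
      unfolding abs_mult using that B(1) B(2)[of t] N(3)[of t] by (intro mult_mono) auto
  qed
qed

lemma curve_length_isometry: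
  fixes T :: "'a::euclidean_space \<Rightarrow> 'a"
  assumes c: "lipschitz_curve U a b c"
    and T: "\<And>x. x \<in> U \<Longrightarrow> (T has_derivative T' x) (at x)"
    and iso: "\<And>x v. x \<in> U \<Longrightarrow> g2 (T x) (T' x v) (T' x v) = g1 x v v"
  shows "curve_length g2 a b (T \<circ> c) = curve_length g1 a b c"
proof -
  have lc: "lipschitz_ivl a b c" and cU: "c ` {a..b} \<subseteq> U" using c by (auto simp: lipschitz_curve_iff)
  obtain N where N: "negligible N"
    "\<And>t. t \<in> {a..b} - N \<Longrightarrow> (c has_vector_derivative vector_derivative c (at t)) (at t)"
    using lipschitz_ivl_ae_differentiable[OF lc] by metis
  show ?thesis unfolding curve_length_def
  proof (rule integral_spike[OF N(1)])
    fix t assume t: "t \<in> {a..b} - N"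
    then have ct: "c t \<in> U" using cU by auto
    have "((T \<circ> c) has_vector_derivative T' (c t) (vector_derivative c (at t))) (at t)"
      by (rule vector_derivative_diff_chain_within[OF N(2)[OF t]])
        (use T[OF ct] in \<open>rule has_derivative_at_withinI\<close>)
    then have "vector_derivative (T \<circ> c) (at t) = T' (c t) (vector_derivative c (at t))"
      by (rule vector_derivative_at)
    then show "sqrt (g1 (c t) (vector_derivative c (at t)) (vector_derivative c (at t)))
      = sqrt (g2 ((T \<circ> c) t) (vector_derivative (T \<circ> c) (at t)) (vector_derivative (T \<circ> c) (at t)))"
      using iso[OF ct] by simp
  qed
qed

section \<open>The hyperbolic distance to the origin\<close>

text \<open>The integral of the conformal factor \<open>2 / (1 - s^2)\<close> from 0 to
  \<open>norm x\<close>; \<open>riem_dist_0\<close> identifies it with the distance to the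
  origin.\<close>

definition hyp_radius :: "'a::euclidean_space \<Rightarrow> real" where
  "hyp_radius x = 2 * artanh (norm x)"

lemma norm_less_1_square: "norm x < 1 \<Longrightarrow> 0 < 1 - (norm x)\<^sup>2"
  by (simp add: power_less_one_iff)

lemma hyperbolic_speed:
  assumes "x \<in> hyperbolic_space"
  shows "sqrt (hyperbolic_metric x v v) = 2 / (1 - (norm x)\<^sup>2) * norm v"
proof -
  have "0 < 1 - (norm x)\<^sup>2" using assms by (intro norm_less_1_square) (simp add: hyperbolic_space_def)
  then have "sqrt (hyperbolic_metric x v v) = sqrt ((2 / (1 - (norm x)\<^sup>2) * norm v)\<^sup>2)"
    by (simp add: hyperbolic_metric_def power_mult_distrib power_divide dot_square_norm)
  also have "\<dots> = 2 / (1 - (norm x)\<^sup>2) * norm v"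
    using \<open>0 < 1 - (norm x)\<^sup>2\<close> by (intro real_sqrt_unique) auto
  finally show ?thesis .
qed

lemma artanh_derivative_at:
  assumes "\<bar>x\<bar> < (1::real)"
  shows "((\<lambda>x. 2 * artanh x) has_real_derivative 2 / (1 - x\<^sup>2)) (at x)"
proof -
  have "((\<lambda>x. 2 * artanh x) has_real_derivative 2 * (1 / (1 - x\<^sup>2))) (at x)"
    by (intro DERIV_cmult artanh_real_has_field_derivative assms)
  then show ?thesis by simp
qed

lemma hyp_radius_nonneg:
  assumes "x \<in> hyperbolic_space"
  shows "0 \<le> hyp_radius x" "x \<noteq> 0 \<Longrightarrow> 0 < hyp_radius x"
proof -
  have "norm x < 1" using assms by (simp add: hyperbolic_space_def)
  then have "1 < (1 + norm x) / (1 - norm x)" if "x \<noteq> 0"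
    using that by (simp add: field_simps)
  then show "x \<noteq> 0 \<Longrightarrow> 0 < hyp_radius x" by (simp add: hyp_radius_def artanh_def ln_gt_zero)
  then show "0 \<le> hyp_radius x" by (cases "x = 0") (auto simp: hyp_radius_def)
qed

lemma hyp_radius_tanh:
  assumes "norm \<theta> = 1" "0 \<le> r"
  shows "hyp_radius (tanh (r / 2) *\<^sub>R \<theta>) = r"
  using assms by (simp add: hyp_radius_def artanh_tanh_real)

lemma tanh_hyp_radius:
  assumes "x \<in> hyperbolic_space"
  shows "tanh (hyp_radius x / 2) = norm x"
proof -
  have n: "norm x < 1" using assms by (simp add: hyperbolic_space_def)
  have "exp (- 2 * artanh (norm x)) = (1 - norm x) / (1 + norm x)"
  proof -
    have "0 < (1 + norm x) / (1 - norm x)" using n by (simp add: add_pos_nonneg)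
    then show ?thesis by (simp add: artanh_def exp_minus)
  qed
  then show ?thesis
    using n norm_ge_zero[of x] unfolding hyp_radius_def tanh_real_altdef 
    by (simp add: divide_simps add_nonneg_eq_0_iff) (simp add: algebra_simps)
qed

lemma lipschitz_ivl_hyp_radius:
  assumes c: "lipschitz_curve hyperbolic_space a b c"
  shows "lipschitz_ivl a b (\<lambda>t. hyp_radius (c t))"
  unfolding hyp_radius_def
proof (rule lipschitz_ivl_compose_C1[where f = "\<lambda>t. norm (c t)" and g = "\<lambda>x. 2 * artanh x" and g' = "\<lambda>x. 2 / (1 - x\<^sup>2)"])
  show "lipschitz_ivl a b (\<lambda>t. norm (c t))"
    using c by (intro lipschitz_ivl_norm) (simp add: lipschitz_curve_iff)
  have *: "0 \<le> x \<and> x < 1" if "x \<in> (\<lambda>t. norm (c t)) ` {a..b}" for x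
    using that c by (auto simp: lipschitz_curve_iff hyperbolic_space_def)
  show "((\<lambda>x. 2 * artanh x) has_real_derivative 2 / (1 - x\<^sup>2)) (at x)"
    if "x \<in> (\<lambda>t. norm (c t)) ` {a..b}" for x
    using *[OF that] by (intro artanh_derivative_at) simp
  have "1 - x\<^sup>2 \<noteq> 0" if "x \<in> (\<lambda>t. norm (c t)) ` {a..b}" for x
    using *[OF that] norm_less_1_square[of x] by simp
  then show "continuous_on ((\<lambda>t. norm (c t)) ` {a..b}) (\<lambda>x. 2 / (1 - x\<^sup>2))"
    by (intro continuous_intros) simp
qed

lemma continuous_on_hyp_factor: "continuous_on hyperbolic_space (\<lambda>x. 2 / (1 - (norm x)\<^sup>2))"
proof -
  have "1 - (norm x)\<^sup>2 \<noteq> 0" if "x \<in> hyperbolic_space" for x :: 'a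
    using norm_less_1_square[of x] that by (simp add: hyperbolic_space_def)
  then show ?thesis by (intro continuous_intros) simp
qed

lemma curve_length_hyperbolic:
  assumes "c ` {a..b} \<subseteq> hyperbolic_space"
  shows "curve_length hyperbolic_metric a b c
    = integral {a..b} (\<lambda>t. 2 / (1 - (norm (c t))\<^sup>2) * norm (vector_derivative c (at t)))"
  unfolding curve_length_def by (rule integral_cong, rule hyperbolic_speed) (use assms in blast)

text \<open>By Cauchy-Schwarz the radial part of the velocity is at most its norm, so the radius
  changes at most at the hyperbolic speed. This is the lower bound for all distances computed
  below.\<close>

lemma hyp_radius_diff_le_length:
  fixes c :: "real \<Rightarrow> 'a::euclidean_space"
  assumes c: "lipschitz_curve hyperbolic_space a b c" and ab: "a \<le> b"
  shows "\<bar>hyp_radius (c b) - hyp_radius (c a)\<bar> \<le> curve_length hyperbolic_metric a b c"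
proof -
  have cU: "c ` {a..b} \<subseteq> hyperbolic_space" and lc: "lipschitz_ivl a b c"
    using c by (auto simp: lipschitz_curve_iff)
  let ?f = "\<lambda>t. hyp_radius (c t)"
  let ?F = "\<lambda>t. 2 / (1 - (norm (c t))\<^sup>2) * norm (vector_derivative c (at t))"
  have lf: "lipschitz_ivl a b ?f" using c by (rule lipschitz_ivl_hyp_radius)
  obtain N1 where N1: "negligible N1" "\<And>t. t \<in> {a..b} - N1 \<Longrightarrow> a < t \<and> t < b"
    "\<And>t. t \<in> {a..b} - N1 \<Longrightarrow> (c has_vector_derivative vector_derivative c (at t)) (at t)"
    using lipschitz_ivl_ae_differentiable[OF lc] by metis
  obtain N2 where N2: "negligible N2"
    "\<And>t. t \<in> {a..b} - N2 \<Longrightarrow> (?f has_vector_derivative vector_derivative ?f (at t)) (at t)"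
    using lipschitz_ivl_ae_differentiable[OF lf] by metis
  have le: "\<bar>vector_derivative ?f (at t)\<bar> \<le> ?F t" if t: "t \<in> {a..b} - (N1 \<union> N2)" for t
  proof -
    have tab: "a < t" "t < b" using t N1(2)[of t] by auto
    have ct: "c t \<in> hyperbolic_space" using cU t by blast
    then have n1: "norm (c t) < 1" by (simp add: hyperbolic_space_def)
    have dc: "(c has_vector_derivative vector_derivative c (at t)) (at t)"
      and df: "(?f has_real_derivative vector_derivative ?f (at t)) (at t)"
      using N1(3)[of t] N2(2)[of t] t by (auto simp: has_real_derivative_iff_has_vector_derivative)
    have F0: "0 \<le> ?F t" using norm_less_1_square[OF n1] by simp
    show ?thesis
    proof (cases "c t = 0")
      case True
      \<comment> \<open>The norm is not differentiable at the origin, but the radius along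
        \<open>c\<close> is differentiable off \<open>N2\<close> and has a minimum at
        \<open>t\<close>.\<close>
      have "vector_derivative ?f (at t) = 0"
      proof (rule DERIV_local_min[OF df])
        show "0 < min (t - a) (b - t)" using tab by simp
        show "\<forall>y. \<bar>t - y\<bar> < min (t - a) (b - t) \<longrightarrow> ?f t \<le> ?f y"
        proof (intro allI impI)
          fix y assume "\<bar>t - y\<bar> < min (t - a) (b - t)"
          then have "c y \<in> hyperbolic_space" using cU by (intro subsetD[OF cU] imageI) auto
          then show "?f t \<le> ?f y" using hyp_radius_nonneg(1)[of "c y"] True by (simp add: hyp_radius_def)
        qed
      qed
      then show ?thesis using F0 by simp
    next
      case False
      have "((\<lambda>s. norm (c s)) has_derivative (\<lambda>h. (h *\<^sub>R vector_derivative c (at t)) \<bullet> sgn (c t))) (at t)"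
        using False by (intro has_derivative_compose[OF dc[unfolded has_vector_derivative_def]] has_derivative_norm)
      then have "((\<lambda>s. norm (c s)) has_real_derivative (vector_derivative c (at t) \<bullet> sgn (c t))) (at t)"
        by (simp add: has_field_derivative_def mult_commute_abs)
      then have "(?f has_real_derivative 2 / (1 - (norm (c t))\<^sup>2) * (vector_derivative c (at t) \<bullet> sgn (c t))) (at t)"
        unfolding hyp_radius_def using n1
        by (intro DERIV_chain2[where f = "\<lambda>x. 2 * artanh x"] artanh_derivative_at) simp
      then have "vector_derivative ?f (at t) = 2 / (1 - (norm (c t))\<^sup>2) * (vector_derivative c (at t) \<bullet> sgn (c t))"
        using df by (rule DERIV_unique[rotated])
      moreover have "\<bar>vector_derivative c (at t) \<bullet> sgn (c t)\<bar> \<le> norm (vector_derivative c (at t))"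
        using Cauchy_Schwarz_ineq2[of "vector_derivative c (at t)" "sgn (c t)"] False by (simp add: norm_sgn)
      ultimately show ?thesis
        using norm_less_1_square[OF n1] by (simp add: abs_mult divide_right_mono)
    qed
  qed
  have N: "negligible (N1 \<union> N2)" using N1(1) N2(1) by (rule negligible_Un)
  have Fi: "?F integrable_on {a..b}"
    by (rule conformal_speed_integrable[OF c continuous_on_hyp_factor])
  have f': "((\<lambda>t. vector_derivative ?f (at t)) has_integral ?f b - ?f a) {a..b}"
    by (rule lipschitz_ivl_fundamental_theorem[OF lf ab])
  have "?f b - ?f a \<le> integral {a..b} ?F"
    unfolding integral_unique[OF f', symmetric]
    by (rule integral_le_ae[OF has_integral_integrable[OF f'] Fi N]) (use le in fastforce)
  moreover have "- (?f b - ?f a) \<le> integral {a..b} ?F"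
    unfolding integral_unique[OF has_integral_neg[OF f'], symmetric]
    by (rule integral_le_ae[OF has_integral_integrable[OF has_integral_neg[OF f']] Fi N]) (use le in fastforce)
  ultimately show ?thesis unfolding curve_length_hyperbolic[OF cU] by linarith
qed

lemma abs_tanh_less_1: "\<bar>tanh (x::real)\<bar> < 1"
  using tanh_real_lt_1[of x] tanh_real_gt_neg1[of x] by linarith

lemma radial_in_hyperbolic_space: "norm \<theta> = 1 \<Longrightarrow> tanh (r::real) *\<^sub>R \<theta> \<in> hyperbolic_space"
  using abs_tanh_less_1[of r] by (simp add: hyperbolic_space_def)

lemma tanh_half_derivative:
  assumes "(u has_real_derivative u') (at t)"
  shows "((\<lambda>t. tanh (u t / 2)) has_real_derivative (1 - (tanh (u t / 2))\<^sup>2) / 2 * u') (at t)"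
  using assms by (auto intro!: derivative_eq_intros simp: cosh_real_pos less_imp_neq[THEN not_sym])

text \<open>A point at hyperbolic distance \<open>r\<close> from the origin has Euclidean norm
  \<open>tanh (r / 2)\<close>. Letting the distance vary affinely therefore gives constant
  hyperbolic speed.\<close>

lemma radial_curve:
  fixes \<theta> :: "'a::euclidean_space"
    and r s :: real
  assumes \<theta>: "norm \<theta> = 1"
  defines "c \<equiv> \<lambda>t. tanh ((r + (s - r) * t) / 2) *\<^sub>R \<theta>"
  shows "lipschitz_curve hyperbolic_space 0 1 c" "curve_length hyperbolic_metric 0 1 c = \<bar>s - r\<bar>"
proof -
  have cU: "c t \<in> hyperbolic_space" for t unfolding c_def by (rule radial_in_hyperbolic_space[OF \<theta>])
  have du: "((\<lambda>t. r + (s - r) * t) has_real_derivative s - r) (at t)" for t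
    by (auto intro!: derivative_eq_intros)
  let ?g' = "\<lambda>t. (1 - (tanh ((r + (s - r) * t) / 2))\<^sup>2) / 2 * (s - r)"
  have dt: "((\<lambda>t. tanh ((r + (s - r) * t) / 2)) has_real_derivative ?g' t) (at t)" for t
    by (rule tanh_half_derivative[OF du])
  have "lipschitz_ivl 0 1 (\<lambda>t. tanh ((r + (s - r) * t) / 2))"
  proof (rule lipschitz_ivl_compose_C1[where f = "\<lambda>t. t" and g = "\<lambda>t. tanh ((r + (s - r) * t) / 2)" and g' = ?g'])
    show "lipschitz_ivl 0 1 (\<lambda>t::real. t)" unfolding lipschitz_ivl_def using lipschitz_on_id by blast
    show "continuous_on ((\<lambda>t. t) ` {0..1}) ?g'"
      by (intro continuous_intros) (auto simp: less_imp_neq[THEN not_sym] cosh_real_pos)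
  qed (rule dt)
  then have "lipschitz_ivl 0 1 c" unfolding c_def by (rule lipschitz_ivl_scaleR[OF _ lipschitz_ivl_const])
  then show "lipschitz_curve hyperbolic_space 0 1 c" using cU by (auto simp: lipschitz_curve_iff)
  have sp: "2 / (1 - (norm (c t))\<^sup>2) * norm (vector_derivative c (at t)) = \<bar>s - r\<bar>" for t
  proof -
    let ?R = "tanh ((r + (s - r) * t) / 2)"
    have "(c has_vector_derivative ?g' t *\<^sub>R \<theta>) (at t)" unfolding c_def
      using dt[of t] by (auto intro!: derivative_eq_intros simp: has_real_derivative_iff_has_vector_derivative)
    then have "norm (vector_derivative c (at t)) = \<bar>?g' t\<bar>" using \<theta> by (simp add: vector_derivative_at)
    moreover have "0 < 1 - ?R\<^sup>2"
      using abs_tanh_less_1[of "(r + (s - r) * t) / 2"] norm_less_1_square[of ?R] by simp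
    moreover have "norm (c t) = \<bar>?R\<bar>" using \<theta> by (simp add: c_def)
    ultimately show ?thesis by (simp add: abs_mult divide_simps) (simp add: mult.commute)
  qed
  have "c ` {0..1} \<subseteq> hyperbolic_space" using cU by auto
  from curve_length_hyperbolic[OF this] show "curve_length hyperbolic_metric 0 1 c = \<bar>s - r\<bar>"
    unfolding sp by simp
qed

text \<open>The infimum is attained by the radial curve, and
  \<open>hyp_radius_diff_le_length\<close> bounds every competitor from below.\<close>

lemma riem_dist_radial:
  fixes \<theta> :: "'a::euclidean_space"
  assumes \<theta>: "norm \<theta> = 1" and r: "0 \<le> r" and s: "0 \<le> s"
  shows "riem_dist hyperbolic_space hyperbolic_metric (tanh (r / 2) *\<^sub>R \<theta>) (tanh (s / 2) *\<^sub>R \<theta>) = \<bar>r - s\<bar>"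
  unfolding riem_dist_def
proof (rule cInf_eq_minimum)
  show "\<bar>r - s\<bar> \<in> {curve_length hyperbolic_metric 0 1 c |c. lipschitz_curve hyperbolic_space 0 1 c \<and>
      c 0 = tanh (r / 2) *\<^sub>R \<theta> \<and> c 1 = tanh (s / 2) *\<^sub>R \<theta>}"
    using radial_curve[OF \<theta>, of r s]
    by (auto simp: abs_minus_commute intro!: exI[of _ "\<lambda>t. tanh ((r + (s - r) * t) / 2) *\<^sub>R \<theta>"])
  fix l assume "l \<in> {curve_length hyperbolic_metric 0 1 c |c. lipschitz_curve hyperbolic_space 0 1 c \<and>
      c 0 = tanh (r / 2) *\<^sub>R \<theta> \<and> c 1 = tanh (s / 2) *\<^sub>R \<theta>}"
  then obtain c where c: "l = curve_length hyperbolic_metric 0 1 c" "lipschitz_curve hyperbolic_space 0 1 c"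
      "c 0 = tanh (r / 2) *\<^sub>R \<theta>" "c 1 = tanh (s / 2) *\<^sub>R \<theta>" by blast
  show "\<bar>r - s\<bar> \<le> l"
    using hyp_radius_diff_le_length[OF c(2)] hyp_radius_tanh[OF \<theta> r] hyp_radius_tanh[OF \<theta> s] c
    by (simp add: abs_minus_commute)
qed

lemma riem_dist_0:
  fixes x :: "'a::euclidean_space"
  assumes x: "x \<in> hyperbolic_space"
  shows "riem_dist hyperbolic_space hyperbolic_metric x 0 = hyp_radius x"
proof -
  obtain \<theta> :: 'a where \<theta>: "norm \<theta> = 1" "x = norm x *\<^sub>R \<theta>"
  proof (cases "x = 0")
    case True
    \<comment> \<open>At the origin any unit vector can serve as the direction.\<close>
    then show ?thesis using that[of "SOME i. i \<in> Basis"] by (simp add: SOME_Basis)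
  next
    case False
    then show ?thesis using that[of "sgn x"] by (simp add: norm_sgn sgn_div_norm)
  qed
  have "x = tanh (hyp_radius x / 2) *\<^sub>R \<theta>" using \<theta>(2) tanh_hyp_radius[OF x] by simp
  then show ?thesis
    using riem_dist_radial[OF \<theta>(1) hyp_radius_nonneg(1)[OF x] order_refl] hyp_radius_nonneg(1)[OF x]
    by simp
qed

lemma riem_setdist_0:
  "x \<in> hyperbolic_space \<Longrightarrow> riem_setdist hyperbolic_space hyperbolic_metric x {0} = hyp_radius x"
  by (simp add: riem_setdist_def riem_dist_0)

section \<open>Polar coordinates\<close>

definition warp :: "real \<Rightarrow> real" where
  "warp s = (sinh (exp s) / exp s)\<^sup>2"

definition warp' :: "real \<Rightarrow> real" where
  "warp' s = 2 * (sinh (exp s) / exp s) * (cosh (exp s) - sinh (exp s) / exp s)"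

lemma sinh_gt_self:
  assumes "0 < (y::real)"
  shows "y < sinh y"
proof -
  have "sinh 0 - 0 < sinh y - y"
  proof (rule DERIV_pos_imp_increasing_open[OF assms])
    fix x :: real assume "0 < x"
    then have "1 < cosh x" by (simp add: cosh_real_strict_mono[of 0 x, simplified])
    moreover have "((\<lambda>x. sinh x - x) has_real_derivative cosh x - 1) (at x)"
      by (auto intro!: derivative_eq_intros)
    ultimately show "\<exists>d. ((\<lambda>x. sinh x - x) has_real_derivative d) (at x) \<and> 0 < d" by force
  qed (intro continuous_intros)
  then show ?thesis by simp
qed

text \<open>Positivity of the derivative of \<open>sinh y / y\<close>, which is why
  \<open>warp\<close> increases.\<close>

lemma sinh_less_mult_cosh:
  assumes "0 < (y::real)"
  shows "sinh y < y * cosh y"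
proof -
  have "0 * cosh 0 - sinh 0 < y * cosh y - sinh y"
  proof (rule DERIV_pos_imp_increasing_open[OF assms])
    fix x :: real assume "0 < x"
    then have "0 < x * sinh x" by simp
    moreover have "((\<lambda>x. x * cosh x - sinh x) has_real_derivative x * sinh x) (at x)"
      by (auto intro!: derivative_eq_intros)
    ultimately show "\<exists>d. ((\<lambda>x. x * cosh x - sinh x) has_real_derivative d) (at x) \<and> 0 < d" by force
  qed (intro continuous_intros)
  then show ?thesis by simp
qed

lemma warp_gt_1: "1 < warp s"
proof -
  have "1 < sinh (exp s) / exp s" using sinh_gt_self[of "exp s"] by simp
  then show ?thesis unfolding warp_def by (simp add: one_less_power)
qed

lemma warp_derivative: "(warp has_real_derivative warp' s) (at s)"
  unfolding warp_def [abs_def] warp'_def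
  by (auto intro!: derivative_eq_intros) (simp add: field_simps power2_eq_square)

lemma warp'_pos: "0 < warp' s"
proof -
  have "sinh (exp s) / exp s < cosh (exp s)"
    using sinh_less_mult_cosh[of "exp s"] by (simp add: field_simps)
  then show ?thesis unfolding warp'_def by simp
qed

lemma continuous_on_warp: "continuous_on S warp" "continuous_on S warp'"
  unfolding warp_def [abs_def] warp'_def [abs_def] by (intro continuous_intros; simp)+

lemma strict_mono_warp: "strict_mono warp"
proof (rule strict_monoI)
  fix x y :: real assume "x < y"
  then show "warp x < warp y"
  proof (rule DERIV_pos_imp_increasing)
    show "\<exists>d. (warp has_real_derivative d) (at z) \<and> 0 < d" for z
      using warp_derivative[of z] warp'_pos[of z] by blast
  qed
qed

definition warp_length :: "real \<Rightarrow> real \<Rightarrow> (real \<Rightarrow> real) \<Rightarrow> (real \<Rightarrow> 'a::euclidean_space) \<Rightarrow> real" where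
  "warp_length a b \<sigma> \<theta> = integral {a..b}
     (\<lambda>t. sqrt ((vector_derivative \<sigma> (at t))\<^sup>2 + warp (\<sigma> t) * (norm (vector_derivative \<theta> (at t)))\<^sup>2))"

definition warp_energy :: "real \<Rightarrow> real \<Rightarrow> (real \<Rightarrow> real) \<Rightarrow> (real \<Rightarrow> 'a::euclidean_space) \<Rightarrow> real" where
  "warp_energy a b \<sigma> \<theta> = integral {a..b}
     (\<lambda>t. (vector_derivative \<sigma> (at t))\<^sup>2 + warp (\<sigma> t) * (norm (vector_derivative \<theta> (at t)))\<^sup>2)"

text \<open>The angular coordinate is a unit vector of the ambient space, so the round metric is the
  Euclidean norm of its derivative. The sphere needs no charts, and all dimensions are treated
  alike.\<close>

definition warp_curve :: "real \<Rightarrow> real \<Rightarrow> (real \<Rightarrow> real) \<Rightarrow> (real \<Rightarrow> 'a::euclidean_space) \<Rightarrow> bool" where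
  "warp_curve a b \<sigma> \<theta> \<longleftrightarrow> lipschitz_ivl a b \<sigma> \<and> lipschitz_ivl a b \<theta> \<and> (\<forall>t\<in>{a..b}. norm (\<theta> t) = 1)"

lemma warp_curve_subset: "warp_curve a b \<sigma> \<theta> \<Longrightarrow> a \<le> s \<Longrightarrow> t \<le> b \<Longrightarrow> warp_curve s t \<sigma> \<theta>"
  unfolding warp_curve_def by (auto intro: lipschitz_ivl_subset)

text \<open>The weight \<open>u\<close> is left general: besides \<open>warp\<close> along \<sigma>
  it will be the constant 1, a bump function and \<open>warp\<close> along a reparametrized
  \<sigma>.\<close>

lemma warp_curve_integrands:
  fixes \<theta> :: "real \<Rightarrow> 'a::euclidean_space"
  assumes "lipschitz_ivl a b \<sigma>" "lipschitz_ivl a b \<theta>" and u: "continuous_on {a..b} u"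
  shows "(\<lambda>t. sqrt ((vector_derivative \<sigma> (at t))\<^sup>2 + u t * (norm (vector_derivative \<theta> (at t)))\<^sup>2)) integrable_on {a..b}"
    "(\<lambda>t. (vector_derivative \<sigma> (at t))\<^sup>2) integrable_on {a..b}"
    "(\<lambda>t. u t * (norm (vector_derivative \<theta> (at t)))\<^sup>2) integrable_on {a..b}"
proof -
  note [measurable] = lipschitz_ivl_measurable[OF assms(1)] lipschitz_ivl_measurable[OF assms(2)]
  have [measurable]: "u \<in> borel_measurable (lebesgue_on {a..b})"
    using u by (rule continuous_imp_measurable_on_sets_lebesgue) simp
  obtain N1 A where N1: "negligible N1" "0 \<le> A" "\<And>t. t \<in> {a..b} - N1 \<Longrightarrow> norm (vector_derivative \<sigma> (at t)) \<le> A"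
    using lipschitz_ivl_ae_differentiable[OF assms(1)] by metis
  obtain N2 B where N2: "negligible N2" "0 \<le> B" "\<And>t. t \<in> {a..b} - N2 \<Longrightarrow> norm (vector_derivative \<theta> (at t)) \<le> B"
    using lipschitz_ivl_ae_differentiable[OF assms(2)] by metis
  have "bounded (u ` {a..b})" by (intro compact_imp_bounded compact_continuous_image u) simp
  then obtain K where K: "0 < K" "\<And>t. t \<in> {a..b} \<Longrightarrow> \<bar>u t\<bar> \<le> K" unfolding bounded_pos by auto
  have N: "negligible (N1 \<union> N2)" using N1(1) N2(1) by (rule negligible_Un)
  have bs: "\<bar>(vector_derivative \<sigma> (at t))\<^sup>2\<bar> \<le> A\<^sup>2" and bt: "\<bar>u t * (norm (vector_derivative \<theta> (at t)))\<^sup>2\<bar> \<le> K * B\<^sup>2"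
    if "t \<in> {a..b} - (N1 \<union> N2)" for t
  proof -
    show "\<bar>(vector_derivative \<sigma> (at t))\<^sup>2\<bar> \<le> A\<^sup>2"
      using N1(3)[of t] that N1(2) by (auto simp: abs_le_square_iff[symmetric])
    show "\<bar>u t * (norm (vector_derivative \<theta> (at t)))\<^sup>2\<bar> \<le> K * B\<^sup>2"
      unfolding abs_mult using N2(3)[of t] that K by (intro mult_mono) (auto intro: power_mono)
  qed
  show "(\<lambda>t. (vector_derivative \<sigma> (at t))\<^sup>2) integrable_on {a..b}"
    by (rule bounded_ae_measurable_integrable[OF _ N bs]) (measurable)
  show "(\<lambda>t. u t * (norm (vector_derivative \<theta> (at t)))\<^sup>2) integrable_on {a..b}"
    by (rule bounded_ae_measurable_integrable[OF _ N bt]) (measurable)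
  show "(\<lambda>t. sqrt ((vector_derivative \<sigma> (at t))\<^sup>2 + u t * (norm (vector_derivative \<theta> (at t)))\<^sup>2)) integrable_on {a..b}"
  proof (rule bounded_ae_measurable_integrable[OF _ N])
    show "(\<lambda>t. sqrt ((vector_derivative \<sigma> (at t))\<^sup>2 + u t * (norm (vector_derivative \<theta> (at t)))\<^sup>2))
        \<in> borel_measurable (lebesgue_on {a..b})" by measurable
    fix t assume t: "t \<in> {a..b} - (N1 \<union> N2)"
    have "\<bar>(vector_derivative \<sigma> (at t))\<^sup>2 + u t * (norm (vector_derivative \<theta> (at t)))\<^sup>2\<bar> \<le> A\<^sup>2 + K * B\<^sup>2"
      using bs[OF t] bt[OF t] by linarith
    \<comment> \<open>On reals \<open>sqrt\<close> is odd, so the bound also covers weights of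
      negative sign.\<close>
    moreover have "\<bar>sqrt x\<bar> = sqrt \<bar>x\<bar>" for x by (auto simp: abs_if real_sqrt_minus)
    ultimately show "\<bar>sqrt ((vector_derivative \<sigma> (at t))\<^sup>2 + u t * (norm (vector_derivative \<theta> (at t)))\<^sup>2)\<bar> \<le> sqrt (A\<^sup>2 + K * B\<^sup>2)"
      by simp
  qed
qed

lemma unit_curve_orthogonal:
  fixes \<theta> :: "real \<Rightarrow> 'a::real_inner"
  assumes u: "\<And>s. s \<in> {a..b} \<Longrightarrow> norm (\<theta> s) = 1" and t: "a < t" "t < b"
    and d: "(\<theta> has_vector_derivative v) (at t)"
  shows "\<theta> t \<bullet> v = 0"
proof -
  have "((\<lambda>s. \<theta> s \<bullet> \<theta> s) has_vector_derivative \<theta> t \<bullet> v + v \<bullet> \<theta> t) (at t)"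
    by (rule bounded_bilinear.has_vector_derivative[OF bounded_bilinear_inner d d])
  moreover have "((\<lambda>s. \<theta> s \<bullet> \<theta> s) has_vector_derivative 0) (at t)"
  proof (rule has_vector_derivative_transform_within_open)
    show "((\<lambda>s. 1) has_vector_derivative 0) (at t)" by (rule has_vector_derivative_const)
    show "1 = \<theta> s \<bullet> \<theta> s" if "s \<in> {a<..<b}" for s
      using u[of s] that unfolding power2_norm_eq_inner[symmetric] by simp
  qed (use t in auto)
  ultimately have "\<theta> t \<bullet> v + v \<bullet> \<theta> t = 0" by (rule vector_derivative_unique_at)
  then show ?thesis by (simp add: inner_commute)
qed

section \<open>The condition metric in polar coordinates\<close>

definition polar_chart :: "real \<Rightarrow> 'a::euclidean_space \<Rightarrow> 'a" where
  "polar_chart s \<theta> = tanh (exp s / 2) *\<^sub>R \<theta>"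

abbreviation condition_metric_0 :: "'a::euclidean_space metric_field" where
  "condition_metric_0 \<equiv> condition_metric hyperbolic_space hyperbolic_metric {0}"

lemma polar_chart_in:
  assumes "norm \<theta> = 1"
  shows "polar_chart s \<theta> \<in> hyperbolic_space - {0}" "hyp_radius (polar_chart s \<theta>) = exp s"
    "sgn (polar_chart s \<theta>) = \<theta>"
proof -
  have p: "0 < tanh (exp s / 2)" by simp
  show "polar_chart s \<theta> \<in> hyperbolic_space - {0}"
    using radial_in_hyperbolic_space[OF assms, of "exp s / 2"] assms p unfolding polar_chart_def by auto
  show "hyp_radius (polar_chart s \<theta>) = exp s"
    unfolding polar_chart_def by (rule hyp_radius_tanh[OF assms]) simp
  show "sgn (polar_chart s \<theta>) = \<theta>"
    using assms p unfolding polar_chart_def by (simp add: sgn_scaleR sgn_div_norm)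
qed

lemma polar_chart_inverse:
  assumes "x \<in> hyperbolic_space - {0}"
  shows "polar_chart (ln (hyp_radius x)) (sgn x) = x"
proof -
  have "exp (ln (hyp_radius x)) = hyp_radius x" using assms hyp_radius_nonneg(2)[of x] by simp
  then show ?thesis
    using assms tanh_hyp_radius[of x] by (simp add: polar_chart_def sgn_div_norm)
qed

lemma condition_speed_0:
  assumes "x \<in> hyperbolic_space - {0}"
  shows "sqrt (condition_metric_0 x v v) = 2 / (1 - (norm x)\<^sup>2) * norm v / hyp_radius x"
  using assms hyp_radius_nonneg(2)[of x]
  by (simp add: condition_metric_def riem_setdist_0 real_sqrt_divide hyperbolic_speed)

text \<open>The derivative of a unit curve is orthogonal to it, so radial and angular parts add by
  Pythagoras. In the radial part the conformal factor cancels \<open>(1 - R^2) / 2\<close>, and the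
  division by the distance \<open>y\<close> cancels the derivative of \<open>exp\<close>, leaving
  \<open>\<sigma>'\<close> alone: this is the purpose of the logarithmic radius.\<close>

lemma polar_chart_speed:
  fixes \<theta> :: "real \<Rightarrow> 'a::euclidean_space"
  assumes u: "\<And>s. s \<in> {a..b} \<Longrightarrow> norm (\<theta> s) = 1" and t: "a < t" "t < b"
    and ds: "(\<sigma> has_real_derivative \<sigma>') (at t)" and d\<theta>: "(\<theta> has_vector_derivative \<theta>') (at t)"
  defines "c \<equiv> \<lambda>t. polar_chart (\<sigma> t) (\<theta> t)"
  shows "sqrt (condition_metric_0 (c t) (vector_derivative c (at t)) (vector_derivative c (at t)))
    = sqrt (\<sigma>'\<^sup>2 + warp (\<sigma> t) * (norm \<theta>')\<^sup>2)"
proof -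
  have n1: "norm (\<theta> t) = 1" using u t by simp
  define y where "y = exp (\<sigma> t)"
  define R where "R = tanh (y / 2)"
  have y: "0 < y" by (simp add: y_def)
  have "((\<lambda>t. exp (\<sigma> t)) has_real_derivative y * \<sigma>') (at t)"
    unfolding y_def by (auto intro!: derivative_eq_intros ds)
  from tanh_half_derivative[OF this]
  have dR: "((\<lambda>t. tanh (exp (\<sigma> t) / 2)) has_real_derivative (1 - R\<^sup>2) / 2 * (y * \<sigma>')) (at t)"
    by (simp add: R_def y_def)
  have "(c has_vector_derivative (R *\<^sub>R \<theta>' + ((1 - R\<^sup>2) / 2 * (y * \<sigma>')) *\<^sub>R \<theta> t)) (at t)"
    unfolding c_def polar_chart_def R_def y_def
    using has_vector_derivative_scaleR[OF dR d\<theta>] by (simp add: R_def y_def)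
  then have vd: "vector_derivative c (at t) = R *\<^sub>R \<theta>' + ((1 - R\<^sup>2) / 2 * (y * \<sigma>')) *\<^sub>R \<theta> t"
    by (rule vector_derivative_at)
  have orth: "\<theta> t \<bullet> \<theta>' = 0" using unit_curve_orthogonal[OF u t d\<theta>] by simp
  have nsq: "(norm (vector_derivative c (at t)))\<^sup>2 = R\<^sup>2 * (norm \<theta>')\<^sup>2 + ((1 - R\<^sup>2) / 2 * (y * \<sigma>'))\<^sup>2"
    using orth n1 unfolding vd power2_norm_eq_inner
    by (simp add: inner_add_left inner_add_right inner_commute norm_eq_1) (simp add: power2_eq_square)
  have Rlt: "0 < 1 - R\<^sup>2" using abs_tanh_less_1[of "y/2"] norm_less_1_square[of R] by (simp add: R_def)
  have ct: "c t \<in> hyperbolic_space - {0}" "hyp_radius (c t) = y" "norm (c t) = R"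
    using polar_chart_in(1,2)[OF n1, of "\<sigma> t"] n1 y unfolding c_def y_def R_def
    by (auto simp: polar_chart_def)
  \<comment> \<open>The double-argument formula turns the angular factor of the ball model into the
    \<open>sinh\<close> of \<open>warp\<close>.\<close>
  have sinh: "sinh y = 2 * R / (1 - R\<^sup>2)"
  proof -
    have "1 - R\<^sup>2 = 1 / (cosh (y/2))\<^sup>2"
      unfolding R_def tanh_def using cosh_square_eq[of "y/2"]
      by (simp add: power_divide divide_simps add_nonneg_eq_0_iff)
    then have "2 * R / (1 - R\<^sup>2) = 2 * sinh (y/2) * cosh (y/2)"
      unfolding R_def tanh_def by (simp add: power2_eq_square)
    then show ?thesis using sinh_double[of "y/2"] by simp
  qed
  have "(2 / (1 - R\<^sup>2) * norm (vector_derivative c (at t)) / y)\<^sup>2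
      = (2 / (1 - R\<^sup>2) / y)\<^sup>2 * (R\<^sup>2 * (norm \<theta>')\<^sup>2 + ((1 - R\<^sup>2) / 2 * (y * \<sigma>'))\<^sup>2)"
    unfolding nsq[symmetric] by (simp add: power_mult_distrib power_divide)
  also have "\<dots> = (2 * R / (1 - R\<^sup>2) / y)\<^sup>2 * (norm \<theta>')\<^sup>2 + \<sigma>'\<^sup>2"
    using Rlt y by (simp add: distrib_left power_mult_distrib power_divide) 
  also have "\<dots> = \<sigma>'\<^sup>2 + warp (\<sigma> t) * (norm \<theta>')\<^sup>2"
    unfolding sinh[symmetric] warp_def y_def by simp
  finally have sq: "(2 / (1 - R\<^sup>2) * norm (vector_derivative c (at t)) / y)\<^sup>2 = \<sigma>'\<^sup>2 + warp (\<sigma> t) * (norm \<theta>')\<^sup>2" .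
  have "sqrt (condition_metric_0 (c t) (vector_derivative c (at t)) (vector_derivative c (at t)))
    = 2 / (1 - R\<^sup>2) * norm (vector_derivative c (at t)) / y"
    using condition_speed_0[OF ct(1)] ct(2,3) by simp
  also have "\<dots> = sqrt (\<sigma>'\<^sup>2 + warp (\<sigma> t) * (norm \<theta>')\<^sup>2)"
    by (rule real_sqrt_unique[symmetric, OF sq]) (use Rlt y in simp)
  finally show ?thesis .
qed

lemma polar_chart_curve:
  fixes \<theta> :: "real \<Rightarrow> 'a::euclidean_space"
  assumes "warp_curve a b \<sigma> \<theta>"
  shows "lipschitz_curve (hyperbolic_space - {0}) a b (\<lambda>t. polar_chart (\<sigma> t) (\<theta> t))"
    "curve_length condition_metric_0 a b (\<lambda>t. polar_chart (\<sigma> t) (\<theta> t)) = warp_length a b \<sigma> \<theta>"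
proof -
  have ls: "lipschitz_ivl a b \<sigma>" and lt: "lipschitz_ivl a b \<theta>" and u: "\<And>t. t \<in> {a..b} \<Longrightarrow> norm (\<theta> t) = 1"
    using assms unfolding warp_curve_def by auto
  have "lipschitz_ivl a b (\<lambda>t. tanh (exp (\<sigma> t) / 2))"
  proof (rule lipschitz_ivl_compose_C1[OF ls, where g = "\<lambda>s. tanh (exp s / 2)" and g' = "\<lambda>s. (1 - (tanh (exp s / 2))\<^sup>2) / 2 * exp s"])
    show "((\<lambda>s. tanh (exp s / 2)) has_real_derivative (1 - (tanh (exp x / 2))\<^sup>2) / 2 * exp x) (at x)" for x
      by (rule tanh_half_derivative) (rule DERIV_exp)
    show "continuous_on (\<sigma> ` {a..b}) (\<lambda>s. (1 - (tanh (exp s / 2))\<^sup>2) / 2 * exp s)"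
      by (intro continuous_intros) (auto simp: less_imp_neq[THEN not_sym] cosh_real_pos)
  qed
  then show "lipschitz_curve (hyperbolic_space - {0}) a b (\<lambda>t. polar_chart (\<sigma> t) (\<theta> t))"
    using polar_chart_in(1) u lipschitz_ivl_scaleR[OF _ lt]
    by (fastforce simp: lipschitz_curve_iff polar_chart_def)
  obtain N1 where N1: "negligible N1" "\<And>t. t \<in> {a..b} - N1 \<Longrightarrow> a < t \<and> t < b"
    "\<And>t. t \<in> {a..b} - N1 \<Longrightarrow> (\<sigma> has_vector_derivative vector_derivative \<sigma> (at t)) (at t)"
    using lipschitz_ivl_ae_differentiable[OF ls] by metis
  obtain N2 where N2: "negligible N2" 
    "\<And>t. t \<in> {a..b} - N2 \<Longrightarrow> (\<theta> has_vector_derivative vector_derivative \<theta> (at t)) (at t)"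
    using lipschitz_ivl_ae_differentiable[OF lt] by metis
  show "curve_length condition_metric_0 a b (\<lambda>t. polar_chart (\<sigma> t) (\<theta> t)) = warp_length a b \<sigma> \<theta>"
    unfolding curve_length_def warp_length_def
  proof (rule integral_spike[OF negligible_Un[OF N1(1) N2(1)]])
    fix t assume "t \<in> {a..b} - (N1 \<union> N2)"
    then have t: "t \<in> {a..b} - N1" "t \<in> {a..b} - N2" by auto
    show "sqrt ((vector_derivative \<sigma> (at t))\<^sup>2 + warp (\<sigma> t) * (norm (vector_derivative \<theta> (at t)))\<^sup>2)
      = sqrt (condition_metric_0 (polar_chart (\<sigma> t) (\<theta> t))
         (vector_derivative (\<lambda>t. polar_chart (\<sigma> t) (\<theta> t)) (at t)) (vector_derivative (\<lambda>t. polar_chart (\<sigma> t) (\<theta> t)) (at t)))"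
      using N1(2)[OF t(1)] N1(3)[OF t(1)] N2(2)[OF t(2)]
      by (intro polar_chart_speed[symmetric, OF u]) (auto simp: has_real_derivative_iff_has_vector_derivative)
  qed
qed

text \<open>At an interior point the two-sided derivative only sees values in \<open>{a..b}\<close>.
  At the endpoints it may see outside values, but two points do not change the integral.\<close>

lemma curve_length_cong:
  assumes "\<And>t. t \<in> {a..b} \<Longrightarrow> c t = d t"
  shows "curve_length g a b c = curve_length g a b d"
  unfolding curve_length_def
proof (rule integral_spike[of "{a, b}"])
  fix t assume "t \<in> {a..b} - {a, b}"
  then have t: "a < t" "t < b" by auto
  have "eventually (\<lambda>s. s \<in> {a<..<b}) (nhds t)" by (rule eventually_nhds_in_open) (use t in auto)
  then have "eventually (\<lambda>s. c s = d s) (nhds t)"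
    by eventually_elim (use assms in simp)
  then have "eventually (\<lambda>s. s \<in> UNIV \<longrightarrow> c s = d s) (nhds t)" by simp
  then have "vector_derivative c (at t) = vector_derivative d (at t)" by (rule vector_derivative_cong_eq) auto
  then show "sqrt (g (d t) (vector_derivative d (at t)) (vector_derivative d (at t)))
    = sqrt (g (c t) (vector_derivative c (at t)) (vector_derivative c (at t)))"
    using assms t by simp
qed simp

lemma polar_coordinates_curve:
  fixes c :: "real \<Rightarrow> 'a::euclidean_space"
  assumes c: "lipschitz_curve (hyperbolic_space - {0}) a b c"
  shows "warp_curve a b (\<lambda>t. ln (hyp_radius (c t))) (\<lambda>t. sgn (c t))"
    "curve_length condition_metric_0 a b c = warp_length a b (\<lambda>t. ln (hyp_radius (c t))) (\<lambda>t. sgn (c t))"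
proof -
  have cU: "\<And>t. t \<in> {a..b} \<Longrightarrow> c t \<in> hyperbolic_space - {0}" and lc: "lipschitz_ivl a b c"
    using c unfolding lipschitz_curve_iff by blast+
  have c0: "lipschitz_curve hyperbolic_space a b c" using c by (auto simp: lipschitz_curve_iff)
  have "lipschitz_ivl a b (\<lambda>t. ln (hyp_radius (c t)))"
  proof (rule lipschitz_ivl_compose_C1[OF lipschitz_ivl_hyp_radius[OF c0], where g = ln and g' = "\<lambda>x. 1 / x"])
    have pos: "0 < x" if "x \<in> (\<lambda>t. hyp_radius (c t)) ` {a..b}" for x
      using that cU hyp_radius_nonneg(2) by fastforce
    show "(ln has_real_derivative 1 / x) (at x)" if "x \<in> (\<lambda>t. hyp_radius (c t)) ` {a..b}" for x
      using pos[OF that] by (auto intro!: derivative_eq_intros)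
    show "continuous_on ((\<lambda>t. hyp_radius (c t)) ` {a..b}) (\<lambda>x. 1 / x)"
      by (intro continuous_intros ballI) (use pos in \<open>blast intro: less_imp_neq[THEN not_sym]\<close>)
  qed
  moreover have "lipschitz_ivl a b (\<lambda>t. sgn (c t))"
    unfolding sgn_div_norm
  proof (rule lipschitz_ivl_scaleR[OF _ lc])
    show "lipschitz_ivl a b (\<lambda>t. inverse (norm (c t)))"
    proof (rule lipschitz_ivl_compose_C1[OF lipschitz_ivl_norm[OF lc], where g = inverse and g' = "\<lambda>x. - (inverse x * inverse x)"])
      have pos: "x \<noteq> 0" if "x \<in> (\<lambda>t. norm (c t)) ` {a..b}" for x
        using that cU by fastforce
      show "(inverse has_real_derivative - (inverse x * inverse x)) (at x)" if "x \<in> (\<lambda>t. norm (c t)) ` {a..b}" for x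
        using pos[OF that] DERIV_inverse[of x] by (simp add: power2_eq_square)
      show "continuous_on ((\<lambda>t. norm (c t)) ` {a..b}) (\<lambda>x. - (inverse x * inverse x))"
        by (intro continuous_intros ballI) (use pos in blast)+
    qed
  qed
  moreover have "norm (sgn (c t)) = 1" if "t \<in> {a..b}" for t using cU[OF that] by (simp add: norm_sgn)
  ultimately show w: "warp_curve a b (\<lambda>t. ln (hyp_radius (c t))) (\<lambda>t. sgn (c t))"
    by (simp add: warp_curve_def)
  have "curve_length condition_metric_0 a b c
    = curve_length condition_metric_0 a b (\<lambda>t. polar_chart (ln (hyp_radius (c t))) (sgn (c t)))"
    by (rule curve_length_cong) (use polar_chart_inverse cU in metis)
  then show "curve_length condition_metric_0 a b c = warp_length a b (\<lambda>t. ln (hyp_radius (c t))) (\<lambda>t. sgn (c t))"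
    using polar_chart_curve(2)[OF w] by simp
qed

section \<open>Minimizing curves\<close>

text \<open>The tail integrals are the masses of the half-lines \<open>{x<..}\<close> under the
  measures with densities \<open>f\<close> and \<open>g\<close>. These masses determine the measure,
  and a density is determined almost everywhere by its measure. Its main use: arc length
  parametrization means unit speed almost everywhere.\<close>

lemma equal_tail_integrals_imp_ae_equal:
  fixes f g :: "real \<Rightarrow> real"
  assumes f: "f integrable_on {a..b}" "\<And>t. t \<in> {a..b} \<Longrightarrow> 0 \<le> f t"
    and g: "g integrable_on {a..b}" "\<And>t. t \<in> {a..b} \<Longrightarrow> 0 \<le> g t"
    and eq: "\<And>t. t \<in> {a..b} \<Longrightarrow> integral {t..b} f = integral {t..b} g"
  obtains N where "negligible N" "\<And>t. t \<in> {a..b} - N \<Longrightarrow> f t = g t"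
proof -
  have rep: "\<exists>h'\<in>borel_measurable lborel. (AE x in lborel. indicator {a..b} x * h x = h' x) \<and>
      (\<forall>x. emeasure (density lborel (\<lambda>y. ennreal (h' y))) {x<..} = ennreal (integral {max a x..b} h))"
    if h: "h integrable_on {a..b}" "\<And>t. t \<in> {a..b} \<Longrightarrow> 0 \<le> h t" for h :: "real \<Rightarrow> real"
  proof -
    from h(1) obtain I where "(h has_integral I) {a..b}" by blast
    then have "(\<lambda>x. indicator {a..b} x *\<^sub>R h x) \<in> lebesgue \<rightarrow>\<^sub>M borel"
      by (rule has_integral_implies_lebesgue_measurable)
    then obtain h' where h': "h' \<in> borel_measurable lborel" "AE x in lborel. indicator {a..b} x * h x = h' x"
      by (auto dest: completion_ex_borel_measurable_real)
    have "emeasure (density lborel (\<lambda>y. ennreal (h' y))) {x<..} = ennreal (integral {max a x..b} h)" for x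
    proof -
      have "emeasure (density lborel (\<lambda>y. ennreal (h' y))) {x<..} = (\<integral>\<^sup>+y. ennreal (h' y) * indicator {x<..} y \<partial>lborel)"
        by (rule emeasure_density) (use h'(1) in auto)
      also have "\<dots> = (\<integral>\<^sup>+y. ennreal (h y) * indicator {max a x..b} y \<partial>lborel)"
      proof (rule nn_integral_cong_AE)
        have "AE y in lborel. y \<noteq> x" by (rule AE_lborel_singleton)
        with h'(2) show "AE y in lborel. ennreal (h' y) * indicator {x<..} y = ennreal (h y) * indicator {max a x..b} y"
        proof eventually_elim
          case (elim y)
          then show ?case by (cases "y \<in> {a..b}"; cases "x < y") (auto simp: indicator_def)
        qed
      qed
      also have "\<dots> = ennreal (integral {max a x..b} h)"
      proof (rule nn_integral_has_integral_lebesgue')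
        show "(h has_integral integral {max a x..b} h) {max a x..b}"
          by (rule integrable_integral, rule integrable_on_subinterval[OF h(1)]) auto
      qed (use h(2) in auto)
      finally show ?thesis .
    qed
    with h' show ?thesis by blast
  qed
  obtain f' where f': "f' \<in> borel_measurable lborel" "AE x in lborel. indicator {a..b} x * f x = f' x"
    "\<And>x. emeasure (density lborel (\<lambda>y. ennreal (f' y))) {x<..} = ennreal (integral {max a x..b} f)"
    using rep[OF f] by metis
  obtain g' where g': "g' \<in> borel_measurable lborel" "AE x in lborel. indicator {a..b} x * g x = g' x"
    "\<And>x. emeasure (density lborel (\<lambda>y. ennreal (g' y))) {x<..} = ennreal (integral {max a x..b} g)"
    using rep[OF g] by metis
  have "density lborel (\<lambda>y. ennreal (f' y)) = density lborel (\<lambda>y. ennreal (g' y))"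
  proof (rule measure_eqI_lessThan)
    fix x
    have "integral {max a x..b} f = integral {max a x..b} g"
      using eq[of "max a x"] by (cases "max a x \<le> b") auto
    then show "emeasure (density lborel (\<lambda>y. ennreal (f' y))) {x<..} = emeasure (density lborel (\<lambda>y. ennreal (g' y))) {x<..}"
      by (simp add: f'(3) g'(3))
    show "emeasure (density lborel (\<lambda>y. ennreal (f' y))) {x<..} < \<infinity>" by (simp add: f'(3))
  qed auto
  then have "AE x in lborel. ennreal (f' x) = ennreal (g' x)"
    using sigma_finite_measure.density_unique_iff[OF sigma_finite_lborel, of "\<lambda>y. ennreal (f' y)" "\<lambda>y. ennreal (g' y)"] f'(1) g'(1) by simp
  with f'(2) g'(2) have "AE x in lborel. x \<in> {a..b} \<longrightarrow> f x = g x"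
  proof eventually_elim
    case (elim x)
    show ?case
    proof
      assume x: "x \<in> {a..b}"
      then have "ennreal (f x) = ennreal (g x)" using elim by simp
      then show "f x = g x" using f(2)[OF x] g(2)[OF x] by simp
    qed
  qed
  then obtain N where N: "N \<in> null_sets lborel" "{x \<in> space lborel. \<not> (x \<in> {a..b} \<longrightarrow> f x = g x)} \<subseteq> N"
    unfolding eventually_ae_filter by blast
  show thesis
  proof (rule that[of N])
    show "negligible N" unfolding negligible_iff_null_sets using N(1) by (rule null_sets_completionI)
    show "f t = g t" if "t \<in> {a..b} - N" for t using N(2) that by auto
  qed
qed

lemma nonneg_integral_le_0_imp_ae_0:
  fixes f :: "real \<Rightarrow> real"
  assumes f: "f integrable_on {a..b}" "\<And>t. t \<in> {a..b} \<Longrightarrow> 0 \<le> f t" and le: "integral {a..b} f \<le> 0"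
  obtains N where "negligible N" "\<And>t. t \<in> {a..b} - N \<Longrightarrow> f t = 0"
proof (rule equal_tail_integrals_imp_ae_equal[OF f, of "\<lambda>_. 0"])
  fix t assume t: "t \<in> {a..b}"
  have ft: "f integrable_on {t..b}" by (rule integrable_on_subinterval[OF f(1)]) (use t in auto)
  have "integral {t..b} f \<le> integral {a..b} f"
    by (rule integral_subset_le[OF _ ft f(1)]) (use t f(2) in auto)
  moreover have "0 \<le> integral {t..b} f"
    by (rule integral_nonneg[OF ft]) (use t f(2) in auto)
  ultimately show "integral {t..b} f = integral {t..b} (\<lambda>_. 0)" using le by simp
qed (auto intro: integrable_0 that)

text \<open>The competitors share the parameter interval, which matters because energy, unlike
  length, depends on the parametrization.\<close>

definition warp_minimal :: "real \<Rightarrow> real \<Rightarrow> (real \<Rightarrow> real) \<Rightarrow> (real \<Rightarrow> 'a::euclidean_space) \<Rightarrow> bool" where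
  "warp_minimal a b \<sigma> \<theta> \<longleftrightarrow> warp_curve a b \<sigma> \<theta> \<and>
     (\<forall>\<tau> \<phi>. warp_curve a b \<tau> \<phi> \<and> \<tau> a = \<sigma> a \<and> \<tau> b = \<sigma> b \<and> \<phi> a = \<theta> a \<and> \<phi> b = \<theta> b \<longrightarrow>
        warp_energy a b \<sigma> \<theta> \<le> warp_energy a b \<tau> \<phi>)"

lemma warp_curve_integrable:
  fixes \<theta> :: "real \<Rightarrow> 'a::euclidean_space"
  assumes "warp_curve a b \<sigma> \<theta>"
  shows "(\<lambda>t. sqrt ((vector_derivative \<sigma> (at t))\<^sup>2 + warp (\<sigma> t) * (norm (vector_derivative \<theta> (at t)))\<^sup>2)) integrable_on {a..b}"
    "(\<lambda>t. (vector_derivative \<sigma> (at t))\<^sup>2 + warp (\<sigma> t) * (norm (vector_derivative \<theta> (at t)))\<^sup>2) integrable_on {a..b}"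
proof -
  have ls: "lipschitz_ivl a b \<sigma>" and lt: "lipschitz_ivl a b \<theta>" using assms unfolding warp_curve_def by auto
  have c: "continuous_on {a..b} (\<lambda>t. warp (\<sigma> t))"
    by (rule continuous_on_compose2[OF continuous_on_warp(1) lipschitz_ivl_continuous[OF ls] subset_UNIV])
  note i = warp_curve_integrands[OF ls lt c]
  show "(\<lambda>t. sqrt ((vector_derivative \<sigma> (at t))\<^sup>2 + warp (\<sigma> t) * (norm (vector_derivative \<theta> (at t)))\<^sup>2)) integrable_on {a..b}"
    by (rule i(1))
  show "(\<lambda>t. (vector_derivative \<sigma> (at t))\<^sup>2 + warp (\<sigma> t) * (norm (vector_derivative \<theta> (at t)))\<^sup>2) integrable_on {a..b}"
    by (rule integrable_add[OF i(2,3)])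
qed

text \<open>Arc length forces unit speed almost everywhere, so the energy of the curve equals its
  length \<open>b - a\<close>. For a competitor with squared speed \<open>e\<close>, the inequality
  \<open>sqrt e \<le> (e + 1) / 2\<close> bounds its length by the mean of its energy and
  \<open>b - a\<close>; as that length is at least \<open>b - a\<close>, so is its energy.\<close>

lemma warp_minimal_if_length_minimal:
  fixes \<theta> :: "real \<Rightarrow> 'a::euclidean_space"
  assumes w: "warp_curve a b \<sigma> \<theta>" and ab: "a \<le> b"
    and arc: "\<And>t. t \<in> {a..b} \<Longrightarrow> warp_length t b \<sigma> \<theta> = b - t"
    and min: "\<And>\<tau> \<phi>. \<lbrakk>warp_curve a b \<tau> \<phi>; \<tau> a = \<sigma> a; \<tau> b = \<sigma> b; \<phi> a = \<theta> a; \<phi> b = \<theta> b\<rbrakk>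
       \<Longrightarrow> warp_length a b \<sigma> \<theta> \<le> warp_length a b \<tau> \<phi>"
  shows "warp_minimal a b \<sigma> \<theta>"
proof -
  let ?e = "\<lambda>\<tau> (\<phi>::real \<Rightarrow> 'a) t. (vector_derivative \<tau> (at t))\<^sup>2 + warp (\<tau> t) * (norm (vector_derivative \<phi> (at t)))\<^sup>2"
  have e0: "0 \<le> ?e \<tau> \<phi> t" for \<tau> \<phi> t using warp_gt_1[of "\<tau> t"] by simp
  obtain N where N: "negligible N" "\<And>t. t \<in> {a..b} - N \<Longrightarrow> sqrt (?e \<sigma> \<theta> t) = 1"
  proof (rule equal_tail_integrals_imp_ae_equal[OF warp_curve_integrable(1)[OF w] _ integrable_const_ivl[of 1]])
    show "integral {t..b} (\<lambda>t. sqrt (?e \<sigma> \<theta> t)) = integral {t..b} (\<lambda>_. 1)" if "t \<in> {a..b}" for t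
      using arc[OF that] that by (simp add: warp_length_def)
  qed (use e0 in auto)
  have "warp_energy a b \<sigma> \<theta> = integral {a..b} (\<lambda>_. 1)"
    unfolding warp_energy_def by (rule integral_spike[OF N(1)]) (use N(2) in fastforce)
  then have en: "warp_energy a b \<sigma> \<theta> = b - a" using ab by simp
  have "warp_energy a b \<sigma> \<theta> \<le> warp_energy a b \<tau> \<phi>"
    if c: "warp_curve a b \<tau> \<phi>" "\<tau> a = \<sigma> a" "\<tau> b = \<sigma> b" "\<phi> a = \<theta> a" "\<phi> b = \<theta> b" for \<tau> \<phi>
  proof -
    have "((\<lambda>t. (?e \<tau> \<phi> t + 1) / 2) has_integral (warp_energy a b \<tau> \<phi> + 1 * (b - a)) / 2) {a..b}"
      unfolding warp_energy_def
      by (intro has_integral_divide has_integral_add integrable_integral warp_curve_integrable(2)[OF c(1)])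
        (use has_integral_const_real[of "1::real" a b] ab in simp)
    then have hi: "((\<lambda>t. (?e \<tau> \<phi> t + 1) / 2) has_integral (warp_energy a b \<tau> \<phi> + (b - a)) / 2) {a..b}"
      by simp
    have "b - a \<le> warp_length a b \<tau> \<phi>" using min[OF c] arc[of a] ab by simp
    also have "\<dots> \<le> integral {a..b} (\<lambda>t. (?e \<tau> \<phi> t + 1) / 2)"
      unfolding warp_length_def
    proof (rule integral_le)
      show "sqrt (?e \<tau> \<phi> t) \<le> (?e \<tau> \<phi> t + 1) / 2" for t
        using arith_geo_mean_sqrt[OF e0[of \<tau> t \<phi>], of 1] by simp
    qed (rule warp_curve_integrable(1)[OF c(1)], rule has_integral_integrable[OF hi])
    also have "\<dots> = (warp_energy a b \<tau> \<phi> + (b - a)) / 2" by (rule integral_unique[OF hi])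
    finally show ?thesis using en by simp
  qed
  then show ?thesis unfolding warp_minimal_def using w by blast
qed

section \<open>Comparison curves for the energy\<close>

definition chord :: "(real \<Rightarrow> real) \<Rightarrow> real \<Rightarrow> real \<Rightarrow> real \<Rightarrow> real" where
  "chord f u v t = f u + (f v - f u) / (v - u) * (t - u)"

lemma chord_left: "chord f u v u = f u"
  by (simp add: chord_def)

lemma chord_right: "u < v \<Longrightarrow> chord f u v v = f v"
  by (simp add: chord_def)

lemma chord_derivative: "(chord f u v has_real_derivative (f v - f u) / (v - u)) (at t)"
proof -
  have "((\<lambda>t. f u + m * (t - u)) has_real_derivative m) (at t)" for m
    by (auto intro!: derivative_eq_intros)
  then show ?thesis unfolding chord_def [abs_def] .
qed

lemma lipschitz_ivl_C1:
  assumes "\<And>t. (g has_real_derivative g' t) (at t)" "continuous_on UNIV g'"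
  shows "lipschitz_ivl a b g"
proof (rule lipschitz_ivl_compose_C1[where f = "\<lambda>t. t" and g = g and g' = g'])
  show "lipschitz_ivl a b (\<lambda>t::real. t)" unfolding lipschitz_ivl_def using lipschitz_on_id by blast
qed (use assms continuous_on_subset in blast)+

text \<open>Where \<open>\<sigma>\<close> exceeds its chord, replacing it by the chord lowers the energy, because the
  warping function increases.\<close>

lemma warp_minimal_below_chord:
  fixes \<theta> :: "real \<Rightarrow> 'a::euclidean_space"
  assumes w: "warp_minimal u v \<sigma> \<theta>" and uv: "u < v" and t: "t \<in> {u..v}"
  shows "\<sigma> t \<le> chord \<sigma> u v t"
proof -
  have wc: "warp_curve u v \<sigma> \<theta>" using w unfolding warp_minimal_def by blast
  then have ls: "lipschitz_ivl u v \<sigma>" and lt: "lipschitz_ivl u v \<theta>" and n1: "\<And>t. t \<in> {u..v} \<Longrightarrow> norm (\<theta> t) = 1"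
    unfolding warp_curve_def by auto
  define m where "m = (\<sigma> v - \<sigma> u) / (v - u)"
  define l where "l = chord \<sigma> u v"
  have dl: "(l has_real_derivative m) (at s)" for s unfolding l_def m_def by (rule chord_derivative)
  have ll: "lipschitz_ivl u v l" by (rule lipschitz_ivl_C1[OF dl]) (rule continuous_on_const)
  \<comment> \<open>The excess over the chord; \<open>\<sigma> - z\<close> is the minimum of
    \<open>\<sigma>\<close> and the chord, with the same end values.\<close>
  define z where "z s = max 0 (\<sigma> s - l s)" for s
  have lz: "lipschitz_ivl u v z"
    unfolding z_def
  proof (rule lipschitz_ivl_compose[OF lipschitz_ivl_diff[OF ls ll]])
    show "1-lipschitz_on ((\<lambda>t. \<sigma> t - l t) ` {u..v}) (max 0)"
      by (rule lipschitz_onI) (auto simp: dist_real_def)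
  qed
  have z0: "z u = 0" "z v = 0" using uv by (auto simp: z_def l_def chord_left chord_right)
  have zc: "warp_curve u v (\<lambda>s. \<sigma> s - z s) \<theta>"
    using lipschitz_ivl_diff[OF ls lz] lt n1 by (simp add: warp_curve_def)
  have le: "warp_energy u v \<sigma> \<theta> \<le> warp_energy u v (\<lambda>s. \<sigma> s - z s) \<theta>"
    using w zc z0 unfolding warp_minimal_def by simp
  obtain N1 where N1: "negligible N1" "\<And>t. t \<in> {u..v} - N1 \<Longrightarrow> u < t \<and> t < v"
    "\<And>t. t \<in> {u..v} - N1 \<Longrightarrow> (\<sigma> has_vector_derivative vector_derivative \<sigma> (at t)) (at t)"
    using lipschitz_ivl_ae_differentiable[OF ls] by metis
  obtain N2 where N2: "negligible N2" 
    "\<And>t. t \<in> {u..v} - N2 \<Longrightarrow> (z has_vector_derivative vector_derivative z (at t)) (at t)"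
    using lipschitz_ivl_ae_differentiable[OF lz] by metis
  let ?s' = "\<lambda>t. vector_derivative \<sigma> (at t)" and ?z' = "\<lambda>t. vector_derivative z (at t)" and ?T = "\<lambda>t. (norm (vector_derivative \<theta> (at t)))\<^sup>2"
  have pw: "(vector_derivative (\<lambda>s. \<sigma> s - z s) (at t))\<^sup>2 + warp (\<sigma> t - z t) * ?T t
      \<le> (?s' t)\<^sup>2 + warp (\<sigma> t) * ?T t - ((?z' t)\<^sup>2 + 2 * m * ?z' t)" if t: "t \<in> {u..v} - (N1 \<union> N2)" for t
  proof -
    have ds: "(\<sigma> has_real_derivative ?s' t) (at t)" and dz: "(z has_real_derivative ?z' t) (at t)"
      using N1(3)[of t] N2(2)[of t] t by (auto simp: has_real_derivative_iff_has_vector_derivative)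
    have "((\<lambda>s. \<sigma> s - z s) has_real_derivative ?s' t - ?z' t) (at t)" by (intro DERIV_diff ds dz)
    then have vd: "vector_derivative (\<lambda>s. \<sigma> s - z s) (at t) = ?s' t - ?z' t"
      by (simp add: has_real_derivative_iff_has_vector_derivative vector_derivative_at)
    have "warp (\<sigma> t - z t) \<le> warp (\<sigma> t)"
      by (rule strict_mono_leD[OF strict_mono_warp]) (simp add: z_def)
    then have wle: "warp (\<sigma> t - z t) * ?T t \<le> warp (\<sigma> t) * ?T t" by (rule mult_right_mono) simp
    \<comment> \<open>Where \<open>z\<close> is positive, \<open>\<sigma>' = z' + m\<close>, so both
      sides equal \<open>m^2\<close>. Where \<open>z\<close> is 0 it has a minimum, so
      \<open>z' = 0\<close>.\<close>
    have sq: "(?s' t - ?z' t)\<^sup>2 = (?s' t)\<^sup>2 - ((?z' t)\<^sup>2 + 2 * m * ?z' t)"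
    proof (cases "\<sigma> t > l t")
      case False
      then have zt: "z t = 0" by (simp add: z_def)
      have "?z' t = 0"
        by (rule DERIV_local_min[OF dz zero_less_one]) (unfold zt, simp add: z_def)
      then show ?thesis by simp
    next
      case True
      have "isCont (\<lambda>s. \<sigma> s - l s) t"
        by (intro continuous_diff DERIV_isCont[OF ds] DERIV_isCont[OF dl])
      then have "((\<lambda>s. \<sigma> s - l s) \<longlongrightarrow> \<sigma> t - l t) (nhds t)"
        using tendsto_at_iff_tendsto_nhds[of "\<lambda>s. \<sigma> s - l s" t] by (simp add: isCont_def)
      then have "eventually (\<lambda>s. \<sigma> s - l s > 0) (nhds t)"
        by (rule order_tendstoD(1)) (use True in simp)
      then have "eventually (\<lambda>s. z s = \<sigma> s - l s) (nhds t)" by eventually_elim (simp add: z_def)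
      then have "(z has_real_derivative ?s' t - m) (at t)"
        using DERIV_diff[OF ds dl[of t]] by (subst DERIV_cong_ev[OF refl _ refl])
      then have "?z' t = ?s' t - m" using dz by (rule DERIV_unique[rotated])
      then have s': "?s' t = ?z' t + m" by simp
      show ?thesis unfolding s' by (simp add: power2_eq_square algebra_simps)
    qed
    show ?thesis unfolding vd sq using wle by simp
  qed
  note zi = lipschitz_ivl_fundamental_theorem[OF lz less_imp_le[OF uv]]
  have zi2: "(\<lambda>t. (?z' t)\<^sup>2) integrable_on {u..v}"
    by (rule warp_curve_integrands(2)[OF lz lt continuous_on_const])
  have ri: "(\<lambda>t. (?z' t)\<^sup>2 + 2 * m * ?z' t) integrable_on {u..v}"
    by (intro integrable_add zi2 integrable_on_mult_right has_integral_integrable[OF zi])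
  have "warp_energy u v (\<lambda>s. \<sigma> s - z s) \<theta>
      \<le> integral {u..v} (\<lambda>t. (?s' t)\<^sup>2 + warp (\<sigma> t) * ?T t - ((?z' t)\<^sup>2 + 2 * m * ?z' t))"
    unfolding warp_energy_def
    by (rule integral_le_ae[OF warp_curve_integrable(2)[OF zc] integrable_diff[OF warp_curve_integrable(2)[OF wc] ri] negligible_Un[OF N1(1) N2(1)] pw])
  also have "\<dots> = warp_energy u v \<sigma> \<theta> - integral {u..v} (\<lambda>t. (?z' t)\<^sup>2 + 2 * m * ?z' t)"
    unfolding warp_energy_def by (rule integral_diff[OF warp_curve_integrable(2)[OF wc] ri])
  \<comment> \<open>The linear term integrates to a multiple of \<open>z v - z u = 0\<close>, so
    minimality leaves only the integral of \<open>z'^2\<close>, which cannot be positive.\<close>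
  also have "integral {u..v} (\<lambda>t. (?z' t)\<^sup>2 + 2 * m * ?z' t) = integral {u..v} (\<lambda>t. (?z' t)\<^sup>2) + 2 * m * (z v - z u)"
    by (rule integral_unique, intro has_integral_add has_integral_mult_right zi integrable_integral[OF zi2])
  finally have "integral {u..v} (\<lambda>t. (?z' t)\<^sup>2) \<le> 0" using le z0 by simp
  then obtain N where N: "negligible N" "\<And>t. t \<in> {u..v} - N \<Longrightarrow> (?z' t)\<^sup>2 = 0"
    using nonneg_integral_le_0_imp_ae_0[OF zi2] by auto
  have "z t = z u"
    by (rule lipschitz_ivl_const_if_ae_derivative_0[OF lz N(1) _ t]) (use N(2) in simp)
  then show ?thesis using z0 by (simp add: z_def l_def)
qed

text \<open>A positive continuous derivative is bounded away from 0 on a compact interval; \<kappa>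
  quantifies the first-order gain from moving inwards.\<close>

lemma warp_increment_lower_bound:
  obtains \<kappa> where "0 < \<kappa>" "\<And>x y. \<lbrakk>A \<le> x; x \<le> y; y \<le> B\<rbrakk> \<Longrightarrow> \<kappa> * (y - x) \<le> warp y - warp x"
proof (cases "A \<le> B")
  case False
  show ?thesis by (rule that[of 1]) (use False in auto)
next
  case True
  then obtain z where z: "z \<in> {A..B}" "\<And>x. x \<in> {A..B} \<Longrightarrow> warp' z \<le> warp' x"
    using continuous_attains_inf[OF compact_Icc _ continuous_on_warp(2), of A B] by auto
  show ?thesis
  proof (rule that[of "warp' z"])
    show "0 < warp' z" by (rule warp'_pos)
    fix x y assume xy: "A \<le> x" "x \<le> y" "y \<le> B"
    show "warp' z * (y - x) \<le> warp y - warp x"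
    proof (cases "x = y")
      case False
      then have "x < y" using xy by simp
      from MVT2[OF this warp_derivative] obtain w where w: "x < w" "w < y" "warp y - warp x = (y - x) * warp' w"
        by auto
      moreover have "warp' z \<le> warp' w" by (rule z(2)) (use w xy in auto)
      ultimately show ?thesis using \<open>x < y\<close> by (simp add: mult.commute mult_left_mono)
    qed simp
  qed
qed

lemma warp_lipschitz:
  obtains K where "0 \<le> K" "\<And>x y. \<lbrakk>x \<in> {A..B}; y \<in> {A..B}\<rbrakk> \<Longrightarrow> \<bar>warp x - warp y\<bar> \<le> K * \<bar>x - y\<bar>"
proof -
  have "bounded (warp' ` {A..B})"
    by (intro compact_imp_bounded compact_continuous_image continuous_on_warp) simp
  then obtain K where K: "0 < K" "\<And>x. x \<in> {A..B} \<Longrightarrow> norm (warp' x) \<le> K"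
    unfolding bounded_pos by auto
  show ?thesis
  proof (rule that[of K])
    fix x y assume "x \<in> {A..B}" "y \<in> {A..B}"
    then have "norm (warp x - warp y) \<le> K * norm (x - y)"
      by (intro field_differentiable_bound[OF convex_box(1)[of A B, unfolded cbox_interval] has_field_derivative_at_within[OF warp_derivative] K(2)]) auto
    then show "\<bar>warp x - warp y\<bar> \<le> K * \<bar>x - y\<bar>" by simp
  qed (use K in simp)
qed

text \<open>To first order in \<open>\<epsilon>\<close>, pushing an affine \<open>\<sigma>\<close> inwards by \<open>\<epsilon> q\<close> changes the energy only
  through the angular term, which decreases unless \<open>\<theta>\<close> is constant.\<close>

lemma warp_minimal_affine_imp_const:
  fixes \<theta> :: "real \<Rightarrow> 'a::euclidean_space"
  assumes w: "warp_minimal u v \<sigma> \<theta>" and uv: "u < v"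
    and aff: "\<And>t. t \<in> {u..v} \<Longrightarrow> \<sigma> t = chord \<sigma> u v t" and t: "t \<in> {u..v}"
  shows "\<theta> t = \<theta> u"
proof -
  have wc: "warp_curve u v \<sigma> \<theta>" using w unfolding warp_minimal_def by blast
  then have ls: "lipschitz_ivl u v \<sigma>" and lt: "lipschitz_ivl u v \<theta>" and n1: "\<And>t. t \<in> {u..v} \<Longrightarrow> norm (\<theta> t) = 1"
    unfolding warp_curve_def by auto
  define m where "m = (\<sigma> v - \<sigma> u) / (v - u)"
  \<comment> \<open>A bump that is positive inside and vanishes at both ends, so that pushed curves
    keep their endpoints.\<close>
  define q where "q s = (s - u) * (v - s)" for s
  define q' where "q' s = u + v - 2 * s" for s
  have dq: "(q has_real_derivative q' s) (at s)" for s
    unfolding q_def [abs_def] q'_def by (auto intro!: derivative_eq_intros)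
  have q'c: "continuous_on S q'" for S unfolding q'_def by (intro continuous_intros)
  have qc: "continuous_on S q" for S unfolding q_def by (intro continuous_intros)
  have lq: "lipschitz_ivl u v q" by (rule lipschitz_ivl_C1[OF dq q'c])
  have q0: "q u = 0" "q v = 0" by (auto simp: q_def)
  have qpos: "0 \<le> q s" "q s \<le> (v - u)\<^sup>2" if "s \<in> {u..v}" for s
    using that unfolding q_def power2_eq_square by (auto intro!: mult_mono)
  have ds: "(\<sigma> has_real_derivative m) (at s)" if s: "s \<in> {u<..<v}" for s
    unfolding m_def
    by (rule has_field_derivative_transform_within_open[OF chord_derivative[of \<sigma> u v], of "{u<..<v}"])
      (use s aff in auto)
  obtain B where B: "\<And>s. s \<in> {u..v} \<Longrightarrow> norm (\<sigma> s) \<le> B" using lipschitz_ivl_bounded[OF ls] by metis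
  \<comment> \<open>The range has to contain \<open>\<sigma> s\<close> and
    \<open>\<sigma> s - \<epsilon> * q s\<close> for all \<open>\<epsilon> \<le> 1\<close>, and
    \<open>q\<close> is at most \<open>(v - u)^2\<close>.\<close>
  obtain \<kappa> where \<kappa>: "0 < \<kappa>" "\<And>x y. \<lbrakk>- B - (v - u)\<^sup>2 \<le> x; x \<le> y; y \<le> B\<rbrakk> \<Longrightarrow> \<kappa> * (y - x) \<le> warp y - warp x"
    using warp_increment_lower_bound[of "- B - (v - u)\<^sup>2" B] by blast
  let ?T = "\<lambda>t. (norm (vector_derivative \<theta> (at t)))\<^sup>2"
  define X where "X = integral {u..v} (\<lambda>t. q t * ?T t)"
  define Y where "Y = integral {u..v} (\<lambda>t. (q' t)\<^sup>2)"
  have iX: "(\<lambda>t. q t * ?T t) integrable_on {u..v}" by (rule warp_curve_integrands(3)[OF ls lt qc])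
  have iY: "(\<lambda>t. (q' t)\<^sup>2) integrable_on {u..v}"
    by (intro integrable_continuous_real continuous_intros q'c)
  have iq': "(q' has_integral q v - q u) {u..v}"
    by (rule fundamental_theorem_of_calculus)
      (use uv dq in \<open>auto simp: has_real_derivative_iff_has_vector_derivative[symmetric] has_field_derivative_at_within\<close>)
  \<comment> \<open>The angular gain is at least \<open>\<epsilon> * \<kappa> * X\<close>, the
    radial cost is \<open>\<epsilon>^2 * Y\<close>, and the mixed term with the constant slope
    \<open>m\<close> integrates to zero. Dividing by \<open>\<epsilon>\<close> gives the
    claim.\<close>
  have key: "\<kappa> * X \<le> \<epsilon> * Y" if \<epsilon>: "0 < \<epsilon>" "\<epsilon> \<le> 1" for \<epsilon>
  proof -
    have le\<epsilon>: "lipschitz_ivl u v (\<lambda>s. \<epsilon> * q s)"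
      using lipschitz_ivl_scaleR[OF lipschitz_ivl_const lq, of \<epsilon>] by simp
    have wc\<epsilon>: "warp_curve u v (\<lambda>s. \<sigma> s - \<epsilon> * q s) \<theta>"
      using lipschitz_ivl_diff[OF ls le\<epsilon>] lt n1 by (simp add: warp_curve_def)
    have "warp_energy u v \<sigma> \<theta> \<le> warp_energy u v (\<lambda>s. \<sigma> s - \<epsilon> * q s) \<theta>"
      using w wc\<epsilon> q0 unfolding warp_minimal_def by simp
    also have "\<dots> \<le> integral {u..v} (\<lambda>t. ((vector_derivative \<sigma> (at t))\<^sup>2 + warp (\<sigma> t) * ?T t)
        + (\<epsilon>\<^sup>2 * (q' t)\<^sup>2 - (2 * m * \<epsilon>) * q' t - (\<kappa> * \<epsilon>) * (q t * ?T t)))"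
      unfolding warp_energy_def
    proof (rule integral_le_ae[OF warp_curve_integrable(2)[OF wc\<epsilon>]])
      show "negligible {u, v}" by simp
      show "(\<lambda>t. ((vector_derivative \<sigma> (at t))\<^sup>2 + warp (\<sigma> t) * ?T t)
        + (\<epsilon>\<^sup>2 * (q' t)\<^sup>2 - (2 * m * \<epsilon>) * q' t - (\<kappa> * \<epsilon>) * (q t * ?T t))) integrable_on {u..v}"
        by (intro integrable_add[OF warp_curve_integrable(2)[OF wc]] integrable_diff integrable_on_mult_right iX iY has_integral_integrable[OF iq'])
      fix s assume "s \<in> {u..v} - {u, v}"
      then have s: "s \<in> {u<..<v}" "s \<in> {u..v}" by auto
      have "((\<lambda>s. \<sigma> s - \<epsilon> * q s) has_real_derivative m - \<epsilon> * q' s) (at s)"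
        by (intro DERIV_diff ds s DERIV_cmult dq)
      then have vd: "vector_derivative (\<lambda>s. \<sigma> s - \<epsilon> * q s) (at s) = m - \<epsilon> * q' s"
        by (simp add: has_real_derivative_iff_has_vector_derivative vector_derivative_at)
      have vs: "vector_derivative \<sigma> (at s) = m"
        using ds[OF s(1)] by (simp add: has_real_derivative_iff_has_vector_derivative vector_derivative_at)
      have \<epsilon>q: "0 \<le> \<epsilon> * q s" "\<epsilon> * q s \<le> (v - u)\<^sup>2"
        using qpos[OF s(2)] \<epsilon> mult_mono[of \<epsilon> 1 "q s" "(v - u)\<^sup>2"] by auto
      have "\<kappa> * (\<sigma> s - (\<sigma> s - \<epsilon> * q s)) \<le> warp (\<sigma> s) - warp (\<sigma> s - \<epsilon> * q s)"
        by (rule \<kappa>(2)) (use \<epsilon>q B[OF s(2)] in auto)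
      then have "warp (\<sigma> s - \<epsilon> * q s) \<le> warp (\<sigma> s) - \<kappa> * (\<epsilon> * q s)" by simp
      then have "warp (\<sigma> s - \<epsilon> * q s) * ?T s \<le> (warp (\<sigma> s) - \<kappa> * (\<epsilon> * q s)) * ?T s"
        by (rule mult_right_mono) simp
      then show "(vector_derivative (\<lambda>s. \<sigma> s - \<epsilon> * q s) (at s))\<^sup>2 + warp (\<sigma> s - \<epsilon> * q s) * ?T s
        \<le> ((vector_derivative \<sigma> (at s))\<^sup>2 + warp (\<sigma> s) * ?T s)
        + (\<epsilon>\<^sup>2 * (q' s)\<^sup>2 - (2 * m * \<epsilon>) * q' s - (\<kappa> * \<epsilon>) * (q s * ?T s))"
        unfolding vd vs by (simp add: power2_eq_square algebra_simps)
    qed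
    also have "\<dots> = warp_energy u v \<sigma> \<theta> + (\<epsilon>\<^sup>2 * Y - (2 * m * \<epsilon>) * (q v - q u) - (\<kappa> * \<epsilon>) * X)"
      unfolding X_def Y_def warp_energy_def
      by (rule integral_unique, intro has_integral_add has_integral_diff has_integral_mult_right iq'
          integrable_integral iX iY warp_curve_integrable(2)[OF wc])
    finally have "\<epsilon> * (\<kappa> * X) \<le> \<epsilon> * (\<epsilon> * Y)" using q0 by (simp add: power2_eq_square algebra_simps)
    then show ?thesis using \<epsilon>(1) by simp
  qed
  have Y0: "0 \<le> Y" unfolding Y_def by (rule integral_nonneg[OF iY]) simp
  have "\<kappa> * X \<le> 0"
  proof (rule ccontr)
    assume "\<not> \<kappa> * X \<le> 0"
    then have p: "0 < \<kappa> * X" by simp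
    \<comment> \<open>Small enough that \<open>\<epsilon> * Y\<close> is at most half of
      \<open>\<kappa> * X\<close>; the summand 1 guards against \<open>Y = 0\<close>.\<close>
    define \<epsilon> where "\<epsilon> = min 1 (\<kappa> * X / (2 * (Y + 1)))"
    have "0 < \<epsilon>" "\<epsilon> \<le> 1" using p Y0 by (auto simp: \<epsilon>_def)
    then have "\<kappa> * X \<le> \<epsilon> * Y" by (rule key)
    also have "\<dots> \<le> \<kappa> * X / (2 * (Y + 1)) * Y" using Y0 by (intro mult_right_mono) (auto simp: \<epsilon>_def)
    also have "\<dots> \<le> \<kappa> * X / 2"
      using p Y0 mult_left_mono[of Y "Y + 1" "\<kappa> * X"] by (simp add: field_simps)
    finally show False using p by linarith
  qed
  then have "X \<le> 0" using \<kappa>(1) by (simp add: mult_le_0_iff)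
  then obtain N where N: "negligible N" "\<And>t. t \<in> {u..v} - N \<Longrightarrow> q t * ?T t = 0"
    using nonneg_integral_le_0_imp_ae_0[OF iX] qpos(1) unfolding X_def by auto
  show ?thesis
  proof (rule lipschitz_ivl_const_if_ae_derivative_0[OF lt, of "N \<union> {u, v}"])
    show "negligible (N \<union> {u, v})" using N(1) by (intro negligible_Un) auto
    fix s assume s: "s \<in> {u..v} - (N \<union> {u, v})"
    then have "0 < q s" by (auto simp: q_def)
    then show "vector_derivative \<theta> (at s) = 0" using N(2)[of s] s by simp
  qed (rule t)
qed

text \<open>A substitute for the conservation of angular momentum: if \<open>\<theta>\<close> only moves during \<open>[c, d]\<close>, it
  is cheaper to spread the same motion over the whole of \<open>[a, b]\<close>.\<close>

lemma warp_minimal_spread_imp_const: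
  fixes \<theta> :: "real \<Rightarrow> 'a::euclidean_space"
  assumes w: "warp_minimal a b \<sigma> \<theta>" and abcd: "a \<le> c" "c < d" "d \<le> b" "d - c < b - a"
    and ends: "\<theta> c = \<theta> a" "\<theta> d = \<theta> b"
    and K: "0 \<le> K" "K * (b - a) < 1"
      "\<And>s t. \<lbrakk>s \<in> {a..b}; t \<in> {a..b}\<rbrakk> \<Longrightarrow> \<bar>warp (\<sigma> s) - warp (\<sigma> t)\<bar> \<le> K * \<bar>s - t\<bar>"
    and t: "t \<in> {c..d}"
  shows "\<theta> t = \<theta> c"
proof -
  have wc: "warp_curve a b \<sigma> \<theta>" using w unfolding warp_minimal_def by blast
  then have ls: "lipschitz_ivl a b \<sigma>" and lt: "lipschitz_ivl a b \<theta>" and n1: "\<And>t. t \<in> {a..b} \<Longrightarrow> norm (\<theta> t) = 1"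
    unfolding warp_curve_def by auto
  \<comment> \<open>The contraction ratio of the affine map \<open>\<phi>\<close> from
    \<open>[a, b]\<close> onto \<open>[c, d]\<close>, whose inverse is
    \<open>\<psi>\<close>.\<close>
  define lam where "lam = (d - c) / (b - a)"
  have lam: "0 < lam" "lam < 1" using abcd by (auto simp: lam_def)
  have lamd: "lam * (b - a) = d - c" using abcd by (simp add: lam_def)
  define \<phi> where "\<phi> x = lam * x + (c - lam * a)" for x
  define \<psi> where "\<psi> y = a + (y - c) / lam" for y
  have \<psi>\<phi>: "\<psi> (\<phi> x) = x" and \<phi>\<psi>: "\<phi> (\<psi> x) = x" for x using lam by (auto simp: \<phi>_def \<psi>_def field_simps)
  have \<phi>e: "\<phi> a = c" "\<phi> b = d" using lamd by (auto simp: \<phi>_def algebra_simps)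
  have \<phi>in: "\<phi> x \<in> {c..d}" if "x \<in> {a..b}" for x
  proof -
    have "\<phi> a \<le> \<phi> x" "\<phi> x \<le> \<phi> b" using that lam unfolding \<phi>_def by (auto intro: mult_left_mono)
    then show ?thesis using \<phi>e by simp
  qed
  have \<psi>in: "\<psi> y \<in> {a..b}" if "y \<in> {c..d}" for y
  proof -
    have "0 \<le> (y - c) / lam" "(y - c) / lam \<le> (d - c) / lam"
      using that lam by (auto intro: divide_right_mono)
    moreover have "(d - c) / lam = b - a" using lamd lam by (simp add: field_simps)
    ultimately show ?thesis by (auto simp: \<psi>_def)
  qed
  \<comment> \<open>No point moves by more than the total slack
    \<open>(b - a) - (d - c)\<close>.\<close>
  have \<psi>near: "\<bar>\<psi> y - y\<bar> \<le> (1 - lam) * (b - a)" if y: "y \<in> {c..d}" for y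
  proof -
    define x where "x = \<psi> y"
    have x: "x \<in> {a..b}" unfolding x_def by (rule \<psi>in[OF y])
    have "y = \<phi> x" unfolding x_def \<phi>\<psi> ..
    then have "y - x = (c - a) - (1 - lam) * (x - a)" by (simp add: \<phi>_def algebra_simps)
    moreover have "0 \<le> (1 - lam) * (x - a)" "(1 - lam) * (x - a) \<le> (1 - lam) * (b - a)"
      using x lam by (auto intro: mult_left_mono)
    moreover have "(1 - lam) * (b - a) = (b - a) - (d - c)" using lamd by (simp add: algebra_simps)
    ultimately show ?thesis using abcd unfolding x_def by linarith
  qed
  \<comment> \<open>The same motion run more slowly. By \<open>ends\<close> it has the end values of
    \<open>\<theta>\<close> on \<open>[a, b]\<close>, hence is an admissible angular competitor
    beside the unchanged \<open>\<sigma>\<close>.\<close>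
  define \<omega> where "\<omega> x = \<theta> (\<phi> x)" for x
  have l\<omega>: "lipschitz_ivl a b \<omega>"
  proof -
    obtain C where C: "C-lipschitz_on {a..b} \<theta>" using lt lipschitz_ivl_def by blast
    have "lipschitz_ivl a b \<phi>"
      unfolding \<phi>_def by (rule lipschitz_ivl_C1[where g' = "\<lambda>_. lam"]) (auto intro!: derivative_eq_intros)
    moreover have "C-lipschitz_on (\<phi> ` {a..b}) \<theta>"
      by (rule lipschitz_on_subset[OF C]) (use \<phi>in abcd in force)
    ultimately show ?thesis unfolding \<omega>_def by (rule lipschitz_ivl_compose)
  qed
  have wc\<omega>: "warp_curve a b \<sigma> \<omega>"
  proof -
    have "norm (\<omega> x) = 1" if "x \<in> {a..b}" for x
      unfolding \<omega>_def by (rule n1) (use \<phi>in[OF that] abcd in auto)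
    then show ?thesis using ls l\<omega> by (simp add: warp_curve_def)
  qed
  have le: "warp_energy a b \<sigma> \<theta> \<le> warp_energy a b \<sigma> \<omega>"
    using w wc\<omega> ends \<phi>e unfolding warp_minimal_def by (simp add: \<omega>_def)
  let ?S = "\<lambda>t. (vector_derivative \<sigma> (at t))\<^sup>2" and ?T = "\<lambda>t. (norm (vector_derivative \<theta> (at t)))\<^sup>2"
    and ?W = "\<lambda>t. (norm (vector_derivative \<omega> (at t)))\<^sup>2"
  have lt': "lipschitz_ivl c d \<theta>" and ls': "lipschitz_ivl c d \<sigma>"
    using warp_curve_subset[OF wc abcd(1,3)] unfolding warp_curve_def by simp_all
  have cs: "continuous_on {a..b} (\<lambda>t. warp (\<sigma> t))"
    by (rule continuous_on_compose2[OF continuous_on_warp(1) lipschitz_ivl_continuous[OF ls] subset_UNIV])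
  have c\<psi>: "continuous_on {c..d} (\<lambda>y. warp (\<sigma> (\<psi> y)))"
    by (rule continuous_on_compose2[OF cs]) (use \<psi>in lam in \<open>auto simp: \<psi>_def intro!: continuous_intros\<close>)
  have iS: "?S integrable_on {a..b}" by (rule warp_curve_integrands(2)[OF ls lt continuous_on_const])
  have iT: "(\<lambda>t. warp (\<sigma> t) * ?T t) integrable_on {a..b}" by (rule warp_curve_integrands(3)[OF ls lt cs])
  have iT': "(\<lambda>t. warp (\<sigma> t) * ?T t) integrable_on {c..d}"
    by (rule integrable_on_subinterval[OF iT]) (use abcd in auto)
  have iW: "(\<lambda>t. warp (\<sigma> t) * ?W t) integrable_on {a..b}" by (rule warp_curve_integrands(3)[OF ls l\<omega> cs])
  define H where "H y = warp (\<sigma> (\<psi> y)) * ?T y" for y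
  have iH: "H integrable_on {c..d}" unfolding H_def by (rule warp_curve_integrands(3)[OF ls' lt' c\<psi>])
  have i0: "?T integrable_on {c..d}"
    using warp_curve_integrands(3)[OF ls' lt' continuous_on_const[of _ 1]] by simp
  \<comment> \<open>The squared angular speed is multiplied by \<open>lam^2\<close> and the time by
    \<open>1 / lam\<close>. The weight is now taken at the displaced time
    \<open>\<psi> y\<close>.\<close>
  have W: "integral {a..b} (\<lambda>t. warp (\<sigma> t) * ?W t) = lam * integral {c..d} H"
  proof -
    obtain N where N: "negligible N"
      "\<And>t. t \<in> {a..b} - N \<Longrightarrow> (\<omega> has_vector_derivative vector_derivative \<omega> (at t)) (at t)"
      using lipschitz_ivl_ae_differentiable[OF l\<omega>] by metis
    have "(H has_integral integral {c..d} H) (cbox c d)" using iH by (simp add: integrable_integral)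
    from has_integral_affinity'[OF this lam(1), of "c - lam * a"]
    have "((\<lambda>x. H (\<phi> x)) has_integral integral {c..d} H / lam) {(c - (c - lam * a)) / lam..(d - (c - lam * a)) / lam}"
      by (simp add: \<phi>_def divide_inverse mult.commute)
    moreover have "(c - (c - lam * a)) / lam = a" "(d - (c - lam * a)) / lam = b"
      using lam lamd by (auto simp: field_simps)
    ultimately have "((\<lambda>x. H (\<phi> x)) has_integral integral {c..d} H / lam) {a..b}" by simp
    then have "((\<lambda>x. lam\<^sup>2 * H (\<phi> x)) has_integral lam\<^sup>2 * (integral {c..d} H / lam)) {a..b}"
      by (rule has_integral_mult_right)
    then have "((\<lambda>x. warp (\<sigma> x) * ?W x) has_integral lam\<^sup>2 * (integral {c..d} H / lam)) {a..b}"
    proof (rule has_integral_spike[OF N(1), rotated])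
      fix x assume x: "x \<in> {a..b} - N"
      have d\<psi>: "(\<psi> has_vector_derivative 1 / lam) (at (\<phi> x))"
        unfolding \<psi>_def has_real_derivative_iff_has_vector_derivative[symmetric]
        using lam by (auto intro!: derivative_eq_intros)
      have "(\<omega> has_vector_derivative vector_derivative \<omega> (at x)) (at (\<psi> (\<phi> x)))"
        using N(2)[OF x] by (simp add: \<psi>\<phi>)
      from vector_diff_chain_at[OF d\<psi> this]
      have "(\<theta> has_vector_derivative (1 / lam) *\<^sub>R vector_derivative \<omega> (at x)) (at (\<phi> x))"
        by (simp add: o_def \<omega>_def \<phi>\<psi>)
      then have "vector_derivative \<theta> (at (\<phi> x)) = (1 / lam) *\<^sub>R vector_derivative \<omega> (at x)"
        by (rule vector_derivative_at)
      then have "?T (\<phi> x) = ?W x / lam\<^sup>2"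
        using lam by (simp add: power_divide)
      then show "warp (\<sigma> x) * ?W x = lam\<^sup>2 * H (\<phi> x)"
        using lam by (simp add: H_def \<psi>\<phi>)
    qed
    then show ?thesis using lam by (simp add: integral_unique power2_eq_square)
  qed
  \<comment> \<open>The saving is at least \<open>1 - lam\<close>, because \<open>warp\<close>
    exceeds 1; displacing the weight costs at most \<open>K * (1 - lam) * (b - a)\<close>. Their
    difference is \<eta>, positive because \<open>K * (b - a) < 1\<close>.\<close>
  define \<eta> where "\<eta> = (1 - lam) * (1 - K * (b - a))"
  have \<eta>: "0 < \<eta>" using lam K(2) by (simp add: \<eta>_def)
  have "integral {c..d} (\<lambda>t. warp (\<sigma> t) * ?T t) \<le> integral {a..b} (\<lambda>t. warp (\<sigma> t) * ?T t)"
  proof (rule integral_subset_le[OF _ iT' iT])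
    have "0 \<le> warp (\<sigma> t) * ?T t" for t using warp_gt_1[of "\<sigma> t"] by simp
    then show "\<forall>t\<in>{a..b}. 0 \<le> warp (\<sigma> t) * ?T t" by blast
  qed (use abcd in auto)
  also have "\<dots> \<le> lam * integral {c..d} H"
    using le W unfolding warp_energy_def integral_add[OF iS iT] integral_add[OF iS iW] by simp
  also have "\<dots> = integral {c..d} (\<lambda>y. lam * H y)" by simp
  also have "\<dots> \<le> integral {c..d} (\<lambda>t. warp (\<sigma> t) * ?T t - \<eta> * ?T t)"
  proof (rule integral_le)
    show "(\<lambda>y. lam * H y) integrable_on {c..d}" by (rule integrable_on_mult_right[OF iH])
    show "(\<lambda>t. warp (\<sigma> t) * ?T t - \<eta> * ?T t) integrable_on {c..d}"
      by (intro integrable_diff iT' integrable_on_mult_right i0)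
    fix y assume y: "y \<in> {c..d}"
    have "warp (\<sigma> (\<psi> y)) - warp (\<sigma> y) \<le> K * \<bar>\<psi> y - y\<bar>"
      using K(3)[OF \<psi>in[OF y], of y] y abcd by auto
    also have "\<dots> \<le> K * ((1 - lam) * (b - a))" by (rule mult_left_mono[OF \<psi>near[OF y] K(1)])
    finally have 1: "warp (\<sigma> (\<psi> y)) \<le> warp (\<sigma> y) + K * ((1 - lam) * (b - a))" by simp
    have "lam * warp (\<sigma> (\<psi> y)) \<le> lam * warp (\<sigma> y) + lam * (K * ((1 - lam) * (b - a)))"
      using mult_left_mono[OF 1, of lam] lam by (simp add: distrib_left)
    also have "lam * (K * ((1 - lam) * (b - a))) \<le> K * ((1 - lam) * (b - a))"
      using lam K(1) abcd by (intro mult_left_le_one_le) auto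
    also have "lam * warp (\<sigma> y) \<le> warp (\<sigma> y) - (1 - lam)"
      using mult_left_mono[OF less_imp_le[OF warp_gt_1[of "\<sigma> y"]], of "1 - lam"] lam by (simp add: algebra_simps)
    finally have "lam * warp (\<sigma> (\<psi> y)) \<le> warp (\<sigma> y) - \<eta>" by (simp add: \<eta>_def algebra_simps)
    from mult_right_mono[OF this, of "?T y"]
    show "lam * H y \<le> warp (\<sigma> y) * ?T y - \<eta> * ?T y" by (simp add: H_def algebra_simps)
  qed
  also have "\<dots> = integral {c..d} (\<lambda>t. warp (\<sigma> t) * ?T t) - \<eta> * integral {c..d} ?T"
    by (subst integral_diff[OF iT' integrable_on_mult_right[OF i0]]) simp
  finally have "\<eta> * integral {c..d} ?T \<le> 0" by simp
  then have "integral {c..d} ?T \<le> 0" using \<eta> by (simp add: mult_le_0_iff)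
  then obtain N where N: "negligible N" "\<And>t. t \<in> {c..d} - N \<Longrightarrow> ?T t = 0"
    using nonneg_integral_le_0_imp_ae_0[OF i0] by auto
  show ?thesis
    by (rule lipschitz_ivl_const_if_ae_derivative_0[OF lt' N(1) _ t]) (use N(2) in simp)
qed

section \<open>Where strict convexity fails, the curve is radial\<close>

lemma chord_weights: "u < v \<Longrightarrow> chord f u v t = ((v - t) * f u + (t - u) * f v) / (v - u)"
  by (simp add: chord_def field_simps)

lemma chord_of_chord: "x < y \<Longrightarrow> u < v \<Longrightarrow> chord (chord f u v) x y t = chord f u v t"
proof -
  assume "x < y" "u < v"
  define m where "m = (f v - f u) / (v - u)"
  have c: "chord f u v s = f u + m * (s - u)" for s by (simp add: chord_def m_def)
  have "chord f u v y - chord f u v x = m * (y - x)" unfolding c by (simp add: algebra_simps)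
  then have "(chord f u v y - chord f u v x) / (y - x) = m" using \<open>x < y\<close> by simp
  then have "chord (chord f u v) x y t = chord f u v x + m * (t - x)" by (simp only: chord_def[of "chord f u v"])
  then show "chord (chord f u v) x y t = chord f u v t" unfolding c by (simp add: algebra_simps)
qed

text \<open>A function below all its chords that meets one of them at an interior point coincides
  with it. So \<sigma> is affine and \<theta> constant on \<open>[x, y]\<close>; spreading angular
  motion extends the constancy first to the right end and then to the left end.\<close>

lemma warp_geodesic_degenerate:
  fixes \<theta> :: "real \<Rightarrow> 'a::euclidean_space"
  assumes min: "\<And>u v. \<lbrakk>a \<le> u; u < v; v \<le> b\<rbrakk> \<Longrightarrow> warp_minimal u v \<sigma> \<theta>"
    and K: "0 \<le> K" "K * (b - a) < 1"
      "\<And>s t. \<lbrakk>s \<in> {a..b}; t \<in> {a..b}\<rbrakk> \<Longrightarrow> \<bar>warp (\<sigma> s) - warp (\<sigma> t)\<bar> \<le> K * \<bar>s - t\<bar>"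
    and xyz: "a \<le> x" "x < z" "z < y" "y \<le> b" "chord \<sigma> x y z \<le> \<sigma> z"
    and t: "t \<in> {a..b}"
  shows "\<theta> t = \<theta> a"
proof -
  have below: "\<sigma> s \<le> chord \<sigma> u v s" if "a \<le> u" "u < v" "v \<le> b" "s \<in> {u..v}" for u v s
    by (rule warp_minimal_below_chord[OF min[OF that(1-3)] that(2,4)])
  let ?L = "chord \<sigma> x y"
  have xy: "x < y" using xyz by simp
  have Lx: "?L x = \<sigma> x" and Ly: "?L y = \<sigma> y" using xy by (simp_all add: chord_left chord_right)
  have aff: "\<sigma> s = ?L s" if s: "s \<in> {x..y}" for s
  proof (rule ccontr)
    assume "\<sigma> s \<noteq> ?L s"
    moreover have "\<sigma> s \<le> ?L s" by (rule below) (use s xyz in auto)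
    ultimately have lt: "\<sigma> s < ?L s" by simp
    then have sne: "s \<noteq> x" "s \<noteq> y" "s \<noteq> z" using Lx Ly xyz(5) by auto
    \<comment> \<open>Lowering one end value of a chord lowers it at every interior point, so
      strictness at \<open>s\<close> passes to \<open>z\<close>.\<close>
    have "\<sigma> z < ?L z"
    proof (cases "s < z")
      case True
      have sy: "s < y" using True xyz by simp
      have "\<sigma> z \<le> chord \<sigma> s y z" by (rule below) (use s True xyz in auto)
      also have "\<dots> < chord ?L s y z"
        unfolding chord_weights[OF sy] Ly
        using sy lt xyz by (intro divide_strict_right_mono add_strict_right_mono mult_strict_left_mono) auto
      also have "\<dots> = ?L z" by (rule chord_of_chord[OF sy xy])
      finally show ?thesis .
    next
      case False
      then have xs: "x < s" and zs: "z < s" using xyz sne by auto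
      have "\<sigma> z \<le> chord \<sigma> x s z" by (rule below) (use s zs xyz in auto)
      also have "\<dots> < chord ?L x s z"
        unfolding chord_weights[OF xs] Lx
        using xs lt xyz by (intro divide_strict_right_mono add_strict_left_mono mult_strict_left_mono) auto
      also have "\<dots> = ?L z" by (rule chord_of_chord[OF xs xy])
      finally show ?thesis .
    qed
    then show False using xyz(5) by simp
  qed
  have c1: "\<theta> s = \<theta> x" if "s \<in> {x..y}" for s
    by (rule warp_minimal_affine_imp_const[OF min xy aff that]) (use xyz in simp_all)
  \<comment> \<open>In \<open>[x, b]\<close> the direction can move only during
    \<open>[y, b]\<close>, a strictly shorter interval since \<open>x < y\<close>.\<close>
  have c2: "\<theta> s = \<theta> x" if s: "s \<in> {x..b}" for s
  proof (cases "s \<le> y")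
    case True
    show ?thesis by (rule c1) (use s True in simp)
  next
    case False
    have "K * (b - x) \<le> K * (b - a)" using K(1) xyz by (intro mult_left_mono) auto
    then have Kx: "K * (b - x) < 1" using K(2) by linarith
    have xb: "warp_minimal x b \<sigma> \<theta>" by (rule min) (use xyz in linarith)+
    have Kl: "\<bar>warp (\<sigma> s) - warp (\<sigma> t)\<bar> \<le> K * \<bar>s - t\<bar>" if "s \<in> {x..b}" "t \<in> {x..b}" for s t
      by (rule K(3)) (use that xyz in auto)
    have yx: "\<theta> y = \<theta> x" by (rule c1) (use xy in simp)
    have "\<theta> s = \<theta> y"
      by (rule warp_minimal_spread_imp_const[OF xb _ _ order_refl _ yx refl K(1) Kx Kl])
        (use False s xyz xy in simp_all)
    then show ?thesis using yx by (rule trans)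
  qed
  show ?thesis
  proof (cases "a < x")
    case False
    then have "a = x" using xyz by simp
    have "\<theta> t = \<theta> x" by (rule c2) (use t \<open>a = x\<close> in simp)
    then show ?thesis unfolding \<open>a = x\<close> .
  next
    case True
    have ab: "warp_minimal a b \<sigma> \<theta>" by (rule min) (use xyz in linarith)+
    have xb: "\<theta> x = \<theta> b" by (rule c2[symmetric]) (use xyz in simp)
    \<comment> \<open>Now the direction can move only during \<open>[a, x]\<close>, which is
      strictly shorter than \<open>[a, b]\<close>.\<close>
    have c3: "\<theta> s = \<theta> a" if "s \<in> {a..x}" for s
      by (rule warp_minimal_spread_imp_const[OF ab _ True _ _ refl xb K that]) (use xyz in simp_all)
    show ?thesis
    proof (cases "t \<le> x")
      case True
      show ?thesis by (rule c3) (use t True in simp)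
    next
      case False
      have "\<theta> t = \<theta> x" by (rule c2) (use t False in simp)
      also have "\<theta> x = \<theta> a" by (rule c3) (use xyz in simp)
      finally show ?thesis .
    qed
  qed
qed

text \<open>A maximum principle: if \<open>f\<close> minus its chord had a positive maximum, it
  would be attained inside, where the local midpoint inequality contradicts it.\<close>

lemma locally_below_chords_imp_below_chords:
  assumes I: "is_interval I" and cont: "continuous_on I f"
    and loc: "\<And>t. t \<in> I \<Longrightarrow> \<exists>\<epsilon>>0. \<forall>u\<in>I \<inter> ball t \<epsilon>. \<forall>v\<in>I \<inter> ball t \<epsilon>. u < v \<longrightarrow>
      (\<forall>x\<in>{u..v}. f x \<le> chord f u v x)"
    and uv: "u \<in> I" "v \<in> I" "u < v" and x: "x \<in> {u..v}"
  shows "f x \<le> chord f u v x"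
proof (rule ccontr)
  assume neg: "\<not> f x \<le> chord f u v x"
  define g where "g s = f s - chord f u v s" for s
  have sub: "{u..v} \<subseteq> I" 
    using I uv unfolding is_interval_1 by (meson atLeastAtMost_iff subsetI)
  have "continuous_on {u..v} (chord f u v)"
    by (rule DERIV_continuous_on[OF has_field_derivative_at_within[OF chord_derivative]])
  then have gc: "continuous_on {u..v} g"
    unfolding g_def by (intro continuous_intros continuous_on_subset[OF cont sub])
  obtain m0 where m0: "m0 \<in> {u..v}" "\<And>s. s \<in> {u..v} \<Longrightarrow> g s \<le> g m0"
    using continuous_attains_sup[OF compact_Icc _ gc] uv by auto
  define M where "M = g m0"
  have M: "0 < M" using m0(2)[OF x] neg by (simp add: g_def M_def)
  define S where "S = {u..v} \<inter> g -` {M}"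
  have "closed S"
    unfolding S_def by (rule continuous_closed_preimage[OF gc closed_atLeastAtMost closed_singleton])
  moreover have "bounded S"
    by (rule bounded_subset[OF bounded_closed_interval]) (auto simp: S_def)
  ultimately have "compact S" by (simp add: compact_eq_bounded_closed)
  moreover have "S \<noteq> {}" using m0 by (auto simp: S_def M_def)
  \<comment> \<open>The rightmost maximum point is taken, so that the value at
    \<open>m + \<eta>\<close> is strictly smaller and the midpoint inequality fails
    strictly.\<close>
  ultimately obtain m where m: "m \<in> S" "\<And>s. s \<in> S \<Longrightarrow> s \<le> m" using compact_attains_sup[of S] by auto
  have gm: "g m = M" "m \<in> {u..v}" using m(1) by (auto simp: S_def)
  have "g u = 0" "g v = 0" using uv by (auto simp: g_def chord_left chord_right)
  then have "m \<noteq> u" "m \<noteq> v" using gm M by auto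
  then have mm: "u < m" "m < v" using gm(2) by simp_all
  obtain \<epsilon> where \<epsilon>: "0 < \<epsilon>" "\<And>a b x. \<lbrakk>a \<in> I \<inter> ball m \<epsilon>; b \<in> I \<inter> ball m \<epsilon>; a < b; x \<in> {a..b}\<rbrakk> \<Longrightarrow> f x \<le> chord f a b x"
    using loc[of m] gm(2) sub by blast
  define \<eta> where "\<eta> = min (\<epsilon> / 2) (min (m - u) (v - m))"
  have \<eta>: "0 < \<eta>" "\<eta> < \<epsilon>" "m - \<eta> \<in> {u..v}" "m + \<eta> \<in> {u..v}" using \<epsilon>(1) mm by (auto simp: \<eta>_def)
  have "f m \<le> chord f (m - \<eta>) (m + \<eta>) m"
    by (rule \<epsilon>(2)) (use \<eta> sub in \<open>auto simp: dist_real_def\<close>)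
  also have "\<dots> = (f (m - \<eta>) + f (m + \<eta>)) / 2" using \<eta>(1) by (simp add: chord_def field_simps)
  finally have "f m \<le> (f (m - \<eta>) + f (m + \<eta>)) / 2" .
  moreover have "f u + k * (m - u) = ((f u + k * (m - \<eta> - u)) + (f u + k * (m + \<eta> - u))) / 2" for k
    by (simp add: algebra_simps)
  then have "chord f u v m = (chord f u v (m - \<eta>) + chord f u v (m + \<eta>)) / 2" unfolding chord_def .
  moreover have "A - D \<le> ((B - E) + (C - F)) / 2" if "A \<le> (B + C) / 2" "D = (E + F) / 2" for A B C D E F :: real
    using that by (simp add: field_simps)
  ultimately have "g m \<le> (g (m - \<eta>) + g (m + \<eta>)) / 2"
    unfolding g_def by blast
  moreover have "g (m - \<eta>) \<le> M" using m0(2)[OF \<eta>(3)] by (simp add: M_def)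
  moreover have "g (m + \<eta>) < M"
  proof (rule ccontr)
    assume "\<not> g (m + \<eta>) < M"
    then have "m + \<eta> \<in> S" using m0(2)[OF \<eta>(4)] \<eta>(4) by (auto simp: S_def M_def)
    then show False using m(2)[of "m + \<eta>"] \<eta>(1) by simp
  qed
  ultimately show False using gm(1) by simp
qed

text \<open>Every competitor in polar coordinates is the image of a curve under
  \<open>polar_chart\<close>, so minimality carries over. The second conclusion holds since the
  radial speed is at most the total speed 1; it later provides continuity of \<sigma> and the bound
  for the change of \<open>warp\<close>.\<close>

lemma minimizing_geodesic_imp_warp_minimal:
  fixes \<gamma> :: "real \<Rightarrow> 'a::euclidean_space"
  assumes g: "minimizing_geodesic (hyperbolic_space - {0}) condition_metric_0 a b \<gamma>" and ab: "a \<le> b"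
  defines "\<sigma> \<equiv> \<lambda>t. ln (hyp_radius (\<gamma> t))" and "\<theta> \<equiv> \<lambda>t. sgn (\<gamma> t)"
  shows "warp_minimal a b \<sigma> \<theta>" "\<bar>\<sigma> b - \<sigma> a\<bar> \<le> b - a"
proof -
  have lc: "lipschitz_curve (hyperbolic_space - {0}) a b \<gamma>"
    and arc: "\<And>s t. \<lbrakk>a \<le> s; s \<le> t; t \<le> b\<rbrakk> \<Longrightarrow> curve_length condition_metric_0 s t \<gamma> = t - s"
    and min: "\<And>c. \<lbrakk>lipschitz_curve (hyperbolic_space - {0}) a b c; c a = \<gamma> a; c b = \<gamma> b\<rbrakk>
      \<Longrightarrow> curve_length condition_metric_0 a b \<gamma> \<le> curve_length condition_metric_0 a b c"
    using g unfolding minimizing_geodesic_def by blast+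
  have w: "warp_curve a b \<sigma> \<theta>" unfolding \<sigma>_def \<theta>_def by (rule polar_coordinates_curve(1)[OF lc])
  have len: "warp_length t b \<sigma> \<theta> = b - t" if t: "t \<in> {a..b}" for t
  proof -
    have "lipschitz_curve (hyperbolic_space - {0}) t b \<gamma>"
    proof -
      have "\<gamma> ` {t..b} \<subseteq> \<gamma> ` {a..b}" using t by (intro image_mono) auto
      moreover have "lipschitz_ivl t b \<gamma>"
        by (rule lipschitz_ivl_subset[of a b]) (use lc t in \<open>auto simp: lipschitz_curve_iff\<close>)
      ultimately show ?thesis using lc unfolding lipschitz_curve_iff by blast
    qed
    from polar_coordinates_curve(2)[OF this] show ?thesis
      using arc[of t b] t by (simp add: \<sigma>_def \<theta>_def)
  qed
  have pc: "polar_chart (\<sigma> t) (\<theta> t) = \<gamma> t" if "t \<in> {a..b}" for t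
    unfolding \<sigma>_def \<theta>_def by (rule polar_chart_inverse) (use lc that in \<open>unfold lipschitz_curve_iff, blast\<close>)
  show "warp_minimal a b \<sigma> \<theta>"
  proof (rule warp_minimal_if_length_minimal[OF w ab len])
    fix \<tau> and \<phi> :: "real \<Rightarrow> 'a"
    assume c: "warp_curve a b \<tau> \<phi>" "\<tau> a = \<sigma> a" "\<tau> b = \<sigma> b" "\<phi> a = \<theta> a" "\<phi> b = \<theta> b"
    have "curve_length condition_metric_0 a b \<gamma> \<le> curve_length condition_metric_0 a b (\<lambda>t. polar_chart (\<tau> t) (\<phi> t))"
      by (rule min[OF polar_chart_curve(1)[OF c(1)]]) (use c pc ab in auto)
    then show "warp_length a b \<sigma> \<theta> \<le> warp_length a b \<tau> \<phi>"
      using polar_coordinates_curve(2)[OF lc] polar_chart_curve(2)[OF c(1)] by (simp add: \<sigma>_def \<theta>_def)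
  qed
  have ls: "lipschitz_ivl a b \<sigma>" using w unfolding warp_curve_def by blast
  note f = lipschitz_ivl_fundamental_theorem[OF ls ab]
  have i: "\<bar>\<sigma> b - \<sigma> a\<bar> \<le> integral {a..b} (\<lambda>t. sqrt ((vector_derivative \<sigma> (at t))\<^sup>2 + warp (\<sigma> t) * (norm (vector_derivative \<theta> (at t)))\<^sup>2))"
    unfolding integral_unique[OF f, symmetric] real_norm_def[symmetric]
  proof (rule integral_norm_bound_integral[OF has_integral_integrable[OF f] warp_curve_integrable(1)[OF w]])
    fix t
    show "norm (vector_derivative \<sigma> (at t)) \<le> sqrt ((vector_derivative \<sigma> (at t))\<^sup>2 + warp (\<sigma> t) * (norm (vector_derivative \<theta> (at t)))\<^sup>2)"
      using warp_gt_1[of "\<sigma> t"] by (simp add: real_le_rsqrt)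
  qed
  then show "\<bar>\<sigma> b - \<sigma> a\<bar> \<le> b - a" using len[of a] ab by (simp add: warp_length_def)
qed

section \<open>Geodesics of the condition metric\<close>

text \<open>The witness is the unit-speed ray from \<open>x\<close> to the origin, shortest by
  \<open>riem_dist_radial\<close>.\<close>

lemma directed_along_segment_radial:
  fixes x :: "'a::euclidean_space"
  assumes x: "x \<in> hyperbolic_space - {0}"
  shows "directed_along_segment hyperbolic_space hyperbolic_metric 0 x (k *\<^sub>R sgn x)"
proof -
  define L where "L = hyp_radius x"
  define \<theta> where "\<theta> = sgn x"
  have L: "0 < L" using x hyp_radius_nonneg(2)[of x] by (simp add: L_def)
  have \<theta>: "norm \<theta> = 1" using x by (simp add: \<theta>_def norm_sgn)
  define c where "c s = tanh ((L - s) / 2) *\<^sub>R \<theta>" for s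
  \<comment> \<open>The Euclidean speed at \<open>x\<close> of a curve of hyperbolic speed 1: the
    reciprocal of the conformal factor.\<close>
  define \<rho> where "\<rho> = (1 - (tanh (L / 2))\<^sup>2) / 2"
  have \<rho>: "0 < \<rho>" using abs_tanh_less_1[of "L/2"] norm_less_1_square[of "tanh (L/2)"] by (simp add: \<rho>_def)
  have "((\<lambda>s. L - s) has_real_derivative - 1) (at 0)" by (auto intro!: derivative_eq_intros)
  from tanh_half_derivative[OF this]
  have "((\<lambda>s. tanh ((L - s) / 2)) has_real_derivative - \<rho>) (at 0)" by (simp add: \<rho>_def)
  from has_vector_derivative_scaleR[OF this has_vector_derivative_const[of \<theta>]]
  have "(c has_vector_derivative (- \<rho>) *\<^sub>R \<theta>) (at 0)" unfolding c_def by simp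
  then have dc: "(c has_vector_derivative (- \<rho>) *\<^sub>R \<theta>) (at 0 within {0..L})"
    by (rule has_vector_derivative_at_within)
  show ?thesis
    unfolding directed_along_segment_def
  proof (intro exI conjI)
    show "0 < L" by (rule L)
    show "c ` {0..L} \<subseteq> hyperbolic_space"
      using radial_in_hyperbolic_space[OF \<theta>] by (simp add: c_def image_subset_iff)
    show "c 0 = x"
      using tanh_hyp_radius[of x] x by (simp add: c_def L_def \<theta>_def sgn_div_norm)
    show "c L = 0" by (simp add: c_def)
    show "\<forall>s\<in>{0..L}. \<forall>t\<in>{0..L}. riem_dist hyperbolic_space hyperbolic_metric (c s) (c t) = \<bar>s - t\<bar>"
    proof (intro ballI)
      fix s t assume "s \<in> {0..L}" "t \<in> {0..L}"
      then have "riem_dist hyperbolic_space hyperbolic_metric (c s) (c t) = \<bar>(L - s) - (L - t)\<bar>"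
        unfolding c_def by (intro riem_dist_radial[OF \<theta>]) simp_all
      then show "riem_dist hyperbolic_space hyperbolic_metric (c s) (c t) = \<bar>s - t\<bar>" by simp
    qed
    show "(c has_vector_derivative (- \<rho>) *\<^sub>R \<theta>) (at 0 within {0..L})" by (rule dc)
    show "k *\<^sub>R sgn x = (- (k / \<rho>)) *\<^sub>R ((- \<rho>) *\<^sub>R \<theta>)" using \<rho> by (simp add: \<theta>_def)
  qed
qed

lemma condition_geodesic_local_warp:
  fixes \<gamma> :: "real \<Rightarrow> 'a::euclidean_space"
  assumes g: "condition_geodesic hyperbolic_space hyperbolic_metric {0} I \<gamma>" and t: "t \<in> I"
  defines "\<sigma> \<equiv> \<lambda>t. ln (hyp_radius (\<gamma> t))" and "\<theta> \<equiv> \<lambda>t. sgn (\<gamma> t)"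
  obtains \<epsilon> where "0 < \<epsilon>"
    "\<And>a b. \<lbrakk>a \<in> I \<inter> ball t \<epsilon>; b \<in> I \<inter> ball t \<epsilon>; a < b\<rbrakk> \<Longrightarrow> warp_minimal a b \<sigma> \<theta>"
    "\<And>a b. \<lbrakk>a \<in> I \<inter> ball t \<epsilon>; b \<in> I \<inter> ball t \<epsilon>\<rbrakk> \<Longrightarrow> \<bar>\<sigma> a - \<sigma> b\<bar> \<le> \<bar>a - b\<bar>"
proof -
  obtain \<epsilon> where \<epsilon>: "0 < \<epsilon>" "\<And>a b. \<lbrakk>a \<in> I \<inter> ball t \<epsilon>; b \<in> I \<inter> ball t \<epsilon>; a < b\<rbrakk> \<Longrightarrow>
      minimizing_geodesic (hyperbolic_space - {0}) condition_metric_0 a b \<gamma>"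
  proof -
    have "\<forall>t\<in>I. \<exists>\<epsilon>>0. \<forall>a\<in>I \<inter> ball t \<epsilon>. \<forall>b\<in>I \<inter> ball t \<epsilon>.
        a < b \<longrightarrow> minimizing_geodesic (hyperbolic_space - {0}) condition_metric_0 a b \<gamma>"
      using g unfolding condition_geodesic_def geodesic_def by (elim conjE)
    from bspec[OF this t] show ?thesis using that by (elim exE conjE) simp
  qed
  show thesis
  proof (rule that[OF \<epsilon>(1)])
    fix a b assume ab: "a \<in> I \<inter> ball t \<epsilon>" "b \<in> I \<inter> ball t \<epsilon>"
    show "warp_minimal a b \<sigma> \<theta>" if "a < b"
      unfolding \<sigma>_def \<theta>_def
      by (rule minimizing_geodesic_imp_warp_minimal(1)[OF \<epsilon>(2)[OF ab that] less_imp_le[OF that]])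
    have lip: "\<bar>\<sigma> b - \<sigma> a\<bar> \<le> b - a" if "a \<in> I \<inter> ball t \<epsilon>" "b \<in> I \<inter> ball t \<epsilon>" "a < b" for a b
      unfolding \<sigma>_def
      by (rule minimizing_geodesic_imp_warp_minimal(2)[OF \<epsilon>(2)[OF that] less_imp_le[OF that(3)]])
    consider "a < b" | "b < a" | "a = b" by linarith
    then show "\<bar>\<sigma> a - \<sigma> b\<bar> \<le> \<bar>a - b\<bar>"
    proof cases
      case 1
      from lip[OF ab this] show ?thesis using 1 by (simp add: abs_minus_commute)
    next
      case 2
      from lip[OF ab(2,1) this] show ?thesis using 2 by simp
    qed simp
  qed
qed

lemma log_condition_0:
  assumes "x \<in> hyperbolic_space - {0}"
  shows "log_condition hyperbolic_space hyperbolic_metric {0} x = - ln (hyp_radius x)"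
  using assms hyp_radius_nonneg(2)[of x]
  by (simp add: log_condition_def riem_setdist_0 ln_div)

lemma chord_interpolate: "x < y \<Longrightarrow> chord f x y (x + r * (y - x)) = f x + r * (f y - f x)"
  by (simp add: chord_def)

lemma convex_on_if_below_chords:
  fixes f :: "real \<Rightarrow> real"
  assumes "convex I" and f: "\<And>u v x. \<lbrakk>u \<in> I; v \<in> I; u < v; x \<in> {u..v}\<rbrakk> \<Longrightarrow> f x \<le> chord f u v x"
  shows "convex_on I f"
proof (rule convex_on_linorderI)
  fix t x y :: real
  assume t: "0 < t" "t < 1" and xy: "x \<in> I" "y \<in> I" "x < y"
  have e: "(1 - t) * x + t * y = x + t * (y - x)" by (simp add: algebra_simps)
  have e2: "x + t * (y - x) = y - (1 - t) * (y - x)" by (simp add: algebra_simps)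
  have "x + t * (y - x) \<le> y" unfolding e2 using t xy by simp
  moreover have "0 \<le> t * (y - x)" using t xy by simp
  ultimately have "x + t * (y - x) \<in> {x..y}" by simp
  then have "f ((1 - t) * x + t * y) \<le> chord f x y ((1 - t) * x + t * y)"
    unfolding e by (rule f[OF xy])
  also have "\<dots> = (1 - t) * f x + t * f y"
    unfolding e chord_interpolate[OF xy(3)] by (simp add: algebra_simps)
  finally show "f ((1 - t) *\<^sub>R x + t *\<^sub>R y) \<le> (1 - t) * f x + t * f y" by simp
qed (rule assms(1))

lemma convex_on_transform:
  fixes f g :: "real \<Rightarrow> real"
  assumes f: "convex_on S f" and eq: "\<And>x. x \<in> S \<Longrightarrow> f x = g x"
  shows "convex_on S g"
proof -
  have S: "convex S" using f by (rule convex_on_imp_convex)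
  have "g (u *\<^sub>R x + v *\<^sub>R y) \<le> u * g x + v * g y"
    if "x \<in> S" "y \<in> S" "0 \<le> u" "0 \<le> v" "u + v = 1" for x y u v
  proof -
    have "f (u *\<^sub>R x + v *\<^sub>R y) \<le> u * f x + v * f y"
      using f that unfolding convex_on_def by simp
    then show ?thesis by (simp only: eq[OF convexD[OF S that]] eq[OF that(1)] eq[OF that(2)])
  qed
  then show ?thesis using S unfolding convex_on_def by blast
qed

text \<open>The chord inequality is known only on short intervals, where the geodesic minimizes; the
  maximum principle makes it global, with continuity supplied by the local bound on the radial
  speed.\<close>

lemma condition_geodesic_convex:
  fixes \<gamma> :: "real \<Rightarrow> 'a::euclidean_space"
  assumes g: "condition_geodesic hyperbolic_space hyperbolic_metric {0} I \<gamma>"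
  shows "convex_on I (\<lambda>t. ln (hyp_radius (\<gamma> t)))"
proof (rule convex_on_if_below_chords)
  let ?\<sigma> = "\<lambda>t. ln (hyp_radius (\<gamma> t))"
  have I: "is_interval I" using g unfolding condition_geodesic_def geodesic_def by blast
  then show "convex I" by (simp add: is_interval_convex_1)
  have cont: "continuous_on I ?\<sigma>"
    unfolding continuous_on_iff
  proof (intro ballI allI impI)
    fix t e :: real assume t: "t \<in> I" and e: "0 < e"
    obtain \<epsilon> where \<epsilon>: "0 < \<epsilon>" "\<And>a b. \<lbrakk>a \<in> I \<inter> ball t \<epsilon>; b \<in> I \<inter> ball t \<epsilon>\<rbrakk> \<Longrightarrow> \<bar>?\<sigma> a - ?\<sigma> b\<bar> \<le> \<bar>a - b\<bar>"
      by (rule condition_geodesic_local_warp[OF g t]) blast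
    show "\<exists>d>0. \<forall>x'\<in>I. dist x' t < d \<longrightarrow> dist (?\<sigma> x') (?\<sigma> t) < e"
    proof (intro exI conjI ballI impI)
      show "0 < min \<epsilon> e" using \<epsilon>(1) e by simp
      fix s assume s: "s \<in> I" "dist s t < min \<epsilon> e"
      then have "\<bar>?\<sigma> s - ?\<sigma> t\<bar> \<le> \<bar>s - t\<bar>"
        using t \<epsilon>(1) by (intro \<epsilon>(2)) (auto simp: dist_commute)
      then show "dist (?\<sigma> s) (?\<sigma> t) < e" using s by (simp add: dist_real_def)
    qed
  qed
  fix u v x assume uv: "u \<in> I" "v \<in> I" "u < v" and x: "x \<in> {u..v}"
  show "?\<sigma> x \<le> chord ?\<sigma> u v x"
  proof (rule locally_below_chords_imp_below_chords[OF I cont _ uv x])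
    fix t assume t: "t \<in> I"
    obtain \<epsilon> where \<epsilon>: "0 < \<epsilon>" "\<And>a b. \<lbrakk>a \<in> I \<inter> ball t \<epsilon>; b \<in> I \<inter> ball t \<epsilon>; a < b\<rbrakk> \<Longrightarrow> warp_minimal a b ?\<sigma> (\<lambda>t. sgn (\<gamma> t))"
      by (rule condition_geodesic_local_warp[OF g t]) blast
    show "\<exists>\<epsilon>>0. \<forall>u\<in>I \<inter> ball t \<epsilon>. \<forall>v\<in>I \<inter> ball t \<epsilon>. u < v \<longrightarrow> (\<forall>x\<in>{u..v}. ?\<sigma> x \<le> chord ?\<sigma> u v x)"
    proof (intro exI[of _ \<epsilon>] conjI ballI impI)
      fix u v x assume "u \<in> I \<inter> ball t \<epsilon>" "v \<in> I \<inter> ball t \<epsilon>" and uv: "u < v" and x: "x \<in> {u..v}"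
      then have "warp_minimal u v ?\<sigma> (\<lambda>t. sgn (\<gamma> t))" by (intro \<epsilon>(2))
      then show "?\<sigma> x \<le> chord ?\<sigma> u v x" using uv x by (rule warp_minimal_below_chord)
    qed (rule \<epsilon>(1))
  qed
qed

text \<open>Where \<open>ln (hyp_radius (\<gamma> t))\<close> is not strictly convex, the direction of \<open>\<gamma>\<close> is locally
  constant, so that \<open>\<gamma>\<close> runs along a ray.\<close>

lemma condition_geodesic_strict:
  fixes \<gamma> :: "real \<Rightarrow> 'a::euclidean_space"
  assumes g: "condition_geodesic hyperbolic_space hyperbolic_metric {0} I \<gamma>" and t: "t \<in> I"
    and d: "(\<gamma> has_vector_derivative w) (at t within I)"
    and nstrict: "\<not> strictly_concave_at I (\<lambda>t. - ln (hyp_radius (\<gamma> t))) t"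
  shows "directed_along_segment hyperbolic_space hyperbolic_metric 0 (\<gamma> t) w"
proof -
  define \<sigma> where "\<sigma> = (\<lambda>s. ln (hyp_radius (\<gamma> s)))"
  define \<theta> where "\<theta> = (\<lambda>s. sgn (\<gamma> s))"
  have I: "is_interval I" and \<gamma>I: "\<And>s. s \<in> I \<Longrightarrow> \<gamma> s \<in> hyperbolic_space - {0}"
    using g unfolding condition_geodesic_def geodesic_def by blast+
  obtain \<epsilon> where \<epsilon>0: "0 < \<epsilon>"
    "\<And>a b. \<lbrakk>a \<in> I \<inter> ball t \<epsilon>; b \<in> I \<inter> ball t \<epsilon>; a < b\<rbrakk> \<Longrightarrow>
       warp_minimal a b (\<lambda>s. ln (hyp_radius (\<gamma> s))) (\<lambda>s. sgn (\<gamma> s))"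
    "\<And>a b. \<lbrakk>a \<in> I \<inter> ball t \<epsilon>; b \<in> I \<inter> ball t \<epsilon>\<rbrakk> \<Longrightarrow>
       \<bar>ln (hyp_radius (\<gamma> a)) - ln (hyp_radius (\<gamma> b))\<bar> \<le> \<bar>a - b\<bar>"
    by (rule condition_geodesic_local_warp[OF g t], rule that)
  have \<epsilon>: "0 < \<epsilon>"
    "\<And>a b. \<lbrakk>a \<in> I \<inter> ball t \<epsilon>; b \<in> I \<inter> ball t \<epsilon>; a < b\<rbrakk> \<Longrightarrow> warp_minimal a b \<sigma> \<theta>"
    "\<And>a b. \<lbrakk>a \<in> I \<inter> ball t \<epsilon>; b \<in> I \<inter> ball t \<epsilon>\<rbrakk> \<Longrightarrow> \<bar>\<sigma> a - \<sigma> b\<bar> \<le> \<bar>a - b\<bar>"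
    unfolding \<sigma>_def \<theta>_def by (rule \<epsilon>0; assumption)+
  obtain K where K: "0 \<le> K" "\<And>x y. \<lbrakk>x \<in> {\<sigma> t - 1..\<sigma> t + 1}; y \<in> {\<sigma> t - 1..\<sigma> t + 1}\<rbrakk> \<Longrightarrow> \<bar>warp x - warp y\<bar> \<le> K * \<bar>x - y\<bar>"
    by (rule warp_lipschitz[of "\<sigma> t - 1" "\<sigma> t + 1"], rule that)
  \<comment> \<open>The bound \<epsilon> keeps the curve minimizing, 1 keeps \<sigma> in the range
    where \<open>K\<close> is valid, and the last bound makes \<open>K * (b - a) < 1\<close> for
    every interval \<open>[a, b]\<close> in the ball, whose length is at most
    \<open>2 * \<delta>\<close>.\<close>
  define \<delta> where "\<delta> = min \<epsilon> (min 1 (1 / (4 * (K + 1))))"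
  have \<delta>: "0 < \<delta>" "\<delta> \<le> \<epsilon>" "\<delta> \<le> 1" "\<delta> \<le> 1 / (4 * (K + 1))"
    using \<epsilon>(1) K(1) unfolding \<delta>_def by (simp, linarith+)
  let ?J = "I \<inter> ball t \<delta>"
  have J\<epsilon>: "s \<in> I \<inter> ball t \<epsilon>" if "s \<in> ?J" for s using that \<delta>(2) by auto
  have J: "is_interval ?J" by (intro is_interval_Int I is_interval_ball_real)
  have near: "\<sigma> s \<in> {\<sigma> t - 1..\<sigma> t + 1}" if "s \<in> ?J" for s
  proof -
    have "\<bar>\<sigma> s - \<sigma> t\<bar> \<le> \<bar>s - t\<bar>" by (rule \<epsilon>(3)[OF J\<epsilon>[OF that]]) (use t \<epsilon>(1) in simp)
    also have "\<dots> \<le> 1" using that \<delta>(3) by (auto simp: dist_real_def)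
    finally show ?thesis by (simp add: abs_le_iff)
  qed
  have "\<not> strictly_concave_on ?J (\<lambda>t. - \<sigma> t)"
    using nstrict \<delta>(1) unfolding strictly_concave_at_def \<sigma>_def by blast
  then obtain x y \<mu> \<nu> where xy: "x \<in> ?J" "y \<in> ?J" "\<mu> > 0" "\<nu> > 0" "x \<noteq> y" "\<mu> + \<nu> = 1"
    "\<not> \<mu> * - \<sigma> x + \<nu> * - \<sigma> y < - \<sigma> (\<mu> * x + \<nu> * y)"
    using J unfolding strictly_concave_on_def is_interval_convex_1[symmetric] by blast
  have "\<exists>x y z. x \<in> ?J \<and> y \<in> ?J \<and> x < z \<and> z < y \<and> chord \<sigma> x y z \<le> \<sigma> z"
  proof -
    have *: "x < \<mu> * x + \<nu> * y \<and> \<mu> * x + \<nu> * y < y \<and> chord \<sigma> x y (\<mu> * x + \<nu> * y) = \<mu> * \<sigma> x + \<nu> * \<sigma> y"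
      if "x < y" "0 < \<mu>" "0 < \<nu>" "\<mu> + \<nu> = 1" for x y \<mu> \<nu> :: real
    proof -
      have \<mu>: "\<mu> = 1 - \<nu>" using that by simp
      have e: "\<mu> * x + \<nu> * y = x + \<nu> * (y - x)" "\<mu> * x + \<nu> * y = y - \<mu> * (y - x)"
        unfolding \<mu> by (simp_all add: algebra_simps)
      have "x < \<mu> * x + \<nu> * y" unfolding e(1) using that by simp
      moreover have "\<mu> * x + \<nu> * y < y" unfolding e(2) using that by simp
      moreover have "chord \<sigma> x y (\<mu> * x + \<nu> * y) = \<mu> * \<sigma> x + \<nu> * \<sigma> y"
        unfolding e(1) chord_interpolate[OF that(1)] by (simp add: \<mu> algebra_simps)
      ultimately show ?thesis by blast
    qed
    show ?thesis
    proof (cases "x < y")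
      case True
      then show ?thesis using *[OF True xy(3,4,6)] xy
        by (intro exI[of _ x] exI[of _ y] exI[of _ "\<mu> * x + \<nu> * y"]) auto
    next
      case False
      then have yx: "y < x" using xy(5) by simp
      have "\<nu> + \<mu> = 1" using xy(6) by simp
      from *[OF yx xy(4,3) this] show ?thesis using xy
        by (intro exI[of _ y] exI[of _ x] exI[of _ "\<mu> * x + \<nu> * y"]) (auto simp: add.commute)
    qed
  qed
  then obtain x y z where z: "x \<in> ?J" "y \<in> ?J" "x < z" "z < y" "chord \<sigma> x y z \<le> \<sigma> z" by blast
  \<comment> \<open>The interval is enlarged to contain \<open>t\<close>, where the velocity is to
    be determined.\<close>
  define a where "a = min t x"
  define b where "b = max t y"
  have aJ: "a \<in> ?J" and bJ: "b \<in> ?J" using z t \<delta>(1) by (auto simp: a_def b_def min_def max_def)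
  have ab: "a < b" "a \<le> x" "y \<le> b" "t \<in> {a..b}" using z by (auto simp: a_def b_def)
  have sub: "{a..b} \<subseteq> ?J" using J aJ bJ unfolding is_interval_1 by (meson atLeastAtMost_iff subsetI)
  have const: "\<theta> s = \<theta> a" if s: "s \<in> {a..b}" for s
  proof (rule warp_geodesic_degenerate[OF _ K(1) _ _ ab(2) z(3,4) ab(3) z(5) s])
    fix u v assume "a \<le> u" "u < v" "v \<le> b"
    then have "u \<in> {a..b}" "v \<in> {a..b}" by auto
    then show "warp_minimal u v \<sigma> \<theta>" using \<open>u < v\<close> by (intro \<epsilon>(2) J\<epsilon> subsetD[OF sub])
  next
    have "b - a \<le> 2 * \<delta>" using aJ bJ by (auto simp: dist_real_def)
    also have "2 * \<delta> \<le> 2 * (1 / (4 * (K + 1)))" using \<delta>(4) by (rule mult_left_mono) simp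
    also have "\<dots> = 1 / (2 * (K + 1))" using K(1) by (simp add: divide_simps)
    finally have "b - a \<le> 1 / (2 * (K + 1))" .
    then have "K * (b - a) \<le> K * (1 / (2 * (K + 1)))" using K(1) by (rule mult_left_mono)
    also have "\<dots> < 1" using K(1) by (simp add: field_simps)
    finally show "K * (b - a) < 1" .
  next
    fix p q assume "p \<in> {a..b}" "q \<in> {a..b}"
    then have pq: "p \<in> ?J" "q \<in> ?J" using sub by auto
    have "\<bar>warp (\<sigma> p) - warp (\<sigma> q)\<bar> \<le> K * \<bar>\<sigma> p - \<sigma> q\<bar>" by (rule K(2)[OF near[OF pq(1)] near[OF pq(2)]])
    also have "\<dots> \<le> K * \<bar>p - q\<bar>" by (rule mult_left_mono[OF \<epsilon>(3)[OF J\<epsilon>[OF pq(1)] J\<epsilon>[OF pq(2)]] K(1)])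
    finally show "\<bar>warp (\<sigma> p) - warp (\<sigma> q)\<bar> \<le> K * \<bar>p - q\<bar>" .
  qed
  have \<theta>t: "\<theta> s = \<theta> t" if "s \<in> {a..b}" for s using const[OF that] const[OF ab(4)] by simp
  have xt: "\<gamma> t \<in> hyperbolic_space - {0}" by (rule \<gamma>I[OF t])
  have n1: "norm (\<theta> t) = 1" using xt by (simp add: \<theta>_def norm_sgn)
  have "w = (w \<bullet> \<theta> t) *\<^sub>R \<theta> t"
  proof -
    \<comment> \<open>The projection onto the complement of \<open>\<theta> t\<close> kills the
      whole arc over \<open>[a, b]\<close>, hence also its velocity. Since \<open>t\<close> may be
      an endpoint, derivatives within the closed interval are compared.\<close>
    let ?P = "\<lambda>v. v - (v \<bullet> \<theta> t) *\<^sub>R \<theta> t"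
    have P: "bounded_linear ?P"
      by (intro bounded_linear_sub bounded_linear_ident bounded_linear_scaleR_const bounded_linear_inner_left)
    have "(\<gamma> has_vector_derivative w) (at t within {a..b})"
      by (rule has_vector_derivative_within_subset[OF d]) (use sub in blast)
    from bounded_linear.has_vector_derivative[OF P this]
    have "((\<lambda>s. ?P (\<gamma> s)) has_vector_derivative ?P w) (at t within {a..b})" .
    moreover have "((\<lambda>s. ?P (\<gamma> s)) has_vector_derivative 0) (at t within {a..b})"
    proof (rule has_vector_derivative_transform[OF ab(4) _ has_vector_derivative_const])
      fix s assume s: "s \<in> {a..b}"
      have "\<gamma> s = norm (\<gamma> s) *\<^sub>R \<theta> s" by (cases "\<gamma> s = 0") (auto simp: \<theta>_def sgn_div_norm)
      then have r: "\<gamma> s = norm (\<gamma> s) *\<^sub>R \<theta> t" unfolding \<theta>t[OF s] .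
      have "?P (k *\<^sub>R \<theta> t) = 0" for k using n1 by (simp add: dot_square_norm)
      from this[of "norm (\<gamma> s)"] show "?P (\<gamma> s) = 0" unfolding r[symmetric] .
    qed
    ultimately have "?P w = 0"
      by (intro vector_derivative_unique_within_closed_interval[OF ab(1)]) (use ab(4) in simp_all)
    then show ?thesis by simp
  qed
  then show ?thesis using directed_along_segment_radial[OF xt, of "w \<bullet> \<theta> t"] by (simp add: \<theta>_def)
qed

section \<open>Moving the point to the origin\<close>

text \<open>Involutive isometries suffice, since an inversion exchanges any given point with the origin.\<close>

definition hyperbolic_involution :: "('a::euclidean_space \<Rightarrow> 'a) \<Rightarrow> ('a \<Rightarrow> 'a \<Rightarrow> 'a) \<Rightarrow> bool" where
  "hyperbolic_involution T T' \<longleftrightarrow>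
     (\<exists>C. C-lipschitz_on hyperbolic_space T) \<and>
     (\<forall>x\<in>hyperbolic_space. T x \<in> hyperbolic_space) \<and>
     (\<forall>x\<in>hyperbolic_space. T (T x) = x) \<and>
     (\<forall>x\<in>hyperbolic_space. (T has_derivative T' x) (at x)) \<and>
     (\<forall>x\<in>hyperbolic_space. \<forall>v. hyperbolic_metric (T x) (T' x v) (T' x v) = hyperbolic_metric x v v)"

text \<open>For positive \<open>R\<close> the map is the inversion in the sphere about
  \<open>a\<close> with squared radius \<open>R\<close>.\<close>

lemma inversion_derivative:
  fixes a :: "'a::euclidean_space"
  assumes "x \<noteq> a"
  shows "((\<lambda>x. a + (R / (norm (x - a))\<^sup>2) *\<^sub>R (x - a)) has_derivative
    (\<lambda>v. (R / (norm (x - a))\<^sup>2) *\<^sub>R v - (2 * R * ((x - a) \<bullet> v) / (norm (x - a))^4) *\<^sub>R (x - a))) (at x)"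
proof -
  define S where "S = (norm (x - a))\<^sup>2"
  have S: "S \<noteq> 0" "(x - a) \<bullet> (x - a) = S" using assms by (simp_all add: S_def dot_square_norm)
  have dy: "((\<lambda>x. x - a) has_derivative (\<lambda>v. v)) (at x)"
    by (auto intro!: derivative_eq_intros)
  have dS: "((\<lambda>x. (x - a) \<bullet> (x - a)) has_derivative (\<lambda>v. (x - a) \<bullet> v + v \<bullet> (x - a))) (at x)"
    by (rule has_derivative_inner[OF dy dy])
  have "((\<lambda>s. R / s) has_real_derivative - (R / S\<^sup>2)) (at ((x - a) \<bullet> (x - a)))"
    unfolding S(2) using S(1) by (auto intro!: derivative_eq_intros simp: power2_eq_square)
  from has_derivative_scaleR[OF DERIV_compose_FDERIV[OF this dS] dy]
  have "((\<lambda>x. (R / ((x - a) \<bullet> (x - a))) *\<^sub>R (x - a)) has_derivative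
      (\<lambda>v. (R / S) *\<^sub>R v + (((x - a) \<bullet> v + v \<bullet> (x - a)) * - (R / S\<^sup>2)) *\<^sub>R (x - a))) (at x)"
    unfolding S(2) .
  moreover have "((x - a) \<bullet> v + v \<bullet> (x - a)) * - (R / S\<^sup>2) = - (2 * R * ((x - a) \<bullet> v) / S\<^sup>2)" for v
    by (simp add: inner_commute)
  ultimately have "((\<lambda>x. (R / (norm (x - a))\<^sup>2) *\<^sub>R (x - a)) has_derivative
      (\<lambda>v. (R / S) *\<^sub>R v - (2 * R * ((x - a) \<bullet> v) / S\<^sup>2) *\<^sub>R (x - a))) (at x)"
    by (simp only: dot_square_norm scaleR_minus_left diff_conv_add_uminus)
  from has_derivative_add[OF has_derivative_const[of a] this]
  show ?thesis by (simp add: S_def power_mult[symmetric])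
qed

text \<open>The derivative is \<open>R / (norm y)^2\<close> times the reflection in the hyperplane
  orthogonal to \<open>y\<close>, so inversions are conformal.\<close>

lemma inversion_derivative_norm:
  fixes y :: "'a::euclidean_space"
  assumes "y \<noteq> 0"
  shows "(norm ((R / (norm y)\<^sup>2) *\<^sub>R v - (2 * R * (y \<bullet> v) / (norm y)^4) *\<^sub>R y))\<^sup>2 = (R / (norm y)\<^sup>2 * norm v)\<^sup>2"
proof -
  define n where "n = norm y"
  have n: "n \<noteq> 0" "y \<bullet> y = n\<^sup>2" using assms by (auto simp: n_def dot_square_norm)
  have "(norm ((R / n\<^sup>2) *\<^sub>R v - (2 * R * (y \<bullet> v) / n^4) *\<^sub>R y))\<^sup>2
      = (R / n\<^sup>2)\<^sup>2 * (v \<bullet> v) - 2 * (R / n\<^sup>2) * (2 * R * (y \<bullet> v) / n^4) * (y \<bullet> v) + (2 * R * (y \<bullet> v) / n^4)\<^sup>2 * n\<^sup>2"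
  proof -
    have "(norm (c *\<^sub>R v - q *\<^sub>R y))\<^sup>2 = c\<^sup>2 * (v \<bullet> v) - 2 * c * q * (y \<bullet> v) + q\<^sup>2 * n\<^sup>2" for c q
      unfolding power2_norm_eq_inner n(2)[symmetric]
      by (simp add: inner_diff_left inner_diff_right inner_commute power2_eq_square algebra_simps)
    then show ?thesis .
  qed
  also have "\<dots> = (R / n\<^sup>2)\<^sup>2 * (v \<bullet> v)"
  proof -
    have "c - 2 * (R / m) * (2 * R * i / m\<^sup>2) * i + (2 * R * i / m\<^sup>2)\<^sup>2 * m = c" if "m \<noteq> 0" for c m i
      using that by (simp add: power2_eq_square)
    moreover have "n^4 = (n\<^sup>2)\<^sup>2" "n\<^sup>2 \<noteq> 0" using n(1) by simp_all
    ultimately show ?thesis by (simp only: not_False_eq_True)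
  qed
  finally show ?thesis unfolding n_def power_mult_distrib dot_square_norm .
qed

lemma hyperbolic_involution_exists:
  fixes p :: "'a::euclidean_space"
  assumes p: "p \<in> hyperbolic_space"
  obtains T T' where "hyperbolic_involution T T'" "T p = 0" "T 0 = p"
proof (cases "p = 0")
  case True
  have "hyperbolic_involution (\<lambda>x::'a. x) (\<lambda>x v. v)"
    unfolding hyperbolic_involution_def using lipschitz_on_id by (auto intro!: exI[of _ 1] has_derivative_ident)
  then show thesis using that[of "\<lambda>x. x" "\<lambda>x v. v"] True by simp
next
  case False
  define P where "P = norm p"
  have P: "0 < P" "P < 1" using p False by (auto simp: P_def hyperbolic_space_def)
  \<comment> \<open>The mirror image of \<open>p\<close> in the unit sphere. With
    \<open>R = (norm a)^2 - 1\<close> the sphere about \<open>a\<close> is orthogonal to the unit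
    sphere, so its inversion preserves the ball, and it exchanges \<open>p\<close> with the
    origin.\<close>
  define a where "a = (1 / P\<^sup>2) *\<^sub>R p"
  define R where "R = 1 / P\<^sup>2 - 1"
  have na: "norm a = 1 / P" using P by (simp add: a_def P_def[symmetric] power2_eq_square)
  have R: "0 < R" using P by (simp add: R_def power_less_one_iff)
  have aa: "a \<bullet> a = R + 1" using na P by (simp add: dot_square_norm R_def power_divide)
  define T where "T x = a + (R / (norm (x - a))\<^sup>2) *\<^sub>R (x - a)" for x
  define T' where "T' x v = (R / (norm (x - a))\<^sup>2) *\<^sub>R v - (2 * R * ((x - a) \<bullet> v) / (norm (x - a))^4) *\<^sub>R (x - a)" for x v
  \<comment> \<open>The distance from the centre of inversion to the ball. It bounds the derivative,
    making the inversion Lipschitz on the whole ball.\<close>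
  define \<delta> where "\<delta> = norm a - 1"
  have \<delta>: "0 < \<delta>" using na P by (simp add: \<delta>_def)
  have far: "\<delta> \<le> norm (x - a)" "x \<noteq> a" if "x \<in> hyperbolic_space" for x
  proof -
    have "norm a \<le> norm x + norm (x - a)" using norm_triangle_sub[of a x] by (simp add: norm_minus_commute)
    then show "\<delta> \<le> norm (x - a)" using that by (simp add: \<delta>_def hyperbolic_space_def)
    then show "x \<noteq> a" using \<delta> by auto
  qed
  have dT: "(T has_derivative T' x) (at x)" if "x \<in> hyperbolic_space" for x
    unfolding T_def [abs_def] T'_def by (rule inversion_derivative[OF far(2)[OF that]])
  have nT': "norm (T' x v) = R / (norm (x - a))\<^sup>2 * norm v" if "x \<in> hyperbolic_space" for x v
  proof -
    have "(norm (T' x v))\<^sup>2 = (R / (norm (x - a))\<^sup>2 * norm v)\<^sup>2"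
      unfolding T'_def using far(2)[OF that] by (intro inversion_derivative_norm) simp
    then show ?thesis using R by (simp add: power2_eq_iff_nonneg)
  qed
  \<comment> \<open>The factor is the conformal factor of the inversion. Its positivity gives
    invariance of the ball, and in the metric it cancels against the scaling of tangent
    vectors.\<close>
  have nT: "1 - (norm (T x))\<^sup>2 = R / (norm (x - a))\<^sup>2 * (1 - (norm x)\<^sup>2)" if "x \<in> hyperbolic_space" for x
  proof -
    define y where "y = x - a"
    define n where "n = norm y"
    have n: "n \<noteq> 0" "y \<bullet> y = n\<^sup>2" using far(2)[OF that] by (auto simp: n_def y_def dot_square_norm)
    have "(norm x)\<^sup>2 = n\<^sup>2 + 2 * (a \<bullet> y) + (R + 1)"
    proof -
      have "x = y + a" by (simp add: y_def)
      then show ?thesis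
        unfolding power2_norm_eq_inner using aa n(2) by (simp add: inner_add_left inner_add_right inner_commute)
    qed
    moreover have "(norm (T x))\<^sup>2 = (R + 1) + 2 * (R / n\<^sup>2) * (a \<bullet> y) + (R / n\<^sup>2)\<^sup>2 * n\<^sup>2"
      unfolding T_def y_def[symmetric] n_def[symmetric] power2_norm_eq_inner
      using aa n(2) by (simp add: inner_add_left inner_add_right inner_commute power2_eq_square)
    moreover have "1 - ((R + 1) + 2 * (R / m) * b + (R / m)\<^sup>2 * m) = R / m * (1 - (m + 2 * b + (R + 1)))"
      if "m \<noteq> 0" for m b
      using that by (simp add: field_simps power2_eq_square)
    ultimately show ?thesis unfolding y_def[symmetric] n_def[symmetric] using n(1) by simp
  qed
  have TU: "T x \<in> hyperbolic_space" if x: "x \<in> hyperbolic_space" for x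
  proof -
    have "0 < 1 - (norm x)\<^sup>2" using x norm_less_1_square[of x] by (simp add: hyperbolic_space_def)
    then have "0 < 1 - (norm (T x))\<^sup>2" unfolding nT[OF x] using R far(2)[OF x] by simp
    then show ?thesis by (simp add: hyperbolic_space_def power_less_one_iff)
  qed
  have TT: "T (T x) = x" if x: "x \<in> hyperbolic_space" for x
  proof -
    define n where "n = norm (x - a)"
    have n: "n \<noteq> 0" using far(2)[OF x] by (simp add: n_def)
    have d: "T x - a = (R / n\<^sup>2) *\<^sub>R (x - a)" by (simp add: T_def n_def)
    have "norm (T x - a) = R / n\<^sup>2 * n" unfolding d n_def using R by simp
    then have nd: "norm (T x - a) = R / n" using n by (simp add: power2_eq_square)
    have "T (T x) = a + (R / (R / n)\<^sup>2) *\<^sub>R ((R / n\<^sup>2) *\<^sub>R (x - a))"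
      unfolding T_def[of "T x"] nd by (simp only: d)
    also have "\<dots> = a + (R / (R / n)\<^sup>2 * (R / n\<^sup>2)) *\<^sub>R (x - a)" by simp
    also have "R / (R / n)\<^sup>2 * (R / n\<^sup>2) = 1" using R n by (simp add: power2_eq_square)
    finally show ?thesis by simp
  qed
  have Tp: "T p = 0"
  proof -
    have pa: "p = P\<^sup>2 *\<^sub>R a" using P by (simp add: a_def)
    have d: "p - a = (- (R * P\<^sup>2)) *\<^sub>R a" using P unfolding R_def by (subst pa) (simp add: algebra_simps)
    have "(norm (p - a))\<^sup>2 = (R * P\<^sup>2)\<^sup>2 * (1 / P)\<^sup>2" unfolding d using na by (simp add: power_mult_distrib power_divide)
    also have "\<dots> = (R * P)\<^sup>2" using P by (simp add: power2_eq_square)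
    finally have "T p = a + (R / (R * P)\<^sup>2 * (- (R * P\<^sup>2))) *\<^sub>R a" by (simp add: T_def d)
    also have "R / (R * P)\<^sup>2 * (- (R * P\<^sup>2)) = - 1" using R P by (simp add: power2_eq_square)
    finally show ?thesis by simp
  qed
  have lip: "(R / \<delta>\<^sup>2)-lipschitz_on hyperbolic_space T"
  proof (rule bounded_derivative_imp_lipschitz)
    show "(T has_derivative T' x) (at x within hyperbolic_space)" if "x \<in> hyperbolic_space" for x
      by (rule has_derivative_at_withinI[OF dT[OF that]])
    show "convex (hyperbolic_space :: 'a set)" by (simp add: hyperbolic_space_def)
    show "onorm (T' x) \<le> R / \<delta>\<^sup>2" if x: "x \<in> hyperbolic_space" for x
    proof (rule onorm_bound)
      show "norm (T' x v) \<le> R / \<delta>\<^sup>2 * norm v" for v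
        unfolding nT'[OF x] using R \<delta> far[OF x]
        by (intro mult_right_mono divide_left_mono power_mono) auto
    qed (use R in simp)
  qed (use R in simp)
  have met: "hyperbolic_metric (T x) (T' x v) (T' x v) = hyperbolic_metric x v v" if x: "x \<in> hyperbolic_space" for x v
  proof -
    define q where "q = R / (norm (x - a))\<^sup>2"
    have q: "q \<noteq> 0" using R far(2)[OF x] by (simp add: q_def)
    have "hyperbolic_metric (T x) (T' x v) (T' x v) = 4 * (q * norm v)\<^sup>2 / (q * (1 - (norm x)\<^sup>2))\<^sup>2"
      unfolding hyperbolic_metric_def dot_square_norm nT[OF x] nT'[OF x] q_def ..
    also have "\<dots> = 4 * (norm v)\<^sup>2 / (1 - (norm x)\<^sup>2)\<^sup>2" using q by (simp add: power_mult_distrib)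
    finally show ?thesis by (simp add: hyperbolic_metric_def dot_square_norm)
  qed
  have "hyperbolic_involution T T'"
    unfolding hyperbolic_involution_def
    by (intro conjI ballI allI exI[of _ "R / \<delta>\<^sup>2"] lip) (simp_all add: TU TT dT met)
  moreover have "T 0 = p" using TT[OF p] Tp by simp
  ultimately show thesis using that Tp by blast
qed

section \<open>Transport of curves, distances and geodesics by an involution\<close>

lemma hyperbolic_involutionD:
  assumes "hyperbolic_involution T T'"
  shows "x \<in> hyperbolic_space \<Longrightarrow> T x \<in> hyperbolic_space"
    "x \<in> hyperbolic_space \<Longrightarrow> T (T x) = x"
    "x \<in> hyperbolic_space \<Longrightarrow> (T has_derivative T' x) (at x)"
    "x \<in> hyperbolic_space \<Longrightarrow> hyperbolic_metric (T x) (T' x v) (T' x v) = hyperbolic_metric x v v"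
  using assms unfolding hyperbolic_involution_def by simp_all

lemma hyperbolic_involution_curve:
  assumes T: "hyperbolic_involution T T'" and c: "lipschitz_curve hyperbolic_space a b c"
  shows "lipschitz_curve hyperbolic_space a b (T \<circ> c)"
proof -
  obtain C where C: "C-lipschitz_on hyperbolic_space T" using T unfolding hyperbolic_involution_def by (elim conjE exE)
  have cU: "c ` {a..b} \<subseteq> hyperbolic_space" and lc: "lipschitz_ivl a b c"
    using c unfolding lipschitz_curve_iff by simp_all
  have "lipschitz_ivl a b (\<lambda>t. T (c t))"
    by (rule lipschitz_ivl_compose[OF lc lipschitz_on_subset[OF C cU]])
  moreover have "(T \<circ> c) ` {a..b} \<subseteq> hyperbolic_space"
    using hyperbolic_involutionD(1)[OF T] cU by (simp add: image_subset_iff)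
  ultimately show ?thesis by (simp add: lipschitz_curve_iff o_def)
qed

lemma hyperbolic_involution_punctured_curve:
  assumes T: "hyperbolic_involution T T'" and p: "p \<in> hyperbolic_space"
    and c: "lipschitz_curve (hyperbolic_space - {p}) a b c"
  shows "lipschitz_curve (hyperbolic_space - {T p}) a b (T \<circ> c)"
proof -
  have c': "lipschitz_curve hyperbolic_space a b c" using c unfolding lipschitz_curve_iff by blast
  have "T (c t) \<noteq> T p" if "t \<in> {a..b}" for t
  proof
    have ct: "c t \<in> hyperbolic_space" "c t \<noteq> p" using c that unfolding lipschitz_curve_iff by blast+
    assume "T (c t) = T p"
    then have "T (T (c t)) = T (T p)" by simp
    then show False using ct hyperbolic_involutionD(2)[OF T] p by simp
  qed
  then show ?thesis
    using hyperbolic_involution_curve[OF T c'] unfolding lipschitz_curve_iff by (simp add: image_subset_iff)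
qed

text \<open>The sets of lengths themselves coincide: mapping curves by \<open>T\<close> gives one
  inclusion, and the same inclusion at the image points gives the other, because \<open>T\<close> is
  its own inverse.\<close>

lemma hyperbolic_involution_riem_dist:
  fixes x y :: "'a::euclidean_space"
  assumes T: "hyperbolic_involution T T'" and x: "x \<in> hyperbolic_space" and y: "y \<in> hyperbolic_space"
  shows "riem_dist hyperbolic_space hyperbolic_metric (T x) (T y) = riem_dist hyperbolic_space hyperbolic_metric x y"
proof -
  let ?S = "\<lambda>x y::'a. {curve_length hyperbolic_metric 0 1 c |c. lipschitz_curve hyperbolic_space 0 1 c \<and> c 0 = x \<and> c 1 = y}"
  have sub: "?S x y \<subseteq> ?S (T x) (T y)" for x y
  proof
    fix l assume "l \<in> ?S x y"
    then obtain c where c: "l = curve_length hyperbolic_metric 0 1 c" "lipschitz_curve hyperbolic_space 0 1 c" "c 0 = x" "c 1 = y"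
      by blast
    have "curve_length hyperbolic_metric 0 1 (T \<circ> c) = l"
      unfolding c(1)
      by (rule curve_length_isometry[where T' = T', OF c(2)])
        (simp_all add: hyperbolic_involutionD(3,4)[OF T])
    then show "l \<in> ?S (T x) (T y)"
      using hyperbolic_involution_curve[OF T c(2)] c(3,4) by (intro CollectI exI[of _ "T \<circ> c"]) simp
  qed
  have "?S (T x) (T y) \<subseteq> ?S x y"
    using sub[of "T x" "T y"] unfolding hyperbolic_involutionD(2)[OF T x] hyperbolic_involutionD(2)[OF T y] .
  with sub have "?S (T x) (T y) = ?S x y" by (intro subset_antisym)
  then show ?thesis unfolding riem_dist_def by simp
qed

lemma hyperbolic_involution_riem_setdist:
  assumes T: "hyperbolic_involution T T'" and "x \<in> hyperbolic_space" "p \<in> hyperbolic_space"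
  shows "riem_setdist hyperbolic_space hyperbolic_metric (T x) {T p} = riem_setdist hyperbolic_space hyperbolic_metric x {p}"
  using hyperbolic_involution_riem_dist[OF assms] by (simp add: riem_setdist_def)

lemma hyperbolic_involution_log_condition:
  assumes T: "hyperbolic_involution T T'" and "x \<in> hyperbolic_space" "p \<in> hyperbolic_space"
  shows "log_condition hyperbolic_space hyperbolic_metric {T p} (T x) = log_condition hyperbolic_space hyperbolic_metric {p} x"
  using hyperbolic_involution_riem_setdist[OF assms] by (simp add: log_condition_def)

lemma hyperbolic_involution_condition_length:
  assumes T: "hyperbolic_involution T T'" and p: "p \<in> hyperbolic_space"
    and c: "lipschitz_curve (hyperbolic_space - {p}) a b c"
  shows "curve_length (condition_metric hyperbolic_space hyperbolic_metric {T p}) a b (T \<circ> c)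
    = curve_length (condition_metric hyperbolic_space hyperbolic_metric {p}) a b c"
proof (rule curve_length_isometry[OF c])
  fix x v assume "x \<in> hyperbolic_space - {p}"
  then have x: "x \<in> hyperbolic_space" by simp
  show "(T has_derivative T' x) (at x)" by (rule hyperbolic_involutionD(3)[OF T x])
  show "condition_metric hyperbolic_space hyperbolic_metric {T p} (T x) (T' x v) (T' x v)
      = condition_metric hyperbolic_space hyperbolic_metric {p} x v v"
    unfolding condition_metric_def hyperbolic_involution_riem_setdist[OF T x p] hyperbolic_involutionD(4)[OF T x] ..
qed

lemma hyperbolic_involution_minimizing:
  assumes T: "hyperbolic_involution T T'" and p: "p \<in> hyperbolic_space" and ab: "a \<le> b"
    and g: "minimizing_geodesic (hyperbolic_space - {p}) (condition_metric hyperbolic_space hyperbolic_metric {p}) a b \<gamma>"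
  shows "minimizing_geodesic (hyperbolic_space - {T p}) (condition_metric hyperbolic_space hyperbolic_metric {T p}) a b (T \<circ> \<gamma>)"
  unfolding minimizing_geodesic_def
proof (intro conjI allI impI)
  let ?g = "\<lambda>p. condition_metric hyperbolic_space hyperbolic_metric {p}"
  have lc: "lipschitz_curve (hyperbolic_space - {p}) a b \<gamma>"
    and arc: "\<And>s t. a \<le> s \<and> s \<le> t \<and> t \<le> b \<Longrightarrow> curve_length (?g p) s t \<gamma> = t - s"
    and min: "\<And>c. lipschitz_curve (hyperbolic_space - {p}) a b c \<and> c a = \<gamma> a \<and> c b = \<gamma> b \<Longrightarrow>
       curve_length (?g p) a b \<gamma> \<le> curve_length (?g p) a b c"
    using g unfolding minimizing_geodesic_def by simp_all
  show "lipschitz_curve (hyperbolic_space - {T p}) a b (T \<circ> \<gamma>)"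
    by (rule hyperbolic_involution_punctured_curve[OF T p lc])
  show "curve_length (?g (T p)) s t (T \<circ> \<gamma>) = t - s" if st: "a \<le> s \<and> s \<le> t \<and> t \<le> b" for s t
  proof -
    have "\<gamma> ` {s..t} \<subseteq> \<gamma> ` {a..b}" using st by (intro image_mono) auto
    moreover have "lipschitz_ivl s t \<gamma>"
      by (rule lipschitz_ivl_subset[of a b]) (use lc st in \<open>simp_all add: lipschitz_curve_iff\<close>)
    ultimately have "lipschitz_curve (hyperbolic_space - {p}) s t \<gamma>" using lc unfolding lipschitz_curve_iff by blast
    then show ?thesis using hyperbolic_involution_condition_length[OF T p] arc[OF st] by simp
  qed
  fix c assume c: "lipschitz_curve (hyperbolic_space - {T p}) a b c \<and> c a = (T \<circ> \<gamma>) a \<and> c b = (T \<circ> \<gamma>) b"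
  have Tp: "T p \<in> hyperbolic_space" "T (T p) = p" using hyperbolic_involutionD(1,2)[OF T p] .
  have lc': "lipschitz_curve (hyperbolic_space - {T p}) a b c" using c by simp
  have lTc: "lipschitz_curve (hyperbolic_space - {p}) a b (T \<circ> c)"
    using hyperbolic_involution_punctured_curve[OF T Tp(1) lc'] unfolding Tp(2) .
  have "\<gamma> a \<in> hyperbolic_space" "\<gamma> b \<in> hyperbolic_space"
    using lc ab unfolding lipschitz_curve_iff by (auto simp: image_subset_iff)
  then have "curve_length (?g p) a b \<gamma> \<le> curve_length (?g p) a b (T \<circ> c)"
    using c by (intro min conjI lTc) (simp_all add: hyperbolic_involutionD(2)[OF T])
  also have "\<dots> = curve_length (?g (T p)) a b c"
    using hyperbolic_involution_condition_length[OF T Tp(1) lc'] unfolding Tp(2) .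
  finally show "curve_length (?g (T p)) a b (T \<circ> \<gamma>) \<le> curve_length (?g (T p)) a b c"
    unfolding hyperbolic_involution_condition_length[OF T p lc] .
qed

lemma hyperbolic_involution_geodesic:
  assumes T: "hyperbolic_involution T T'" and p: "p \<in> hyperbolic_space"
    and g: "condition_geodesic hyperbolic_space hyperbolic_metric {p} I \<gamma>"
  shows "condition_geodesic hyperbolic_space hyperbolic_metric {T p} I (T \<circ> \<gamma>)"
  unfolding condition_geodesic_def geodesic_def
proof (intro conjI)
  show "is_interval I" using g unfolding condition_geodesic_def geodesic_def by (elim conjE)
  have \<gamma>I: "\<gamma> ` I \<subseteq> hyperbolic_space - {p}" using g unfolding condition_geodesic_def geodesic_def by (elim conjE)
  show "(T \<circ> \<gamma>) ` I \<subseteq> hyperbolic_space - {T p}"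
  proof
    fix z assume "z \<in> (T \<circ> \<gamma>) ` I"
    then obtain t where t: "t \<in> I" "z = T (\<gamma> t)" by auto
    then have "\<gamma> t \<in> hyperbolic_space" "\<gamma> t \<noteq> p" using \<gamma>I by blast+
    moreover from this have "T (\<gamma> t) \<noteq> T p" using hyperbolic_involutionD(2)[OF T] p by metis
    ultimately show "z \<in> hyperbolic_space - {T p}" using t hyperbolic_involutionD(1)[OF T] by simp
  qed
  show "\<forall>t\<in>I. \<exists>\<epsilon>>0. \<forall>a\<in>I \<inter> ball t \<epsilon>. \<forall>b\<in>I \<inter> ball t \<epsilon>. a < b \<longrightarrow>
     minimizing_geodesic (hyperbolic_space - {T p}) (condition_metric hyperbolic_space hyperbolic_metric {T p}) a b (T \<circ> \<gamma>)"
  proof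
    fix t assume t: "t \<in> I"
    have "\<forall>t\<in>I. \<exists>\<epsilon>>0. \<forall>a\<in>I \<inter> ball t \<epsilon>. \<forall>b\<in>I \<inter> ball t \<epsilon>. a < b \<longrightarrow>
      minimizing_geodesic (hyperbolic_space - {p}) (condition_metric hyperbolic_space hyperbolic_metric {p}) a b \<gamma>"
      using g unfolding condition_geodesic_def geodesic_def by (elim conjE)
    from bspec[OF this t] obtain \<epsilon> where \<epsilon>: "\<epsilon> > 0" "\<forall>a\<in>I \<inter> ball t \<epsilon>. \<forall>b\<in>I \<inter> ball t \<epsilon>. a < b \<longrightarrow>
      minimizing_geodesic (hyperbolic_space - {p}) (condition_metric hyperbolic_space hyperbolic_metric {p}) a b \<gamma>"
      by (elim exE conjE)
    show "\<exists>\<epsilon>>0. \<forall>a\<in>I \<inter> ball t \<epsilon>. \<forall>b\<in>I \<inter> ball t \<epsilon>. a < b \<longrightarrow>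
     minimizing_geodesic (hyperbolic_space - {T p}) (condition_metric hyperbolic_space hyperbolic_metric {T p}) a b (T \<circ> \<gamma>)"
    proof (intro exI[of _ \<epsilon>] conjI \<epsilon>(1) ballI impI)
      fix a b assume ab: "a \<in> I \<inter> ball t \<epsilon>" "b \<in> I \<inter> ball t \<epsilon>" "a < b"
      have "minimizing_geodesic (hyperbolic_space - {p}) (condition_metric hyperbolic_space hyperbolic_metric {p}) a b \<gamma>"
        using bspec[OF bspec[OF \<epsilon>(2) ab(1)] ab(2)] ab(3) by simp
      then show "minimizing_geodesic (hyperbolic_space - {T p}) (condition_metric hyperbolic_space hyperbolic_metric {T p}) a b (T \<circ> \<gamma>)"
        by (rule hyperbolic_involution_minimizing[OF T p less_imp_le[OF ab(3)]])
    qed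
  qed
qed

lemma hyperbolic_involution_directed:
  fixes x p :: "'a::euclidean_space"
  assumes T: "hyperbolic_involution T T'" and p: "p \<in> hyperbolic_space" and x: "x \<in> hyperbolic_space"
    and d: "directed_along_segment hyperbolic_space hyperbolic_metric (T p) (T x) (T' x v)"
  shows "directed_along_segment hyperbolic_space hyperbolic_metric p x v"
proof -
  obtain L c w k where c: "L > 0" "c ` {0..L} \<subseteq> hyperbolic_space" "c 0 = T x" "c L = T p"
    "\<forall>s\<in>{0..L}. \<forall>t\<in>{0..L}. riem_dist hyperbolic_space hyperbolic_metric (c s) (c t) = \<bar>s - t\<bar>"
    "(c has_vector_derivative w) (at 0 within {0..L})" "T' x v = k *\<^sub>R w"
    using d unfolding directed_along_segment_def by (elim exE conjE)
  have Tx: "T x \<in> hyperbolic_space" "T (T x) = x" using hyperbolic_involutionD(1,2)[OF T x] .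
  have cU: "c s \<in> hyperbolic_space" if "s \<in> {0..L}" for s using c(2) that by blast
  have dT: "(T has_derivative T' (T x)) (at (T x))" by (rule hyperbolic_involutionD(3)[OF T Tx(1)])
  have dc: "((T \<circ> c) has_vector_derivative T' (T x) w) (at 0 within {0..L})"
    by (rule vector_derivative_diff_chain_within[OF c(6)])
      (unfold c(3), rule has_derivative_at_withinI[OF dT])
  \<comment> \<open>Differentiating \<open>T (T y) = y\<close>; this is why the velocity can be
    pulled back.\<close>
  have inv: "T' (T x) (T' x v) = v"
  proof -
    have "((\<lambda>y. T (T y)) has_derivative (\<lambda>v. T' (T x) (T' x v))) (at x)"
      by (rule has_derivative_compose[OF hyperbolic_involutionD(3)[OF T x] dT])
    moreover have "((\<lambda>y. T (T y)) has_derivative (\<lambda>v. v)) (at x)"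
    proof (rule has_derivative_transform_within_open[OF has_derivative_ident])
      show "open (hyperbolic_space :: 'a set)" by (simp add: hyperbolic_space_def)
      show "y = T (T y)" if "y \<in> hyperbolic_space" for y using hyperbolic_involutionD(2)[OF T that] by simp
    qed (rule x)
    ultimately have "(\<lambda>v. T' (T x) (T' x v)) = (\<lambda>v. v)" by (rule has_derivative_unique)
    then show ?thesis by (rule fun_cong)
  qed
  show ?thesis
    unfolding directed_along_segment_def
  proof (intro exI conjI)
    show "(T \<circ> c) ` {0..L} \<subseteq> hyperbolic_space"
      using hyperbolic_involutionD(1)[OF T] cU by (simp add: image_subset_iff)
    show "(T \<circ> c) 0 = x" "(T \<circ> c) L = p"
      using Tx(2) hyperbolic_involutionD(2)[OF T p] c(3,4) by simp_all
    show "\<forall>s\<in>{0..L}. \<forall>t\<in>{0..L}. riem_dist hyperbolic_space hyperbolic_metric ((T \<circ> c) s) ((T \<circ> c) t) = \<bar>s - t\<bar>"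
    proof (intro ballI)
      fix s t assume st: "s \<in> {0..L}" "t \<in> {0..L}"
      show "riem_dist hyperbolic_space hyperbolic_metric ((T \<circ> c) s) ((T \<circ> c) t) = \<bar>s - t\<bar>"
        using hyperbolic_involution_riem_dist[OF T cU[OF st(1)] cU[OF st(2)]] c(5) st by simp
    qed
    have "linear (T' (T x))" by (rule has_derivative_linear[OF dT])
    then show "v = k *\<^sub>R T' (T x) w"
      using inv unfolding c(7) by (simp add: linear_scale)
  qed (rule c(1), rule dc)
qed

section \<open>A geodesic that is not radial\<close>

text \<open>The radial velocity of a unit-speed outward curve with angular velocity
  \<open>1 / warp\<close>: it solves \<open>\<sigma>'^2 + warp * (1 / warp)^2 = 1\<close>.\<close>

definition warp_slope :: "real \<Rightarrow> real" where
  "warp_slope s = sqrt (1 - 1 / warp s)"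

lemma warp_slope_bounds: "0 < warp_slope s" "warp_slope s \<le> 1" "(warp_slope s)\<^sup>2 = 1 - 1 / warp s"
proof -
  have "0 < 1 - 1 / warp s" "0 < 1 / warp s" using warp_gt_1[of s] by (simp_all add: field_simps)
  then show "0 < warp_slope s" "warp_slope s \<le> 1" "(warp_slope s)\<^sup>2 = 1 - 1 / warp s"
    by (simp_all add: warp_slope_def)
qed

lemma warp_slope_strict_mono: "x < y \<Longrightarrow> warp_slope x < warp_slope y"
proof -
  assume "x < y"
  then have "warp x < warp y" by (rule strict_monoD[OF strict_mono_warp])
  then have "1 / warp y < 1 / warp x" using warp_gt_1[of x] by (intro divide_strict_left_mono) auto
  then show ?thesis by (simp add: warp_slope_def)
qed

lemma continuous_on_warp_slope: "continuous_on S warp_slope"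
proof -
  have "warp x \<noteq> 0" for x using warp_gt_1[of x] by simp
  then show ?thesis unfolding warp_slope_def [abs_def] by (intro continuous_intros continuous_on_warp) simp
qed

text \<open>Separation of variables: \<sigma> is the inverse of a primitive \<open>F\<close> of
  \<open>1 / warp_slope\<close>. Since \<open>warp_slope\<close> is at most 1, \<open>F\<close>
  grows at least linearly, so it is onto and its inverse is 1-Lipschitz.\<close>

lemma warp_slope_flow:
  obtains \<sigma> where "\<And>t. (\<sigma> has_real_derivative warp_slope (\<sigma> t)) (at t)"
proof -
  have "warp_slope x \<noteq> 0" for x using warp_slope_bounds(1)[of x] by simp
  then have "continuous_on UNIV (\<lambda>s. 1 / warp_slope s)"
    by (intro continuous_intros continuous_on_warp_slope) simp
  then obtain F where F: "\<And>s. (F has_real_derivative 1 / warp_slope s) (at s)"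
    using continuous_antiderivative_UNIV by metis
  have F1: "1 \<le> 1 / warp_slope s" for s using warp_slope_bounds(1,2)[of s] by simp
  have grow: "y - x \<le> F y - F x" if xy: "x < y" for x y
  proof -
    obtain z where "F y - F x = (y - x) * (1 / warp_slope z)" using MVT2[OF xy F] by auto
    moreover have "(y - x) * 1 \<le> (y - x) * (1 / warp_slope z)" using xy by (intro mult_left_mono F1) simp
    ultimately show ?thesis by simp
  qed
  have Fc: "continuous_on S F" for S
    by (rule DERIV_continuous_on[OF has_field_derivative_at_within[OF F]])
  have surj: "\<exists>s. F s = y" for y
  proof -
    define r where "r = \<bar>y - F 0\<bar> + 1"
    have r: "0 < r" by (simp add: r_def)
    have "y \<le> F r" "F (- r) \<le> y" using grow[of 0 r] grow[of "- r" 0] r unfolding r_def by linarith+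
    then show ?thesis using IVT'[of F "- r" y r] Fc r by auto
  qed
  define \<sigma> where "\<sigma> y = (SOME s. F s = y)" for y
  have F\<sigma>: "F (\<sigma> y) = y" for y unfolding \<sigma>_def by (rule someI_ex[OF surj])
  have \<sigma>lip: "\<bar>\<sigma> x - \<sigma> y\<bar> \<le> \<bar>x - y\<bar>" for x y
    using grow[of "\<sigma> x" "\<sigma> y"] grow[of "\<sigma> y" "\<sigma> x"] unfolding F\<sigma>
    by (cases "\<sigma> x" "\<sigma> y" rule: linorder_cases) auto
  have \<sigma>c: "isCont \<sigma> y" for y
  proof -
    have "1-lipschitz_on UNIV \<sigma>" by (rule lipschitz_onI) (use \<sigma>lip in \<open>simp_all add: dist_real_def\<close>)
    then show ?thesis using lipschitz_on_continuous_on continuous_on_eq_continuous_at open_UNIV by blast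
  qed
  have "(\<sigma> has_real_derivative inverse (1 / warp_slope (\<sigma> y))) (at y)" for y
  proof (rule DERIV_inverse_function[where f = F and a = "y - 1" and b = "y + 1"])
    show "(F has_real_derivative 1 / warp_slope (\<sigma> y)) (at (\<sigma> y))" by (rule F)
  qed (use F\<sigma> \<sigma>c warp_slope_bounds(1)[of "\<sigma> y"] in simp_all)
  then show thesis by (intro that) simp
qed

text \<open>A primitive of this function is a global extension of \<open>arcsin\<close> from \<open>{-1/2..1/2}\<close> that does
  not increase the length of curves on the sphere.\<close>

definition clamped_arcsin_slope :: "real \<Rightarrow> real" where
  "clamped_arcsin_slope y = 1 / sqrt (1 - (max (- 1 / 2) (min (1 / 2) y))\<^sup>2)"

lemma clamped_square_le: "(max (- 1 / 2) (min (1 / 2) (y::real)))\<^sup>2 \<le> 1 / 4"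
proof -
  have "\<bar>max (- 1 / 2) (min (1 / 2) y)\<bar> \<le> 1 / 2" by (auto simp: max_def min_def abs_if)
  then have "\<bar>max (- 1 / 2) (min (1 / 2) y)\<bar>\<^sup>2 \<le> (1 / 2)\<^sup>2" by (rule power_mono) simp
  then show ?thesis by (simp add: power2_eq_square)
qed

lemma continuous_on_clamped_arcsin_slope: "continuous_on S clamped_arcsin_slope"
proof -
  have "sqrt (1 - (max (- 1 / 2) (min (1 / 2) (y::real)))\<^sup>2) \<noteq> 0" for y
    using clamped_square_le[of y] by simp
  then show ?thesis unfolding clamped_arcsin_slope_def [abs_def] by (intro continuous_intros) simp
qed

text \<open>Clamping moves \<open>y\<close> towards 0 and so can only lower the slope of
  \<open>arcsin\<close>. The second inequality says that composing the primitive with the height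
  over an equator does not stretch the sphere, even at the poles, where \<open>arcsin\<close> itself
  has infinite slope.\<close>

lemma clamped_arcsin_slope_le:
  assumes "\<bar>y\<bar> \<le> 1"
  shows "0 \<le> clamped_arcsin_slope y" "clamped_arcsin_slope y * sqrt (1 - y\<^sup>2) \<le> 1"
proof -
  let ?m = "max (- 1 / 2) (min (1 / 2) y)"
  have p: "0 < sqrt (1 - ?m\<^sup>2)" using clamped_square_le[of y] by simp
  then show "0 \<le> clamped_arcsin_slope y" by (simp add: clamped_arcsin_slope_def)
  have "\<bar>?m\<bar> \<le> \<bar>y\<bar>" by (auto simp: max_def min_def abs_if)
  then have "?m\<^sup>2 \<le> y\<^sup>2" by (simp add: abs_le_square_iff)
  then have "sqrt (1 - y\<^sup>2) \<le> sqrt (1 - ?m\<^sup>2)" by simp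
  then show "clamped_arcsin_slope y * sqrt (1 - y\<^sup>2) \<le> 1"
    using p by (simp add: clamped_arcsin_slope_def)
qed

text \<open>As \<open>sin \<alpha> \<le> \<alpha> \<le> 1 / 2\<close>, the clamp is inactive, and
  the non-stretching bound is attained with equality.\<close>

lemma clamped_arcsin_slope_sin:
  assumes "0 \<le> \<alpha>" "\<alpha> \<le> 1 / 2"
  shows "clamped_arcsin_slope (sin \<alpha>) * cos \<alpha> = 1"
proof -
  have "sin \<alpha> \<le> \<alpha>" using assms by (intro sin_x_le_x)
  moreover have "0 \<le> sin \<alpha>" using assms pi_gt3 by (intro sin_ge_zero) auto
  ultimately have "max (- 1 / 2) (min (1 / 2) (sin \<alpha>)) = sin \<alpha>" using assms by simp
  moreover have "0 < cos \<alpha>" using assms pi_gt3 by (intro cos_gt_zero_pi) auto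
  moreover from this have "sqrt (1 - (sin \<alpha>)\<^sup>2) = cos \<alpha>" by (intro real_sqrt_unique) (simp_all add: cos_squared_eq)
  ultimately show ?thesis by (simp add: clamped_arcsin_slope_def)
qed

text \<open>The calibration inequality: the field with components \<open>warp_slope\<close> along \<open>\<tau>\<close> and \<open>1\<close> along
  the angle is the gradient of a function and has length \<open>1\<close> in the warped metric.\<close>

lemma warp_length_calibration:
  fixes \<phi> :: "real \<Rightarrow> 'a::euclidean_space"
  assumes w: "warp_curve a b \<tau> \<phi>" and ab: "a \<le> b" and e: "norm e = 1"
    and G: "\<And>s. (G has_real_derivative warp_slope s) (at s)"
    and \<Psi>: "\<And>y. (\<Psi> has_real_derivative clamped_arcsin_slope y) (at y)"
  shows "(G (\<tau> b) + \<Psi> (\<phi> b \<bullet> e)) - (G (\<tau> a) + \<Psi> (\<phi> a \<bullet> e)) \<le> warp_length a b \<tau> \<phi>"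
proof -
  have ls: "lipschitz_ivl a b \<tau>" and lt: "lipschitz_ivl a b \<phi>" and n1: "\<And>t. t \<in> {a..b} \<Longrightarrow> norm (\<phi> t) = 1"
    using w unfolding warp_curve_def by simp_all
  have lG: "lipschitz_ivl a b (\<lambda>t. G (\<tau> t))"
    by (rule lipschitz_ivl_compose_C1[OF ls G continuous_on_warp_slope])
  have le: "lipschitz_ivl a b (\<lambda>t. \<phi> t \<bullet> e)"
    using lt e lipschitz_on_inner_right[of _ _ \<phi> e] unfolding lipschitz_ivl_def by (elim exE) (simp, blast)
  have l\<Psi>: "lipschitz_ivl a b (\<lambda>t. \<Psi> (\<phi> t \<bullet> e))"
    by (rule lipschitz_ivl_compose_C1[OF le \<Psi> continuous_on_clamped_arcsin_slope])
  let ?\<Phi> = "\<lambda>t. G (\<tau> t) + \<Psi> (\<phi> t \<bullet> e)"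
  have f: "((\<lambda>t. vector_derivative ?\<Phi> (at t)) has_integral ?\<Phi> b - ?\<Phi> a) {a..b}"
    by (rule lipschitz_ivl_fundamental_theorem[OF lipschitz_ivl_add[OF lG l\<Psi>] ab])
  obtain N1 where N1: "negligible N1" "\<And>t. t \<in> {a..b} - N1 \<Longrightarrow> a < t \<and> t < b"
    "\<And>t. t \<in> {a..b} - N1 \<Longrightarrow> (\<tau> has_vector_derivative vector_derivative \<tau> (at t)) (at t)"
    using lipschitz_ivl_ae_differentiable[OF ls] by metis
  obtain N2 where N2: "negligible N2" 
    "\<And>t. t \<in> {a..b} - N2 \<Longrightarrow> (\<phi> has_vector_derivative vector_derivative \<phi> (at t)) (at t)"
    using lipschitz_ivl_ae_differentiable[OF lt] by metis
  have pw: "vector_derivative ?\<Phi> (at t) \<le> sqrt ((vector_derivative \<tau> (at t))\<^sup>2 + warp (\<tau> t) * (norm (vector_derivative \<phi> (at t)))\<^sup>2)"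
    if t: "t \<in> {a..b} - (N1 \<union> N2)" for t
  proof -
    define \<tau>' where "\<tau>' = vector_derivative \<tau> (at t)"
    define \<phi>' where "\<phi>' = vector_derivative \<phi> (at t)"
    have d\<tau>: "(\<tau> has_real_derivative \<tau>') (at t)" and d\<phi>: "(\<phi> has_vector_derivative \<phi>') (at t)" and tab: "a < t" "t < b"
      using N1(2,3)[of t] N2(2)[of t] t by (simp_all add: \<tau>'_def \<phi>'_def has_real_derivative_iff_has_vector_derivative)
    define y where "y = \<phi> t \<bullet> e"
    have d\<phi>e: "((\<lambda>t. \<phi> t \<bullet> e) has_real_derivative \<phi>' \<bullet> e) (at t)"
      unfolding has_real_derivative_iff_has_vector_derivative
      by (rule bounded_linear.has_vector_derivative[OF bounded_linear_inner_left d\<phi>])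
    have "(?\<Phi> has_real_derivative warp_slope (\<tau> t) * \<tau>' + clamped_arcsin_slope y * (\<phi>' \<bullet> e)) (at t)"
      unfolding y_def by (intro DERIV_add DERIV_chain2[OF G d\<tau>] DERIV_chain2[OF \<Psi> d\<phi>e])
    then have vd: "vector_derivative ?\<Phi> (at t) = warp_slope (\<tau> t) * \<tau>' + clamped_arcsin_slope y * (\<phi>' \<bullet> e)"
      by (simp add: has_real_derivative_iff_has_vector_derivative vector_derivative_at)
    have nt: "norm (\<phi> t) = 1" by (rule n1) (use tab in simp)
    have y1: "\<bar>y\<bar> \<le> 1" using Cauchy_Schwarz_ineq2[of "\<phi> t" e] nt e by (simp add: y_def)
    have orth: "\<phi> t \<bullet> \<phi>' = 0" by (rule unit_curve_orthogonal[OF n1 tab d\<phi>])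
    \<comment> \<open>Only the part of \<open>e\<close> tangent to the sphere at
      \<open>\<phi> t\<close> counts, and its length is \<open>sqrt (1 - y^2)\<close>.\<close>
    have "\<phi>' \<bullet> e \<le> norm \<phi>' * sqrt (1 - y\<^sup>2)"
    proof -
      have "\<phi>' \<bullet> e = \<phi>' \<bullet> (e - y *\<^sub>R \<phi> t)" using orth by (simp add: inner_diff_right inner_commute)
      also have "\<dots> \<le> norm \<phi>' * norm (e - y *\<^sub>R \<phi> t)" by (rule norm_cauchy_schwarz)
      also have "norm (e - y *\<^sub>R \<phi> t) = sqrt (1 - y\<^sup>2)"
      proof -
        have "e \<bullet> e = 1" "\<phi> t \<bullet> \<phi> t = 1" "e \<bullet> \<phi> t = y" "\<phi> t \<bullet> e = y"
          using e nt by (simp_all add: dot_square_norm y_def inner_commute)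
        then have "(e - y *\<^sub>R \<phi> t) \<bullet> (e - y *\<^sub>R \<phi> t) = 1 - y\<^sup>2"
          by (simp add: inner_diff_left inner_diff_right power2_eq_square)
        then show ?thesis unfolding norm_eq_sqrt_inner by simp
      qed
      finally show ?thesis .
    qed
    then have "clamped_arcsin_slope y * (\<phi>' \<bullet> e) \<le> clamped_arcsin_slope y * (norm \<phi>' * sqrt (1 - y\<^sup>2))"
      by (rule mult_left_mono[OF _ clamped_arcsin_slope_le(1)[OF y1]])
    also have "\<dots> = (clamped_arcsin_slope y * sqrt (1 - y\<^sup>2)) * norm \<phi>'" by simp
    also have "\<dots> \<le> 1 * norm \<phi>'" by (rule mult_right_mono[OF clamped_arcsin_slope_le(2)[OF y1]]) simp
    finally have 1: "vector_derivative ?\<Phi> (at t) \<le> warp_slope (\<tau> t) * \<tau>' + norm \<phi>'" unfolding vd by simp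
    define k where "k = warp (\<tau> t)"
    define s where "s = warp_slope (\<tau> t)"
    have k: "1 < k" "s\<^sup>2 = 1 - 1 / k" using warp_gt_1 warp_slope_bounds(3) by (simp_all add: k_def s_def)
    \<comment> \<open>Cauchy-Schwarz in the warped metric, where the covector with components
      \<open>s\<close> and 1 has squared length \<open>s^2 + 1 / k = 1\<close>; the defect is
      written as a square.\<close>
    have "(s * \<tau>' + norm \<phi>')\<^sup>2 \<le> \<tau>'\<^sup>2 + k * (norm \<phi>')\<^sup>2"
    proof -
      have "\<tau>'\<^sup>2 + k * (norm \<phi>')\<^sup>2 - (s * \<tau>' + norm \<phi>')\<^sup>2 = (1 - s\<^sup>2) * \<tau>'\<^sup>2 - 2 * s * \<tau>' * norm \<phi>' + (k - 1) * (norm \<phi>')\<^sup>2"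
        by (simp add: power2_eq_square algebra_simps)
      also have "k - 1 = k * s\<^sup>2" unfolding k(2) using k(1) by (simp add: algebra_simps)
      also have "1 - s\<^sup>2 = 1 / k" unfolding k(2) by simp
      also have "1 / k * \<tau>'\<^sup>2 - 2 * s * \<tau>' * norm \<phi>' + k * s\<^sup>2 * (norm \<phi>')\<^sup>2 = (\<tau>' - k * s * norm \<phi>')\<^sup>2 / k"
        using k(1) by (simp add: power2_eq_square field_simps)
      also have "\<dots> \<ge> 0" using k(1) by simp
      finally show ?thesis by simp
    qed
    then have "s * \<tau>' + norm \<phi>' \<le> sqrt (\<tau>'\<^sup>2 + k * (norm \<phi>')\<^sup>2)" by (rule real_le_rsqrt)
    with 1 show ?thesis by (simp add: k_def s_def \<tau>'_def \<phi>'_def)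
  qed
  show ?thesis
    unfolding warp_length_def integral_unique[OF f, symmetric]
    by (rule integral_le_ae[OF has_integral_integrable[OF f] warp_curve_integrable(1)[OF w] negligible_Un[OF N1(1) N2(1)] pw])
qed

text \<open>Two orthonormal vectors span a plane in which the direction can turn. Along the
  constructed curve the calibration is an equality, so the curve minimizes on every
  subinterval.\<close>

lemma nonradial_condition_geodesic_exists:
  assumes dim: "2 \<le> DIM('a::euclidean_space)"
  obtains \<gamma> :: "real \<Rightarrow> 'a::euclidean_space" where "condition_geodesic hyperbolic_space hyperbolic_metric {0} {0..1/2} \<gamma>"
    "\<not> convex_on {0..1/2} (\<lambda>t. - ln (hyp_radius (\<gamma> t)))"
proof -
  obtain B :: "'a set" where B: "B \<subseteq> Basis" "card B = 2" using obtain_subset_with_card_n[OF dim] by metis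
  obtain e1 e2 where "B = {e1, e2}" "e1 \<noteq> e2" using B(2) unfolding card_2_iff by (elim exE conjE)
  then have e: "e1 \<in> Basis" "e2 \<in> Basis" "e1 \<noteq> e2" using B(1) by simp_all
  have e1: "e1 \<bullet> e1 = 1" and e2: "e2 \<bullet> e2 = 1" "norm e2 = 1" and e12: "e1 \<bullet> e2 = 0"
    using e by (simp_all add: inner_Basis)
  obtain \<sigma> where \<sigma>: "\<And>t. (\<sigma> has_real_derivative warp_slope (\<sigma> t)) (at t)" 
    by (rule warp_slope_flow, rule that)
  have \<sigma>c: "continuous_on UNIV \<sigma>" by (rule DERIV_continuous_on[OF has_field_derivative_at_within[OF \<sigma>]])
  have \<sigma>'c: "continuous_on UNIV (\<lambda>t. warp_slope (\<sigma> t))"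
    by (rule continuous_on_compose2[OF continuous_on_warp_slope \<sigma>c subset_UNIV])
  have wne: "warp (\<sigma> t) \<noteq> 0" for t using warp_gt_1[of "\<sigma> t"] by simp
  have kc: "continuous_on UNIV (\<lambda>t. 1 / warp (\<sigma> t))"
    by (intro continuous_intros continuous_on_compose2[OF continuous_on_warp(1)[of UNIV] \<sigma>c]) (simp_all add: wne)
  obtain A0 where A0: "\<And>t. (A0 has_real_derivative 1 / warp (\<sigma> t)) (at t)"
    using continuous_antiderivative_UNIV[OF kc] by metis
  \<comment> \<open>Normalizing the angle to start at 0 keeps it in the range where the clamped
    \<open>arcsin\<close> is exact.\<close>
  define A where "A t = A0 t - A0 0" for t
  have A: "(A has_real_derivative 1 / warp (\<sigma> t)) (at t)" for t
    unfolding A_def [abs_def] using DERIV_diff[OF A0 DERIV_const[of "A0 0"]] by simp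
  \<comment> \<open>The angular velocity is at most 1, so the angle is at most \<open>t\<close>;
    this is the reason for the parameter interval \<open>{0..1/2}\<close>.\<close>
  have Ab: "0 \<le> A t \<and> A t \<le> 1 / 2" if t: "t \<in> {0..1/2}" for t
  proof (cases "t = 0")
    case False
    then have t0: "0 < t" using t by simp
    obtain z where z: "A t - A 0 = (t - 0) * (1 / warp (\<sigma> z))" using MVT2[OF t0 A] by auto
    have "0 < 1 / warp (\<sigma> z)" "1 / warp (\<sigma> z) \<le> 1" using warp_gt_1[of "\<sigma> z"] by simp_all
    then have b: "0 \<le> t * (1 / warp (\<sigma> z))" "t * (1 / warp (\<sigma> z)) \<le> t"
      using t0 mult_left_mono[of "1 / warp (\<sigma> z)" 1 t] by simp_all
    have "A t = t * (1 / warp (\<sigma> z))" using z by (simp add: A_def)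
    then show ?thesis using b(1) order_trans[OF b(2), of "1 / 2"] t by simp
  qed (simp add: A_def)
  define \<theta> where "\<theta> t = cos (A t) *\<^sub>R e1 + sin (A t) *\<^sub>R e2" for t
  have d\<theta>: "(\<theta> has_vector_derivative (- sin (A t) * (1 / warp (\<sigma> t))) *\<^sub>R e1 + (cos (A t) * (1 / warp (\<sigma> t))) *\<^sub>R e2) (at t)" for t
  proof -
    have "((\<lambda>t. cos (A t)) has_real_derivative - sin (A t) * (1 / warp (\<sigma> t))) (at t)"
      "((\<lambda>t. sin (A t)) has_real_derivative cos (A t) * (1 / warp (\<sigma> t))) (at t)"
      by (rule DERIV_chain2[OF DERIV_cos A], rule DERIV_chain2[OF DERIV_sin A])
    from has_vector_derivative_add[OF has_vector_derivative_scaleR[OF this(1) has_vector_derivative_const[of e1]]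
       has_vector_derivative_scaleR[OF this(2) has_vector_derivative_const[of e2]]]
    show ?thesis unfolding \<theta>_def by simp
  qed
  have sc: "(cos x)\<^sup>2 + (sin x)\<^sup>2 = 1" for x :: real by (simp add: add.commute)
  have nsq: "(norm (x *\<^sub>R e1 + y *\<^sub>R e2))\<^sup>2 = x\<^sup>2 + y\<^sup>2" for x y
    unfolding power2_norm_eq_inner using e1 e2 e12
    by (simp add: inner_add_left inner_add_right inner_commute[of e2 e1] power2_eq_square)
  have n\<theta>: "norm (\<theta> t) = 1" for t
  proof -
    have "(norm (\<theta> t))\<^sup>2 = 1" unfolding \<theta>_def nsq by (rule sc)
    then have "norm (\<theta> t) = 1 \<or> norm (\<theta> t) = - 1" by (simp only: power2_eq_1_iff)
    then show ?thesis using norm_ge_zero[of "\<theta> t"] by linarith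
  qed
  have \<theta>e: "\<theta> t \<bullet> e2 = sin (A t)" for t using e12 e2 by (simp add: \<theta>_def inner_add_left)
  have n\<theta>': "(norm (vector_derivative \<theta> (at t)))\<^sup>2 = (1 / warp (\<sigma> t))\<^sup>2" for t
    unfolding vector_derivative_at[OF d\<theta>] nsq power_mult_distrib power2_minus
    by (simp only: distrib_right[symmetric] sin_cos_squared_add mult_1)
  have lA: "lipschitz_ivl a b A" for a b by (rule lipschitz_ivl_C1[OF A kc])
  have l\<theta>: "lipschitz_ivl a b \<theta>" for a b
    unfolding \<theta>_def
    by (intro lipschitz_ivl_add lipschitz_ivl_scaleR lipschitz_ivl_const
        lipschitz_ivl_compose_C1[OF lA DERIV_cos] lipschitz_ivl_compose_C1[OF lA DERIV_sin] continuous_intros)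
  have w: "warp_curve a b \<sigma> \<theta>" for a b
    unfolding warp_curve_def using lipschitz_ivl_C1[OF \<sigma> \<sigma>'c] l\<theta> n\<theta> by simp
  have len: "warp_length a b \<sigma> \<theta> = b - a" if "a \<le> b" for a b
  proof -
    have sp: "(vector_derivative \<sigma> (at t))\<^sup>2 + warp (\<sigma> t) * (norm (vector_derivative \<theta> (at t)))\<^sup>2 = 1" for t
    proof -
      have "vector_derivative \<sigma> (at t) = warp_slope (\<sigma> t)"
        by (rule vector_derivative_at[OF \<sigma>[unfolded has_real_derivative_iff_has_vector_derivative]])
      then have "(vector_derivative \<sigma> (at t))\<^sup>2 = 1 - 1 / warp (\<sigma> t)" by (simp add: warp_slope_bounds(3))
      then show ?thesis unfolding n\<theta>' using wne[of t] by (simp add: power2_eq_square)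
    qed
    show ?thesis unfolding warp_length_def sp using that by simp
  qed
  define \<gamma> where "\<gamma> t = polar_chart (\<sigma> t) (\<theta> t)" for t
  have \<gamma>in: "\<gamma> t \<in> hyperbolic_space - {0}" and \<gamma>r: "ln (hyp_radius (\<gamma> t)) = \<sigma> t" and \<gamma>s: "sgn (\<gamma> t) = \<theta> t" for t
    unfolding \<gamma>_def using polar_chart_in[OF n\<theta>[of t], of "\<sigma> t"] by simp_all
  obtain G where G: "\<And>s. (G has_real_derivative warp_slope s) (at s)"
    using continuous_antiderivative_UNIV[OF continuous_on_warp_slope] by metis
  obtain \<Psi> where \<Psi>: "\<And>s. (\<Psi> has_real_derivative clamped_arcsin_slope s) (at s)"
    using continuous_antiderivative_UNIV[OF continuous_on_clamped_arcsin_slope] by metis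
  \<comment> \<open>The potential grows at unit rate: the radial part contributes
    \<open>1 - 1 / warp\<close> and the angular part \<open>1 / warp\<close>.\<close>
  have pot: "(G (\<sigma> b) + \<Psi> (\<theta> b \<bullet> e2)) - (G (\<sigma> a) + \<Psi> (\<theta> a \<bullet> e2)) = b - a"
    if ab: "a < b" "{a..b} \<subseteq> {0..1/2}" for a b
  proof -
    have d: "((\<lambda>t. G (\<sigma> t) + \<Psi> (sin (A t))) has_real_derivative 1) (at t)" if t: "t \<in> {0..1/2}" for t
    proof -
      have "((\<lambda>t. G (\<sigma> t) + \<Psi> (sin (A t))) has_real_derivative warp_slope (\<sigma> t) * warp_slope (\<sigma> t)
          + clamped_arcsin_slope (sin (A t)) * (cos (A t) * (1 / warp (\<sigma> t)))) (at t)"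
        by (intro DERIV_add DERIV_chain2[OF G \<sigma>] DERIV_chain2[OF \<Psi> DERIV_chain2[OF DERIV_sin A]])
      moreover have "warp_slope (\<sigma> t) * warp_slope (\<sigma> t) = 1 - 1 / warp (\<sigma> t)"
        using warp_slope_bounds(3)[of "\<sigma> t"] by (simp add: power2_eq_square)
      moreover have "clamped_arcsin_slope (sin (A t)) * (cos (A t) * (1 / warp (\<sigma> t))) = 1 / warp (\<sigma> t)"
        using clamped_arcsin_slope_sin[of "A t"] Ab[OF t] by (simp add: mult.assoc[symmetric])
      ultimately show ?thesis using wne[of t] by simp
    qed
    have "\<exists>z>a. z < b \<and> (G (\<sigma> b) + \<Psi> (sin (A b))) - (G (\<sigma> a) + \<Psi> (sin (A a))) = (b - a) * 1"
      by (rule MVT2[OF ab(1), where f = "\<lambda>t. G (\<sigma> t) + \<Psi> (sin (A t))" and f' = "\<lambda>_. 1"])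
        (rule d, rule subsetD[OF ab(2)], simp)
    then show ?thesis unfolding \<theta>e by auto
  qed
  have mini: "minimizing_geodesic (hyperbolic_space - {0}) condition_metric_0 a b \<gamma>"
    if ab: "a < b" "{a..b} \<subseteq> {0..1/2}" for a b
    unfolding minimizing_geodesic_def
  proof (intro conjI allI impI)
    show "lipschitz_curve (hyperbolic_space - {0}) a b \<gamma>"
      unfolding \<gamma>_def by (rule polar_chart_curve(1)[OF w])
    show arc: "curve_length condition_metric_0 s t \<gamma> = t - s" if "a \<le> s \<and> s \<le> t \<and> t \<le> b" for s t
      unfolding \<gamma>_def polar_chart_curve(2)[OF w] by (rule len) (use that in simp)
    fix c assume c: "lipschitz_curve (hyperbolic_space - {0}) a b c \<and> c a = \<gamma> a \<and> c b = \<gamma> b"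
    then have lc: "lipschitz_curve (hyperbolic_space - {0}) a b c" by simp
    have "curve_length condition_metric_0 a b \<gamma> = b - a" by (rule arc) (use ab in simp)
    also have "\<dots> = (G (ln (hyp_radius (c b))) + \<Psi> (sgn (c b) \<bullet> e2)) - (G (ln (hyp_radius (c a))) + \<Psi> (sgn (c a) \<bullet> e2))"
      using c pot[OF ab] by (simp add: \<gamma>r \<gamma>s)
    also have "\<dots> \<le> warp_length a b (\<lambda>t. ln (hyp_radius (c t))) (\<lambda>t. sgn (c t))"
      by (rule warp_length_calibration[OF polar_coordinates_curve(1)[OF lc] less_imp_le[OF ab(1)] e2(2) G \<Psi>])
    also have "\<dots> = curve_length condition_metric_0 a b c" by (rule polar_coordinates_curve(2)[OF lc, symmetric])
    finally show "curve_length condition_metric_0 a b \<gamma> \<le> curve_length condition_metric_0 a b c" .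
  qed
  show thesis
  proof (rule that)
    show "condition_geodesic hyperbolic_space hyperbolic_metric {0} {0..1/2} \<gamma>"
      unfolding condition_geodesic_def geodesic_def
    proof (intro conjI ballI exI[of _ 1] impI)
      show "is_interval {0..1/2::real}" by (rule is_interval_cc)
      show "\<gamma> ` {0..1/2} \<subseteq> hyperbolic_space - {0}" by (rule image_subsetI) (rule \<gamma>in)
      fix t a b :: real assume "a \<in> {0..1/2} \<inter> ball t 1" "b \<in> {0..1/2} \<inter> ball t 1" "a < b"
      then show "minimizing_geodesic (hyperbolic_space - {0}) condition_metric_0 a b \<gamma>" by (intro mini) auto
    qed simp
    show "\<not> convex_on {0..1/2} (\<lambda>t. - ln (hyp_radius (\<gamma> t)))"
    proof
      assume cv: "convex_on {0..1/2} (\<lambda>t. - ln (hyp_radius (\<gamma> t)))"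
      \<comment> \<open>Midpoint convexity at 0, 1/4 and 1/2. It contradicts the mean slopes of
        \<sigma> on the two halves, which increase because \<sigma> and \<open>warp_slope\<close>
        do.\<close>
      have "- \<sigma> ((1 - 1/2) *\<^sub>R 0 + (1/2) *\<^sub>R (1/2)) \<le> (1 - 1/2) * - \<sigma> 0 + (1/2) * - \<sigma> (1/2)"
        using convex_onD[OF cv, of "1/2" 0 "1/2"] by (simp add: \<gamma>r)
      then have mid: "\<sigma> (1/2) - \<sigma> (1/4) \<le> \<sigma> (1/4) - \<sigma> 0" by simp
      obtain x where x: "0 < x" "x < 1/4" "\<sigma> (1/4) - \<sigma> 0 = (1/4 - 0) * warp_slope (\<sigma> x)"
        using MVT2[of 0 "1/4" \<sigma>, OF _ \<sigma>] by auto
      obtain y where y: "1/4 < y" "y < 1/2" "\<sigma> (1/2) - \<sigma> (1/4) = (1/2 - 1/4) * warp_slope (\<sigma> y)"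
        using MVT2[of "1/4" "1/2" \<sigma>, OF _ \<sigma>] by auto
      have "x < y" using x y by simp
      then have "\<sigma> x < \<sigma> y"
        by (rule DERIV_pos_imp_increasing) (use \<sigma> warp_slope_bounds(1) in metis)
      then have "warp_slope (\<sigma> x) < warp_slope (\<sigma> y)" by (rule warp_slope_strict_mono)
      then show False using mid x(3) y(3) by simp
    qed
  qed
qed

text \<open>The failure of self-convexity is asserted from dimension 2 on: in dimension 1 every
  geodesic runs along a ray, where the logarithm is affine and hence convex.\<close>

theorem theorem1p3:
  fixes p :: "'a::euclidean_space"
  assumes "p \<in> hyperbolic_space"
  shows "(\<forall>I \<gamma>. condition_geodesic hyperbolic_space hyperbolic_metric {p} I \<gamma> \<longrightarrow>
            concave_on I (\<lambda>t. log_condition hyperbolic_space hyperbolic_metric {p} (\<gamma> t)) \<and>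
            (\<forall>t\<in>I. \<forall>v. (\<gamma> has_vector_derivative v) (at t within I) \<and>
               \<not> directed_along_segment hyperbolic_space hyperbolic_metric p (\<gamma> t) v \<longrightarrow>
               strictly_concave_at I
                 (\<lambda>t. log_condition hyperbolic_space hyperbolic_metric {p} (\<gamma> t)) t)) \<and>
         (2 \<le> DIM('a) \<longrightarrow>
            \<not> self_convexity hyperbolic_space (hyperbolic_metric :: 'a metric_field) {p})"
proof -
  let ?lc = "\<lambda>q. log_condition hyperbolic_space hyperbolic_metric {q}"
  obtain T T' where T: "hyperbolic_involution T T'" and Tp: "T p = 0" "T 0 = p"
    by (rule hyperbolic_involution_exists[OF assms], rule that)
  have 0: "(0::'a) \<in> hyperbolic_space" by (simp add: hyperbolic_space_def)
  \<comment> \<open>The involution reduces the first two claims to the origin; the counterexample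
    later travels the opposite way by the same map.\<close>
  have transfer: "condition_geodesic hyperbolic_space hyperbolic_metric {0} I (T \<circ> \<gamma>)"
    "\<And>t. t \<in> I \<Longrightarrow> \<gamma> t \<in> hyperbolic_space \<and> ?lc p (\<gamma> t) = - ln (hyp_radius ((T \<circ> \<gamma>) t))"
    if g: "condition_geodesic hyperbolic_space hyperbolic_metric {p} I \<gamma>" for I \<gamma>
  proof -
    show g0: "condition_geodesic hyperbolic_space hyperbolic_metric {0} I (T \<circ> \<gamma>)"
      using hyperbolic_involution_geodesic[OF T assms g] unfolding Tp .
    fix t assume t: "t \<in> I"
    have "(T \<circ> \<gamma>) ` I \<subseteq> hyperbolic_space - {0}" "\<gamma> ` I \<subseteq> hyperbolic_space - {p}"
      using g0 g unfolding condition_geodesic_def geodesic_def by simp_all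
    then have "T (\<gamma> t) \<in> hyperbolic_space - {0}" "\<gamma> t \<in> hyperbolic_space" using t by auto
    then show "\<gamma> t \<in> hyperbolic_space \<and> ?lc p (\<gamma> t) = - ln (hyp_radius ((T \<circ> \<gamma>) t))"
      using hyperbolic_involution_log_condition[OF T _ assms, of "\<gamma> t"] log_condition_0[of "T (\<gamma> t)"]
      by (simp add: Tp)
  qed
  have concave: "concave_on I (\<lambda>t. ?lc p (\<gamma> t))"
    if g: "condition_geodesic hyperbolic_space hyperbolic_metric {p} I \<gamma>" for I \<gamma>
  proof -
    have "convex_on I (\<lambda>t. ln (hyp_radius ((T \<circ> \<gamma>) t)))"
      by (rule condition_geodesic_convex[OF transfer(1)[OF g]])
    moreover have "ln (hyp_radius ((T \<circ> \<gamma>) t)) = - ?lc p (\<gamma> t)" if "t \<in> I" for t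
      using transfer(2)[OF g that] by simp
    ultimately show ?thesis
      unfolding concave_on_def by (rule convex_on_transform)
  qed
  have strict: "strictly_concave_at I (\<lambda>t. ?lc p (\<gamma> t)) t"
    if g: "condition_geodesic hyperbolic_space hyperbolic_metric {p} I \<gamma>" and t: "t \<in> I"
      and d: "(\<gamma> has_vector_derivative v) (at t within I)"
      and nd: "\<not> directed_along_segment hyperbolic_space hyperbolic_metric p (\<gamma> t) v" for I \<gamma> t v
  proof -
    have \<gamma>t: "\<gamma> t \<in> hyperbolic_space" using transfer(2)[OF g t] by simp
    have "((T \<circ> \<gamma>) has_vector_derivative T' (\<gamma> t) v) (at t within I)"
      by (rule vector_derivative_diff_chain_within[OF d])
        (rule has_derivative_at_withinI[OF hyperbolic_involutionD(3)[OF T \<gamma>t]])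
    moreover have "\<not> directed_along_segment hyperbolic_space hyperbolic_metric 0 ((T \<circ> \<gamma>) t) (T' (\<gamma> t) v)"
      using hyperbolic_involution_directed[OF T assms \<gamma>t] nd by (auto simp: Tp)
    ultimately have "strictly_concave_at I (\<lambda>t. - ln (hyp_radius ((T \<circ> \<gamma>) t))) t"
      using condition_geodesic_strict[OF transfer(1)[OF g] t] by blast
    then obtain \<epsilon> where \<epsilon>: "\<epsilon> > 0" "strictly_concave_on (I \<inter> ball t \<epsilon>) (\<lambda>t. - ln (hyp_radius ((T \<circ> \<gamma>) t)))"
      unfolding strictly_concave_at_def by (elim exE conjE)
    have "strictly_concave_on (I \<inter> ball t \<epsilon>) (\<lambda>t. ?lc p (\<gamma> t))"
      unfolding strictly_concave_on_def
    proof (intro conjI ballI allI impI)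
      show cv: "convex (I \<inter> ball t \<epsilon>)" using \<epsilon>(2) unfolding strictly_concave_on_def by simp
      fix x y a b :: real
      assume x: "x \<in> I \<inter> ball t \<epsilon>" and y: "y \<in> I \<inter> ball t \<epsilon>" and ab: "0 < a" "0 < b" "x \<noteq> y \<and> a + b = 1"
      have z: "a * x + b * y \<in> I"
        using convexD[OF cv x y, of a b] ab by simp
      show "a * ?lc p (\<gamma> x) + b * ?lc p (\<gamma> y) < ?lc p (\<gamma> (a * x + b * y))"
        using \<epsilon>(2) x y ab transfer(2)[OF g, of x] transfer(2)[OF g, of y] transfer(2)[OF g z]
        unfolding strictly_concave_on_def by simp
    qed
    then show ?thesis unfolding strictly_concave_at_def using \<epsilon>(1) by blast
  qed
  have not_convex: "\<not> self_convexity hyperbolic_space (hyperbolic_metric :: 'a metric_field) {p}" if dim: "2 \<le> DIM('a)"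
  proof
    assume sc: "self_convexity hyperbolic_space (hyperbolic_metric :: 'a metric_field) {p}"
    obtain \<gamma> :: "real \<Rightarrow> 'a" where \<gamma>: "condition_geodesic hyperbolic_space hyperbolic_metric {0} {0..1/2} \<gamma>"
      "\<not> convex_on {0..1/2} (\<lambda>t. - ln (hyp_radius (\<gamma> t)))"
      by (rule nonradial_condition_geodesic_exists[OF dim], rule that)
    have g: "condition_geodesic hyperbolic_space hyperbolic_metric {p} {0..1/2} (T \<circ> \<gamma>)"
      using hyperbolic_involution_geodesic[OF T 0 \<gamma>(1)] unfolding Tp .
    have "convex_on {0..1/2} (\<lambda>t. ?lc p ((T \<circ> \<gamma>) t))"
      by (rule sc[unfolded self_convexity_def, rule_format, OF g])
    moreover have "?lc p ((T \<circ> \<gamma>) t) = - ln (hyp_radius (\<gamma> t))" if "t \<in> {0..1/2}" for t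
    proof -
      have "\<gamma> ` {0..1/2} \<subseteq> hyperbolic_space - {0}"
        using \<gamma>(1) unfolding condition_geodesic_def geodesic_def by simp
      then have \<gamma>t: "\<gamma> t \<in> hyperbolic_space - {0}" using that by (rule subsetD[OF _ imageI])
      then show ?thesis
        using hyperbolic_involution_log_condition[OF T _ 0, of "\<gamma> t"] log_condition_0[OF \<gamma>t] by (simp add: Tp)
    qed
    ultimately have "convex_on {0..1/2} (\<lambda>t. - ln (hyp_radius (\<gamma> t)))"
      by (rule convex_on_transform)
    with \<gamma>(2) show False ..
  qed
  show ?thesis
  proof (intro conjI allI impI ballI)
    fix I \<gamma> assume g: "condition_geodesic hyperbolic_space hyperbolic_metric {p} I \<gamma>"
    show "concave_on I (\<lambda>t. ?lc p (\<gamma> t))" by (rule concave[OF g])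
    fix t v assume t: "t \<in> I" and v: "(\<gamma> has_vector_derivative v) (at t within I) \<and>
      \<not> directed_along_segment hyperbolic_space hyperbolic_metric p (\<gamma> t) v"
    show "strictly_concave_at I (\<lambda>t. ?lc p (\<gamma> t)) t" by (rule strict[OF g t conjunct1[OF v] conjunct2[OF v]])
  qed (rule not_convex)
qed

end
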